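(* Let $R$ be a commutative ring satisfying $SR_k$ for some $k\ge2$, and let $n\ge1$. Then the partial basis complex $\mathcal{B}_n(R)$ is $(n-k)$-connected. If $k=2$, then $\mathcal{B}_n(R)$ is Cohen–Macaulay (of dimension $n-1$).
   Context: $R$ satisfies $SR_k$ ($k\ge2$) if for every $r_1,\dots,r_k\in R$ generating the unit ideal there are $t_1,\dots,t_{k-1}\in R$ such that $r_1-t_1r_k,\dots,r_{k-1}-t_{k-1}r_k$ generate the unit ideal. The partial basis complex $\mathcal{B}_n(R)$ is the simplicial complex whose vertices are the vectors of $R^n$ contained in some basis of $R^n$, with $\{v_1,\dots,v_{p+1}\}$ a $p$-simplex iff it can be completed to a basis of $R^n$. A complex $X$ is $d$-spherical if it is $d$-dimensional and $(d-1)$-connected; it is Cohen–Macaulay of dimension $d$ if it is $d$-spherical and the link of every $p$-simplex is $(d-p-1)$-spherical. *)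

theory Defs
  imports "HOL-Analysis.Analysis"
begin

definition gen_unit_ideal :: "nat \<Rightarrow> (nat \<Rightarrow> 'a::comm_ring_1) \<Rightarrow> bool" where
  "gen_unit_ideal m r \<longleftrightarrow> (\<exists>a. (\<Sum>i<m. a i * r i) = 1)"

text \<open>SR_k (indices shifted: r_1,...,r_k become r 0, ..., r (k-1)).\<close>
definition SR :: "'a::comm_ring_1 itself \<Rightarrow> nat \<Rightarrow> bool" where
  "SR _ k \<longleftrightarrow> (\<forall>r::nat \<Rightarrow> 'a. gen_unit_ideal k r \<longrightarrow>
       (\<exists>t. gen_unit_ideal (k - 1) (\<lambda>i. r i - t i * r (k - 1))))"

text \<open>R^n is represented as the functions nat => R vanishing outside {0..<n}.\<close>
definition vecs :: "nat \<Rightarrow> (nat \<Rightarrow> 'a::comm_ring_1) set" where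
  "vecs n = {v. \<forall>i\<ge>n. v i = 0}"

definition lincomb :: "((nat \<Rightarrow> 'a::comm_ring_1) \<Rightarrow> 'a) \<Rightarrow> (nat \<Rightarrow> 'a) set \<Rightarrow> nat \<Rightarrow> 'a" where
  "lincomb c B = (\<lambda>i. \<Sum>b\<in>B. c b * b i)"

definition is_basis :: "nat \<Rightarrow> (nat \<Rightarrow> 'a::comm_ring_1) set \<Rightarrow> bool" where
  "is_basis n B \<longleftrightarrow> finite B \<and> B \<subseteq> vecs n
     \<and> (\<forall>w\<in>vecs n. \<exists>c. w = lincomb c B)
     \<and> (\<forall>c. lincomb c B = (\<lambda>i. 0) \<longrightarrow> (\<forall>b\<in>B. c b = 0))"

text \<open>A simplicial complex is represented by its set of simplices (finite nonempty
  vertex sets, closed under passing to nonempty subsets).\<close>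

definition partial_basis_complex :: "nat \<Rightarrow> (nat \<Rightarrow> 'a::comm_ring_1) set set" where
  "partial_basis_complex n = {\<sigma>. \<sigma> \<noteq> {} \<and> finite \<sigma> \<and> (\<exists>B. is_basis n B \<and> \<sigma> \<subseteq> B)}"

definition link :: "'v set set \<Rightarrow> 'v set \<Rightarrow> 'v set set" where
  "link K \<sigma> = {\<tau>\<in>K. \<tau> \<inter> \<sigma> = {} \<and> \<tau> \<union> \<sigma> \<in> K}"

definition cx_dim :: "'v set set \<Rightarrow> int \<Rightarrow> bool" where
  "cx_dim K d \<longleftrightarrow> (\<forall>\<sigma>\<in>K. int (card \<sigma>) \<le> d + 1)
     \<and> (if K = {} then d = -1 else (\<exists>\<sigma>\<in>K. int (card \<sigma>) = d + 1))"

definition closed_simplex :: "'v set \<Rightarrow> ('v \<Rightarrow> real) set" where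
  "closed_simplex \<sigma> = {\<alpha>. (\<forall>v. 0 \<le> \<alpha> v) \<and> (\<forall>v. v \<notin> \<sigma> \<longrightarrow> \<alpha> v = 0) \<and> sum \<alpha> \<sigma> = 1}"

definition realization_set :: "'v set set \<Rightarrow> ('v \<Rightarrow> real) set" where
  "realization_set K = (\<Union>\<sigma>\<in>K. closed_simplex \<sigma>)"

text \<open>Each closed simplex carries its Euclidean topology (subspace of the product topology,
  which agrees with the Euclidean one since sigma is finite); the realization carries the
  weak (coherent) topology: U is open iff its trace on each closed simplex is open.\<close>
definition realization :: "'v set set \<Rightarrow> ('v \<Rightarrow> real) topology" where
  "realization K = topology (\<lambda>U. U \<subseteq> realization_set K \<and>
      (\<forall>\<sigma>\<in>K. openin (subtopology (powertop_real UNIV) (closed_simplex \<sigma>)) (U \<inter> closed_simplex \<sigma>)))"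

lemma istopology_realization:
  fixes K :: "'a set set"
  shows "istopology (\<lambda>U. U \<subseteq> realization_set K \<and>
      (\<forall>\<sigma>\<in>K. openin (subtopology (powertop_real UNIV) (closed_simplex \<sigma>)) (U \<inter> closed_simplex \<sigma>)))"
  unfolding istopology_def
proof (intro conjI allI impI ballI; (elim conjE)?)
  fix S T :: "('a \<Rightarrow> real) set"
  assume hS: "S \<subseteq> realization_set K" "\<forall>\<sigma>\<in>K. openin (subtopology (powertop_real UNIV) (closed_simplex \<sigma>)) (S \<inter> closed_simplex \<sigma>)"
    and hT: "T \<subseteq> realization_set K" "\<forall>\<sigma>\<in>K. openin (subtopology (powertop_real UNIV) (closed_simplex \<sigma>)) (T \<inter> closed_simplex \<sigma>)"
  then show "S \<inter> T \<subseteq> realization_set K" by blast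
  fix \<sigma> assume "\<sigma> \<in> K"
  then have "openin (subtopology (powertop_real UNIV) (closed_simplex \<sigma>)) ((S \<inter> closed_simplex \<sigma>) \<inter> (T \<inter> closed_simplex \<sigma>))"
    using hS(2) hT(2) by (meson openin_Int)
  then show "openin (subtopology (powertop_real UNIV) (closed_simplex \<sigma>)) (S \<inter> T \<inter> closed_simplex \<sigma>)"
    by (simp add: Int_ac)
next
  fix \<F> :: "('a \<Rightarrow> real) set set"
  assume H: "\<forall>S\<in>\<F>. S \<subseteq> realization_set K \<and>
      (\<forall>\<sigma>\<in>K. openin (subtopology (powertop_real UNIV) (closed_simplex \<sigma>)) (S \<inter> closed_simplex \<sigma>))"
  then show "\<Union>\<F> \<subseteq> realization_set K" by blast
  fix \<sigma> assume "\<sigma> \<in> K"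
  have "\<Union>\<F> \<inter> closed_simplex \<sigma> = \<Union>((\<lambda>S. S \<inter> closed_simplex \<sigma>) ` \<F>)" by blast
  moreover have "openin (subtopology (powertop_real UNIV) (closed_simplex \<sigma>)) (\<Union>((\<lambda>S. S \<inter> closed_simplex \<sigma>) ` \<F>))"
    using H \<open>\<sigma> \<in> K\<close> by (intro openin_Union) blast
  ultimately show "openin (subtopology (powertop_real UNIV) (closed_simplex \<sigma>)) (\<Union>\<F> \<inter> closed_simplex \<sigma>)" by simp
qed

definition d_connected_space :: "int \<Rightarrow> 'b topology \<Rightarrow> bool" where
  "d_connected_space d X \<longleftrightarrow> (d \<ge> -1 \<longrightarrow> topspace X \<noteq> {})
     \<and> (\<forall>m::nat. int m \<le> d \<longrightarrow> (\<forall>f. continuous_map (nsphere m) X f \<longrightarrow>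
           (\<exists>c\<in>topspace X. homotopic_with (\<lambda>_. True) (nsphere m) X f (\<lambda>_. c))))"

definition cx_connected :: "int \<Rightarrow> 'v set set \<Rightarrow> bool" where
  "cx_connected d K \<longleftrightarrow> d_connected_space d (realization K)"

definition spherical :: "int \<Rightarrow> 'v set set \<Rightarrow> bool" where
  "spherical d K \<longleftrightarrow> cx_dim K d \<and> cx_connected (d - 1) K"

text \<open>A p-simplex has p+1 vertices.\<close>
definition cohen_macaulay :: "int \<Rightarrow> 'v set set \<Rightarrow> bool" where
  "cohen_macaulay d K \<longleftrightarrow> spherical d K
     \<and> (\<forall>\<sigma>\<in>K. spherical (d - (int (card \<sigma>) - 1) - 1) (link K \<sigma>))"

end

theory Submission
  imports Defs "HOL-Library.Function_Algebras"
begin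

text \<open>Call a finite set of vectors of \<open>R\<^sup>n\<close> unimodular if it has a dual family of linear functionals.
  By \<open>SR\<^sub>k\<close> a unimodular set with at most \<open>n - k + 1\<close> elements extends to a basis. Following
  van der Kallen, the complex \<open>U\<close> of unimodular sets with at most \<open>n - k + 2\<close> elements, and all its links,
  have the expected connectivity: by induction on \<open>n\<close> one first treats the vertices whose last coordinate
  is \<open>0\<close> or \<open>1\<close> and then adds the remaining vertices. The only gluing fact needed is that attaching a cone
  over a \<open>(d-1)\<close>-connected link preserves \<open>d\<close>-connectivity, which is proved by subdividing the boundary of a
  cube into a fine grid. The simplices of \<open>U\<close> that are not partial bases all have exactly
  \<open>n - k + 2\<close> vertices, and their boundaries bound cones of partial bases; hence \<open>U\<close> retracts onto the
  partial bases it contains. The larger partial bases have too high a dimension to matter.\<close>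

section \<open>Simplices and finitely supported maps\<close>

text \<open>The induction is run on unimodular sets because a partial basis of \<open>M\<close>
  lying in the kernel of a functional need not be completable inside that kernel, whereas dual
  functionals simply restrict. The projection \<open>y - c y \<odot> v\<close> along a vector
  \<open>v\<close> with \<open>c v = 1\<close> turns the part of a link around \<open>v\<close> that
  lies in the kernel of \<open>c\<close> into a link in rank one less. The obstacle is to keep this
  compatible with the slab \<open>\<phi> \<in> {0, 1}\<close>. For a vertex with
  \<open>\<phi> v = 1\<close> the functional \<open>\<phi>\<close> itself serves as
  \<open>c\<close>; otherwise the stable range condition yields some \<open>c\<close> whose kernel
  still contains a vector \<open>e'\<close> with \<open>\<phi> e' = 1\<close>, so that the kernel
  has a slab of its own. Height 1 is there for the sake of a cone point \<open>e\<close>; taking all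
  vectors of height 1 instead of \<open>e\<close> alone makes the slab independent of the choice of
  \<open>e'\<close>. Simplices of too high dimension are attached by coning their boundaries with a
  fresh vertex of the same type, so every module must leave out some vector of the ambient
  space.\<close>

definition abstract_complex :: "'v set set \<Rightarrow> bool" where
  "abstract_complex K \<longleftrightarrow> (\<forall>\<sigma>\<in>K. finite \<sigma> \<and> \<sigma> \<noteq> {} \<and> (\<forall>\<tau>. \<tau> \<subseteq> \<sigma> \<and> \<tau> \<noteq> {} \<longrightarrow> \<tau> \<in> K))"

definition induced :: "'v set set \<Rightarrow> 'v set \<Rightarrow> 'v set set" where
  "induced K W = {\<sigma>\<in>K. \<sigma> \<subseteq> W}"

definition support :: "('v \<Rightarrow> real) \<Rightarrow> 'v set" where
  "support \<alpha> = {v. \<alpha> v \<noteq> 0}"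

definition vertex_point :: "'v \<Rightarrow> 'v \<Rightarrow> real" where
  "vertex_point v = (\<lambda>w. if w = v then 1 else 0)"

lemma abstract_complexD:
  assumes "abstract_complex K" "\<sigma> \<in> K"
  shows "finite \<sigma>" "\<sigma> \<noteq> {}" "\<tau> \<subseteq> \<sigma> \<Longrightarrow> \<tau> \<noteq> {} \<Longrightarrow> \<tau> \<in> K"
  using assms unfolding abstract_complex_def by blast+

lemma abstract_complex_induced: "abstract_complex K \<Longrightarrow> abstract_complex (induced K W)"
  unfolding abstract_complex_def induced_def by blast

lemma abstract_complex_link:
  assumes "abstract_complex K" shows "abstract_complex (link K \<sigma>)"
  unfolding abstract_complex_def
proof (intro ballI conjI allI impI)
  fix \<rho> assume r: "\<rho> \<in> link K \<sigma>"
  then have r': "\<rho> \<in> K" "\<rho> \<inter> \<sigma> = {}" "\<rho> \<union> \<sigma> \<in> K" by (auto simp: link_def)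
  show "finite \<rho>" "\<rho> \<noteq> {}" using abstract_complexD[OF assms r'(1)] by auto
  fix \<tau> assume t: "\<tau> \<subseteq> \<rho> \<and> \<tau> \<noteq> {}"
  show "\<tau> \<in> link K \<sigma>"
    using t r' abstract_complexD(3)[OF assms r'(1), of \<tau>] abstract_complexD(3)[OF assms r'(3), of "\<tau> \<union> \<sigma>"]
    by (auto simp: link_def)
qed

lemma closed_simplex_mono:
  assumes "finite \<tau>" "\<sigma> \<subseteq> \<tau>" "\<alpha> \<in> closed_simplex \<sigma>"
  shows "\<alpha> \<in> closed_simplex \<tau>"
proof -
  have "sum \<alpha> \<sigma> = sum \<alpha> \<tau>"
    using assms by (intro sum.mono_neutral_left) (auto simp: closed_simplex_def)
  then show ?thesis using assms unfolding closed_simplex_def by auto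
qed

lemma closed_simplex_support:
  assumes "finite \<sigma>" "\<alpha> \<in> closed_simplex \<sigma>"
  shows "\<alpha> \<in> closed_simplex (support \<alpha>)" "support \<alpha> \<subseteq> \<sigma>" "support \<alpha> \<noteq> {}"
proof -
  show s: "support \<alpha> \<subseteq> \<sigma>" using assms by (auto simp: closed_simplex_def support_def)
  have "sum \<alpha> (support \<alpha>) = sum \<alpha> \<sigma>"
    using assms s by (intro sum.mono_neutral_left) (auto simp: support_def)
  then have 1: "sum \<alpha> (support \<alpha>) = 1" using assms by (auto simp: closed_simplex_def)
  show "\<alpha> \<in> closed_simplex (support \<alpha>)"
    using assms 1 by (auto simp: closed_simplex_def support_def)
  show "support \<alpha> \<noteq> {}" using 1 by auto
qed

lemma closed_simplex_convex:
  assumes "\<alpha> \<in> closed_simplex \<sigma>" "\<beta> \<in> closed_simplex \<sigma>" "0 \<le> t" "t \<le> 1"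
  shows "(\<lambda>v. (1 - t) * \<alpha> v + t * \<beta> v) \<in> closed_simplex \<sigma>"
  using assms by (auto simp: closed_simplex_def sum.distrib sum_distrib_left[symmetric])

lemma vertex_point_in: "finite \<sigma> \<Longrightarrow> v \<in> \<sigma> \<Longrightarrow> vertex_point v \<in> closed_simplex \<sigma>"
  by (auto simp: closed_simplex_def vertex_point_def)

lemma closed_simplex_le_1: "finite \<sigma> \<Longrightarrow> \<alpha> \<in> closed_simplex \<sigma> \<Longrightarrow> \<alpha> v \<le> 1"
proof (cases "v \<in> \<sigma>")
  case True
  assume "finite \<sigma>" "\<alpha> \<in> closed_simplex \<sigma>"
  then show ?thesis using True member_le_sum[of v \<sigma> \<alpha>] by (auto simp: closed_simplex_def)
qed (auto simp: closed_simplex_def)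

text \<open>The support of a point is its carrier; closure under faces puts it into
  \<open>K\<close>, so that no simplex around the point has to be chosen.\<close>

lemma realization_set_iff:
  assumes "abstract_complex K"
  shows "\<alpha> \<in> realization_set K \<longleftrightarrow> support \<alpha> \<in> K \<and> \<alpha> \<in> closed_simplex (support \<alpha>)"
proof
  assume "\<alpha> \<in> realization_set K"
  then obtain \<sigma> where s: "\<sigma> \<in> K" "\<alpha> \<in> closed_simplex \<sigma>" by (auto simp: realization_set_def)
  note f = abstract_complexD[OF assms s(1)]
  show "support \<alpha> \<in> K \<and> \<alpha> \<in> closed_simplex (support \<alpha>)"
    using closed_simplex_support[OF f(1) s(2)] f(3) by auto
qed (auto simp: realization_set_def)

lemma realization_set_induced_iff:
  assumes "abstract_complex K"
  shows "\<alpha> \<in> realization_set (induced K W) \<longleftrightarrow>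
    support \<alpha> \<in> K \<and> support \<alpha> \<subseteq> W \<and> \<alpha> \<in> closed_simplex (support \<alpha>)"
  using realization_set_iff[OF abstract_complex_induced[OF assms]]
  by (auto simp: induced_def)

lemma realization_set_mono: "K \<subseteq> L \<Longrightarrow> realization_set K \<subseteq> realization_set L"
  by (auto simp: realization_set_def)

lemma induced_mono: "K \<subseteq> L \<Longrightarrow> V \<subseteq> W \<Longrightarrow> induced K V \<subseteq> induced L W"
  by (auto simp: induced_def)

definition finite_map :: "'v set set \<Rightarrow> 'x::topological_space set \<Rightarrow> ('x \<Rightarrow> 'v \<Rightarrow> real) \<Rightarrow> bool" where
  "finite_map K S f \<longleftrightarrow> continuous_on S f \<and> (\<exists>W. finite W \<and> f ` S \<subseteq> realization_set (induced K W))"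

lemma finite_map_mono:
  assumes "finite_map K S f" "K \<subseteq> L" shows "finite_map L S f"
proof -
  obtain W where "finite W" "f ` S \<subseteq> realization_set (induced K W)" "continuous_on S f"
    using assms unfolding finite_map_def by blast
  moreover have "realization_set (induced K W) \<subseteq> realization_set (induced L W)"
    by (rule realization_set_mono[OF induced_mono[OF assms(2) order_refl]])
  ultimately show ?thesis unfolding finite_map_def by blast
qed

lemma finite_mapI:
  assumes "abstract_complex K" "continuous_on S f" "finite W"
    and "\<And>x. x \<in> S \<Longrightarrow> f x \<in> realization_set K" "\<And>x. x \<in> S \<Longrightarrow> support (f x) \<subseteq> W"
  shows "finite_map K S f"
  unfolding finite_map_def using assms
  by (auto simp: realization_set_induced_iff[OF assms(1)] realization_set_iff[OF assms(1)] intro!: exI[of _ W])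

lemma finite_mapE:
  assumes "finite_map K S f" "abstract_complex K"
  obtains W where "finite W" "continuous_on S f" "\<And>x. x \<in> S \<Longrightarrow> f x \<in> realization_set K"
    "\<And>x. x \<in> S \<Longrightarrow> support (f x) \<subseteq> W"
proof -
  obtain W where W: "finite W" "f ` S \<subseteq> realization_set (induced K W)" "continuous_on S f"
    using assms unfolding finite_map_def by blast
  then have "f x \<in> realization_set (induced K W)" if "x \<in> S" for x using that by blast
  then show ?thesis using W that
    by (auto simp: realization_set_induced_iff[OF assms(2)] realization_set_iff[OF assms(2)])
qed

section \<open>Cubes and connectivity\<close>

definition cube :: "nat set \<Rightarrow> (nat \<Rightarrow> real) set" where
  "cube I = {x. (\<forall>i\<in>I. \<bar>x i\<bar> \<le> 1) \<and> (\<forall>i. i \<notin> I \<longrightarrow> x i = 0)}"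

definition cube_boundary :: "nat set \<Rightarrow> (nat \<Rightarrow> real) set" where
  "cube_boundary I = {x \<in> cube I. \<exists>i\<in>I. \<bar>x i\<bar> = 1}"

text \<open>The inserted 0 keeps the maximum defined for empty \<open>I\<close>, where the cube is a
  point and its boundary is empty.\<close>

definition max_norm :: "nat set \<Rightarrow> (nat \<Rightarrow> real) \<Rightarrow> real" where
  "max_norm I x = Max (insert 0 ((\<lambda>i. \<bar>x i\<bar>) ` I))"

text \<open>Connectivity of the realization, expressed by maps that hit only finitely many simplices.
  For such maps continuity in the weak topology is continuity of the barycentric coordinates.
  Indexing cubes by finite sets of coordinates lets faces of cubes be cubes again.\<close>

definition cconn :: "int \<Rightarrow> 'v set set \<Rightarrow> bool" where
  "cconn d K \<longleftrightarrow> (\<forall>I f. finite I \<longrightarrow> int (card I) \<le> d + 1 \<longrightarrow> finite_map K (cube_boundary I) f \<longrightarrow>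
     (\<exists>g. finite_map K (cube I) g \<and> (\<forall>x\<in>cube_boundary I. g x = f x)))"

lemma cconnI:
  assumes "\<And>I f. finite I \<Longrightarrow> int (card I) \<le> d + 1 \<Longrightarrow> finite_map K (cube_boundary I) f \<Longrightarrow>
     \<exists>g. finite_map K (cube I) g \<and> (\<forall>x\<in>cube_boundary I. g x = f x)"
  shows "cconn d K"
  using assms unfolding cconn_def by blast

lemma cconnE:
  assumes "cconn d K" "finite I" "int (card I) \<le> d + 1" "finite_map K (cube_boundary I) f"
  obtains g where "finite_map K (cube I) g" "\<And>x. x \<in> cube_boundary I \<Longrightarrow> g x = f x"
  using assms unfolding cconn_def by blast

lemma cconn_le: "cconn d K \<Longrightarrow> e \<le> d \<Longrightarrow> cconn e K"
  unfolding cconn_def by force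

lemma cconn_trivial: "d \<le> -2 \<Longrightarrow> cconn d K"
  unfolding cconn_def by auto

lemma cube_boundary_subset: "cube_boundary I \<subseteq> cube I"
  by (auto simp: cube_boundary_def)

section \<open>Sup norm, closedness and compactness of cubes\<close>

lemma continuous_on_Max_insert:
  fixes f :: "'i \<Rightarrow> 'x::topological_space \<Rightarrow> real"
  assumes "finite I" "\<And>i. i \<in> I \<Longrightarrow> continuous_on S (f i)" "continuous_on S g"
  shows "continuous_on S (\<lambda>x. Max (insert (g x) ((\<lambda>i. f i x) ` I)))"
  using assms(1,2)
proof (induction I rule: finite_induct)
  case empty then show ?case using assms(3) by simp
next
  case (insert i I)
  have "Max (insert (g x) ((\<lambda>i. f i x) ` insert i I)) = max (f i x) (Max (insert (g x) ((\<lambda>i. f i x) ` I)))" for x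
    using insert.hyps by (simp add: insert_commute[of "g x"])
  then show ?case using insert by (simp add: continuous_on_max)
qed

lemma continuous_on_apply: "continuous_on S (\<lambda>x :: 'i \<Rightarrow> real. x i)"
  by (rule continuous_on_product_coordinates[THEN continuous_on_subset]) auto

lemma continuous_on_max_norm: "finite I \<Longrightarrow> continuous_on S (max_norm I)"
  unfolding max_norm_def
  by (rule continuous_on_Max_insert) (auto intro!: continuous_intros continuous_on_apply)

lemma max_norm_ge: "finite I \<Longrightarrow> i \<in> I \<Longrightarrow> \<bar>x i\<bar> \<le> max_norm I x"
  unfolding max_norm_def by (rule Max_ge) auto

lemma max_norm_nonneg: "finite I \<Longrightarrow> 0 \<le> max_norm I x"
  unfolding max_norm_def by (rule Max_ge) auto

lemma max_norm_cases:
  assumes "finite I"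
  shows "max_norm I x = 0 \<or> (\<exists>i\<in>I. max_norm I x = \<bar>x i\<bar>)"
proof -
  have "max_norm I x \<in> insert 0 ((\<lambda>i. \<bar>x i\<bar>) ` I)"
    unfolding max_norm_def using assms by (intro Max_in) auto
  then show ?thesis by auto
qed

lemma max_norm_scale:
  assumes "finite I" "0 \<le> c" shows "max_norm I (\<lambda>i. c * x i) = c * max_norm I x"
proof (rule antisym)
  show "max_norm I (\<lambda>i. c * x i) \<le> c * max_norm I x"
    using max_norm_cases[OF assms(1), of "\<lambda>i. c * x i"] max_norm_ge[OF assms(1), of _ x]
      max_norm_nonneg[OF assms(1)] assms(2)
    by (auto simp: abs_mult intro!: mult_left_mono)
  show "c * max_norm I x \<le> max_norm I (\<lambda>i. c * x i)"
    using max_norm_cases[OF assms(1), of x] max_norm_ge[OF assms(1), of _ "\<lambda>i. c * x i"]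
      max_norm_nonneg[OF assms(1)] assms(2)
    by (auto simp: abs_mult)
qed

lemma cube_iff_max_norm:
  assumes "finite I" shows "x \<in> cube I \<longleftrightarrow> max_norm I x \<le> 1 \<and> (\<forall>i. i \<notin> I \<longrightarrow> x i = 0)"
  using max_norm_ge[OF assms, of _ x] max_norm_cases[OF assms, of x] unfolding cube_def
  by fastforce

lemma cube_boundary_iff_max_norm:
  assumes "finite I" shows "x \<in> cube_boundary I \<longleftrightarrow> max_norm I x = 1 \<and> (\<forall>i. i \<notin> I \<longrightarrow> x i = 0)"
proof -
  have "(\<exists>i\<in>I. \<bar>x i\<bar> = 1) \<longleftrightarrow> max_norm I x = 1" if "max_norm I x \<le> 1"
    using that max_norm_ge[OF assms, of _ x] max_norm_cases[OF assms, of x] by fastforce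
  then show ?thesis unfolding cube_boundary_def using cube_iff_max_norm[OF assms] by auto
qed

lemma closed_cube: "closed (cube I)"
proof -
  have "cube I = (\<Inter>i. {x. \<bar>x i\<bar> \<le> (if i \<in> I then 1 else 0)})"
    by (auto simp: cube_def split: if_splits)
  moreover have "closed {x :: nat \<Rightarrow> real. \<bar>x i\<bar> \<le> c}" for i and c :: real
    by (rule closed_Collect_le) (auto intro!: continuous_intros continuous_on_apply)
  ultimately show ?thesis by auto
qed

lemma closed_cube_boundary: "finite I \<Longrightarrow> closed (cube_boundary I)"
proof -
  assume "finite I"
  then have "cube_boundary I = cube I \<inter> {x. max_norm I x = 1}"
    using cube_boundary_iff_max_norm cube_iff_max_norm by auto
  then show ?thesis
    using closed_cube \<open>finite I\<close>
    by (auto intro!: closed_Int closed_Collect_eq continuous_on_max_norm)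
qed

lemma compact_cube: "compact (cube I)"
proof -
  have "\<bar>x i\<bar> \<le> 1" if "x \<in> cube I" for x i using that by (cases "i \<in> I") (auto simp: cube_def)
  then have "cube I \<subseteq> (\<Pi>\<^sub>E i\<in>UNIV. {-1..1})" by (auto simp: abs_le_iff minus_le_iff)
  moreover have "compact (\<Pi>\<^sub>E i\<in>(UNIV::nat set). {-1..1::real})"
  proof -
    have "compactin (product_topology (\<lambda>i::nat. euclidean) UNIV) (\<Pi>\<^sub>E i\<in>(UNIV::nat set). {-1..1::real})"
      by (simp add: compactin_PiE)
    then show ?thesis by (simp add: euclidean_product_topology)
  qed
  ultimately show ?thesis using closed_cube by (metis compact_Int_closed inf.absorb_iff2)
qed

lemma compact_cube_boundary: "finite I \<Longrightarrow> compact (cube_boundary I)"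
  using compact_cube closed_cube_boundary cube_boundary_subset
  by (metis compact_Int_closed inf.absorb_iff2)

section \<open>Homotopy extension and cones\<close>

text \<open>Homotopy extension by a collar. The cube of half size carries \<open>g'\<close> rescaled
  by 2, and the shell around it runs along straight segments from \<open>f'\<close> to
  \<open>f\<close> with parameter \<open>2 * m x - 1\<close>; \<open>line\<close> keeps each segment
  inside one simplex. It serves to replace a boundary map by one that is easier to fill.\<close>

lemma straight_homotopy:
  assumes K: "abstract_complex K" and I: "finite I"
    and f: "finite_map K (cube_boundary I) f" and f': "finite_map K (cube_boundary I) f'"
    and line: "\<And>x. x \<in> cube_boundary I \<Longrightarrow> \<exists>\<sigma>\<in>K. f x \<in> closed_simplex \<sigma> \<and> f' x \<in> closed_simplex \<sigma>"
    and g': "finite_map K (cube I) g'" "\<And>x. x \<in> cube_boundary I \<Longrightarrow> g' x = f' x"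
  shows "\<exists>g. finite_map K (cube I) g \<and> (\<forall>x\<in>cube_boundary I. g x = f x)"
proof -
  define m where "m = max_norm I"
  obtain W1 where W1: "finite W1" "continuous_on (cube_boundary I) f"
    "\<And>x. x \<in> cube_boundary I \<Longrightarrow> support (f x) \<subseteq> W1"
    using finite_mapE[OF f K] by metis
  obtain W2 where W2: "finite W2" "continuous_on (cube_boundary I) f'"
    "\<And>x. x \<in> cube_boundary I \<Longrightarrow> support (f' x) \<subseteq> W2"
    using finite_mapE[OF f' K] by metis
  obtain W3 where W3: "finite W3" "continuous_on (cube I) g'"
    "\<And>x. x \<in> cube I \<Longrightarrow> g' x \<in> realization_set K" "\<And>x. x \<in> cube I \<Longrightarrow> support (g' x) \<subseteq> W3"
    using finite_mapE[OF g'(1) K] by metis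
  define S1 where "S1 = {x \<in> cube I. m x \<le> 1/2}"
  define S2 where "S2 = {x \<in> cube I. 1/2 \<le> m x}"
  define y where "y x = (\<lambda>i. (1 / m x) * x i)" for x :: "nat \<Rightarrow> real"
  define h where "h x = (\<lambda>v. (1 - (2 * m x - 1)) * f' (y x) v + (2 * m x - 1) * f (y x) v)" for x
  define g where "g x = (if m x \<le> 1/2 then g' (\<lambda>i. 2 * x i) else h x)" for x
  have mcont: "continuous_on S m" for S unfolding m_def using continuous_on_max_norm[OF I] .
  have cl1: "closedin (top_of_set (S1 \<union> S2)) S1"
  proof -
    have "closed S1" unfolding S1_def
      by (intro closed_Collect_conj closed_Collect_le mcont continuous_on_const) (simp add: closed_cube)
    then show ?thesis by (meson closed_subset sup_ge1)
  qed
  have cl2: "closedin (top_of_set (S1 \<union> S2)) S2"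
  proof -
    have "closed S2" unfolding S2_def
      by (intro closed_Collect_conj closed_Collect_le mcont continuous_on_const) (simp add: closed_cube)
    then show ?thesis by (meson closed_subset sup_ge2)
  qed
  have y: "y x \<in> cube_boundary I" if "x \<in> S2" for x
  proof -
    have "max_norm I (y x) = 1"
      using that max_norm_scale[OF I, of "1 / m x" x] unfolding S2_def y_def m_def by auto
    then show ?thesis using that unfolding cube_boundary_iff_max_norm[OF I]
      by (auto simp: y_def S2_def cube_def)
  qed
  have ycont: "continuous_on S2 y"
    unfolding y_def
    by (intro continuous_on_coordinatewise_then_product continuous_intros continuous_on_apply mcont)
      (auto simp: S2_def)
  have fy: "continuous_on S2 (\<lambda>x. f (y x))" "continuous_on S2 (\<lambda>x. f' (y x))"
    using continuous_on_compose2[OF W1(2) ycont] continuous_on_compose2[OF W2(2) ycont] y by auto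
  have hcont: "continuous_on S2 h"
    unfolding h_def
    by (intro continuous_on_coordinatewise_then_product continuous_intros mcont
        fy[THEN continuous_on_product_then_coordinatewise])
  have dbl: "(\<lambda>i. 2 * x i) \<in> cube I" if "x \<in> S1" for x
    using that max_norm_scale[OF I, of 2 x] by (auto simp: S1_def cube_iff_max_norm[OF I] m_def)
  have dcont: "continuous_on S1 (\<lambda>x. g' (\<lambda>i. 2 * x i))"
    by (rule continuous_on_compose2[OF W3(2)])
      (use dbl in \<open>auto intro!: continuous_on_coordinatewise_then_product continuous_intros continuous_on_apply\<close>)
  have "continuous_on (S1 \<union> S2) g"
    unfolding g_def
  proof (rule continuous_on_cases_local[OF cl1 cl2 dcont hcont])
    fix x assume "x \<in> S1 \<and> \<not> m x \<le> 1/2 \<or> x \<in> S2 \<and> m x \<le> 1/2"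
    then have x: "x \<in> S2" "m x = 1/2" unfolding S1_def S2_def by auto
    then have "y x = (\<lambda>i. 2 * x i)" unfolding y_def x(2) by simp
    then show "g' (\<lambda>i. 2 * x i) = h x" unfolding h_def x(2) using y[OF x(1)] g'(2) by simp
  qed
  moreover have S12: "S1 \<union> S2 = cube I" unfolding S1_def S2_def by auto
  ultimately have gcont: "continuous_on (cube I) g" by simp
  have hin: "h x \<in> realization_set K \<and> support (h x) \<subseteq> W1 \<union> W2" if x: "x \<in> S2" for x
  proof
    obtain \<sigma> where s: "\<sigma> \<in> K" "f (y x) \<in> closed_simplex \<sigma>" "f' (y x) \<in> closed_simplex \<sigma>"
      using line[OF y[OF x]] by auto
    have "m x \<le> 1" "1/2 \<le> m x" using x by (auto simp: S2_def m_def cube_iff_max_norm[OF I])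
    then have "h x \<in> closed_simplex \<sigma>" unfolding h_def by (intro closed_simplex_convex s) auto
    then show "h x \<in> realization_set K" using s(1) by (auto simp: realization_set_def)
    have "support (h x) \<subseteq> support (f (y x)) \<union> support (f' (y x))"
      by (auto simp: h_def support_def)
    then show "support (h x) \<subseteq> W1 \<union> W2" using W1(3)[OF y[OF x]] W2(3)[OF y[OF x]] by auto
  qed
  have gin: "g x \<in> realization_set K \<and> support (g x) \<subseteq> W1 \<union> W2 \<union> W3" if x: "x \<in> cube I" for x
  proof (cases "m x \<le> 1/2")
    case True
    then show ?thesis using x W3(3,4)[OF dbl[of x]] by (auto simp: g_def S1_def)
  next
    case False
    then show ?thesis using x hin[of x] by (auto simp: g_def S2_def)
  qed
  have "finite_map K (cube I) g"
    by (rule finite_mapI[OF K gcont, of "W1 \<union> W2 \<union> W3"]) (use gin W1(1) W2(1) W3(1) in auto)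
  moreover have "g x = f x" if "x \<in> cube_boundary I" for x
  proof -
    have "m x = 1" using that cube_boundary_iff_max_norm[OF I] by (auto simp: m_def)
    then show ?thesis by (auto simp: g_def h_def y_def)
  qed
  ultimately show ?thesis by blast
qed

lemma finite_map_const:
  assumes "abstract_complex K" "{v} \<in> K"
  shows "finite_map K S (\<lambda>x. vertex_point v)"
proof (rule finite_mapI[OF assms(1), of _ _ "{v}"])
  show "vertex_point v \<in> realization_set K"
    using vertex_point_in[of "{v}" v] assms(2) by (auto simp: realization_set_def)
qed (auto simp: support_def vertex_point_def)

text \<open>Each support together with \<open>v\<close> is a simplex, so the segments to the
  constant map at \<open>v\<close> stay in the complex, and the constant map extends over the cube.
  This works in every degree \<open>d\<close>.\<close>

lemma cconn_cone:
  assumes K: "abstract_complex K" and v: "{v} \<in> K" "\<And>\<sigma>. \<sigma> \<in> K \<Longrightarrow> insert v \<sigma> \<in> K"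
  shows "cconn d K"
proof (rule cconnI)
  fix I f assume I: "finite I" and f: "finite_map K (cube_boundary I) f"
  show "\<exists>g. finite_map K (cube I) g \<and> (\<forall>x\<in>cube_boundary I. g x = f x)"
  proof (rule straight_homotopy[OF K I f finite_map_const[OF K v(1)] _ finite_map_const[OF K v(1)]])
    fix x assume "x \<in> cube_boundary I"
    then have "f x \<in> realization_set K" using f K by (elim finite_mapE) auto
    then have s: "support (f x) \<in> K" "f x \<in> closed_simplex (support (f x))"
      by (auto simp: realization_set_iff[OF K])
    have fin: "finite (insert v (support (f x)))" using abstract_complexD(1)[OF K s(1)] by auto
    show "\<exists>\<sigma>\<in>K. f x \<in> closed_simplex \<sigma> \<and> vertex_point v \<in> closed_simplex \<sigma>"
      using v(2)[OF s(1)] closed_simplex_mono[OF fin _ s(2)] vertex_point_in[OF fin, of v] by blast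
  qed auto
qed

lemma cconn_minus_one:
  assumes "abstract_complex K" "{v} \<in> K" shows "cconn (-1) K"
proof (rule cconnI)
  fix I :: "nat set" and f assume "finite I" "int (card I) \<le> -1 + 1"
  \<comment> \<open>\<open>I\<close> is empty here, so the claim is only that some map from a point
    exists.\<close>
  then have "cube_boundary I = {}" by (auto simp: cube_boundary_def)
  then show "\<exists>g. finite_map K (cube I) g \<and> (\<forall>x\<in>cube_boundary I. g x = f x)"
    using finite_map_const[OF assms] by auto
qed

section \<open>Extending maps over a cubical grid\<close>

text \<open>A cell is a pair of its free directions and its lower corner in units of
  \<open>1 / M\<close>. Cells of every dimension thus have one type, and a face arises by dropping a
  direction and possibly raising the corner there by 1.\<close>

definition grid_box :: "real \<Rightarrow> nat set \<times> (nat \<Rightarrow> int) \<Rightarrow> (nat \<Rightarrow> real) set" where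
  "grid_box M c = {x. (\<forall>i\<in>fst c. real_of_int (snd c i) \<le> M * x i \<and> M * x i \<le> real_of_int (snd c i) + 1)
     \<and> (\<forall>i. i \<notin> fst c \<longrightarrow> M * x i = real_of_int (snd c i))}"

definition grid_box_boundary :: "real \<Rightarrow> nat set \<times> (nat \<Rightarrow> int) \<Rightarrow> (nat \<Rightarrow> real) set" where
  "grid_box_boundary M c = {x \<in> grid_box M c. \<exists>i\<in>fst c. M * x i = real_of_int (snd c i) \<or> M * x i = real_of_int (snd c i) + 1}"

definition grid_faces :: "nat set \<times> (nat \<Rightarrow> int) \<Rightarrow> (nat set \<times> (nat \<Rightarrow> int)) set" where
  "grid_faces c = {(fst c - {i}, (snd c)(i := snd c i + \<delta>)) | i \<delta>. i \<in> fst c \<and> \<delta> \<in> {0, 1}}"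

lemma grid_face_subset: "c' \<in> grid_faces c \<Longrightarrow> grid_box M c' \<subseteq> grid_box M c"
  by (fastforce simp: grid_faces_def grid_box_def split: if_splits)

lemma grid_box_boundaryE:
  assumes "x \<in> grid_box_boundary M c"
  obtains c' where "c' \<in> grid_faces c" "x \<in> grid_box M c'"
proof -
  obtain i where i: "i \<in> fst c" "M * x i = real_of_int (snd c i) \<or> M * x i = real_of_int (snd c i) + 1"
    and x: "x \<in> grid_box M c" using assms by (auto simp: grid_box_boundary_def)
  obtain \<delta> where d: "\<delta> \<in> {0, 1::int}" "M * x i = real_of_int (snd c i + \<delta>)" using i(2) by fastforce
  have "x \<in> grid_box M (fst c - {i}, (snd c)(i := snd c i + \<delta>))"
    using x d(2) by (auto simp: grid_box_def)
  moreover have "(fst c - {i}, (snd c)(i := snd c i + \<delta>)) \<in> grid_faces c"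
    using i(1) d(1) unfolding grid_faces_def by blast
  ultimately show ?thesis using that by blast
qed

text \<open>At an interior point the free coordinates lie strictly between consecutive integers,
  hence they are free in \<open>c'\<close> too; the dimension bound then gives equal directions and
  equal corners. So a cell of maximal dimension meets the other cells only in its boundary.\<close>

lemma grid_box_Int:
  assumes "finite (fst c)" "card (fst c') \<le> card (fst c)" "finite (fst c')" "c \<noteq> c'"
    and x: "x \<in> grid_box M c" "x \<in> grid_box M c'"
  shows "x \<in> grid_box_boundary M c"
proof (rule ccontr)
  assume "x \<notin> grid_box_boundary M c"
  then have int: "real_of_int (snd c i) < M * x i \<and> M * x i < real_of_int (snd c i) + 1" if "i \<in> fst c" for i
    using that x(1) by (fastforce simp: grid_box_boundary_def grid_box_def)
  have in': "i \<in> fst c'" if "i \<in> fst c" for i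
  proof (rule ccontr)
    assume "i \<notin> fst c'"
    then have "M * x i = real_of_int (snd c' i)" using x(2) by (auto simp: grid_box_def)
    then have "real_of_int (snd c i) < real_of_int (snd c' i)" "real_of_int (snd c' i) < real_of_int (snd c i + 1)"
      using int[OF that] by auto
    then show False unfolding of_int_less_iff by linarith
  qed
  then have eq: "fst c = fst c'" using assms(2,3) by (meson card_seteq subsetI)
  have "snd c i = snd c' i" for i
  proof (cases "i \<in> fst c")
    case True
    have "real_of_int (snd c' i) \<le> M * x i \<and> M * x i \<le> real_of_int (snd c' i) + 1"
      using x(2) True eq by (auto simp: grid_box_def)
    then show ?thesis using int[OF True] by linarith
  next
    case False
    then have "M * x i = real_of_int (snd c i)" "M * x i = real_of_int (snd c' i)"
      using x eq by (auto simp: grid_box_def)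
    then show ?thesis by linarith
  qed
  then show False using eq assms(4) by (metis ext prod_eqI)
qed

lemma closed_grid_box: "closed (grid_box M c)"
proof -
  have "grid_box M c = (\<Inter>i. {x. real_of_int (snd c i) \<le> M * x i} \<inter>
      {x. M * x i \<le> real_of_int (snd c i) + (if i \<in> fst c then 1 else 0)})"
    by (force simp: grid_box_def split: if_splits)
  moreover have "closed {x :: nat \<Rightarrow> real. r \<le> M * x i}" "closed {x :: nat \<Rightarrow> real. M * x i \<le> r}" for i r
    by (rule closed_Collect_le; intro continuous_intros continuous_on_apply)+
  ultimately show ?thesis by (auto intro!: closed_INT closed_Int)
qed

text \<open>Transport of \<open>cconn\<close> from the cube to a box, by the affine bijection
  \<open>\<kappa>\<close> and its inverse \<open>\<iota>\<close>.\<close>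

lemma grid_box_extend:
  assumes M: "M > 0" and L: "cconn d L" and c: "finite (fst c)" "int (card (fst c)) \<le> d + 1"
    and g: "finite_map L (grid_box_boundary M c) g"
  obtains h where "finite_map L (grid_box M c) h" "\<And>x. x \<in> grid_box_boundary M c \<Longrightarrow> h x = g x"
proof -
  define J a where "J = fst c" and "a = snd c"
  define \<kappa> where "\<kappa> y = (\<lambda>i. if i \<in> J then (real_of_int (a i) + (1 + y i) / 2) / M else real_of_int (a i) / M)" for y :: "nat \<Rightarrow> real"
  define \<iota> where "\<iota> x = (\<lambda>i. if i \<in> J then 2 * (M * x i - real_of_int (a i)) - 1 else 0)" for x :: "nat \<Rightarrow> real"
  have kM: "M * \<kappa> y i = (if i \<in> J then real_of_int (a i) + (1 + y i) / 2 else real_of_int (a i))" for y i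
    using M by (auto simp: \<kappa>_def)
  have kb: "\<kappa> y \<in> grid_box M c" if "y \<in> cube J" for y
    using that unfolding grid_box_def mem_Collect_eq kM J_def[symmetric] a_def[symmetric] by (auto simp: cube_def abs_le_iff)
  have kbb: "\<kappa> y \<in> grid_box_boundary M c" if y: "y \<in> cube_boundary J" for y
  proof -
    obtain i where i: "i \<in> J" "\<bar>y i\<bar> = 1" using y by (auto simp: cube_boundary_def)
    have "M * \<kappa> y i = real_of_int (a i) \<or> M * \<kappa> y i = real_of_int (a i) + 1"
      unfolding kM using i by (auto simp: abs_if split: if_splits)
    then show ?thesis using kb y i(1) unfolding grid_box_boundary_def J_def a_def cube_boundary_def by auto
  qed
  have ib: "\<iota> x \<in> cube J" if "x \<in> grid_box M c" for x
    using that by (auto simp: grid_box_def cube_def \<iota>_def J_def a_def abs_le_iff)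
  have ibb: "\<iota> x \<in> cube_boundary J" if b: "x \<in> grid_box_boundary M c" for x
  proof -
    obtain i where i: "i \<in> J" "M * x i = real_of_int (a i) \<or> M * x i = real_of_int (a i) + 1"
      and x: "x \<in> grid_box M c" using b by (auto simp: grid_box_boundary_def J_def a_def)
    have "\<bar>\<iota> x i\<bar> = 1" using i by (auto simp: \<iota>_def)
    then show ?thesis using ib[OF x] i(1) unfolding cube_boundary_def by blast
  qed
  have ki: "\<kappa> (\<iota> x) = x" if "x \<in> grid_box M c" for x
  proof
    fix i
    have "M * \<kappa> (\<iota> x) i = M * x i"
      using that unfolding kM by (auto simp: grid_box_def \<iota>_def J_def a_def field_simps)
    then show "\<kappa> (\<iota> x) i = x i" using M by simp
  qed
  have kc: "continuous_on S \<kappa>" for S unfolding \<kappa>_def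
  proof (intro continuous_on_coordinatewise_then_product)
    fix i show "continuous_on S (\<lambda>x. if i \<in> J then (real_of_int (a i) + (1 + x i) / 2) / M else real_of_int (a i) / M)"
      by (cases "i \<in> J") (use M in \<open>auto intro!: continuous_intros continuous_on_apply\<close>)
  qed
  have ic: "continuous_on S \<iota>" for S unfolding \<iota>_def
  proof (intro continuous_on_coordinatewise_then_product)
    fix i show "continuous_on S (\<lambda>x. if i \<in> J then 2 * (M * x i - real_of_int (a i)) - 1 else 0)"
      by (cases "i \<in> J") (use M in \<open>auto intro!: continuous_intros continuous_on_apply\<close>)
  qed
  obtain W where W: "finite W" "continuous_on (grid_box_boundary M c) g"
      "g ` grid_box_boundary M c \<subseteq> realization_set (induced L W)"
    using g unfolding finite_map_def by blast
  have "finite_map L (cube_boundary J) (\<lambda>y. g (\<kappa> y))"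
    unfolding finite_map_def
  proof (intro conjI exI[of _ W])
    show "continuous_on (cube_boundary J) (\<lambda>y. g (\<kappa> y))"
      by (rule continuous_on_compose2[OF W(2) kc]) (use kbb in auto)
    show "(\<lambda>y. g (\<kappa> y)) ` cube_boundary J \<subseteq> realization_set (induced L W)"
      using W(3) kbb by blast
  qed (rule W(1))
  then obtain h where h: "finite_map L (cube J) h" "\<And>y. y \<in> cube_boundary J \<Longrightarrow> h y = g (\<kappa> y)"
    using cconnE[OF L c[folded J_def]] by metis
  obtain W' where W': "finite W'" "continuous_on (cube J) h" "h ` cube J \<subseteq> realization_set (induced L W')"
    using h(1) unfolding finite_map_def by blast
  have "finite_map L (grid_box M c) (\<lambda>x. h (\<iota> x))"
    unfolding finite_map_def
  proof (intro conjI exI[of _ W'])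
    show "continuous_on (grid_box M c) (\<lambda>x. h (\<iota> x))"
      by (rule continuous_on_compose2[OF W'(2) ic]) (use ib in auto)
    show "(\<lambda>x. h (\<iota> x)) ` grid_box M c \<subseteq> realization_set (induced L W')"
      using W'(3) ib by blast
  qed (rule W'(1))
  moreover have "h (\<iota> x) = g x" if "x \<in> grid_box_boundary M c" for x
    using h(2)[OF ibb[OF that]] ki that by (auto simp: grid_box_boundary_def)
  ultimately show ?thesis using that by blast
qed

lemma grid_extend:
  fixes F :: "(nat set \<times> (nat \<Rightarrow> int)) set"
  assumes M: "M > 0" and L: "abstract_complex L" "cconn d L"
    and F: "finite F" "\<And>c. c \<in> F \<Longrightarrow> finite (fst c) \<and> int (card (fst c)) \<le> d + 1"
      "\<And>c. c \<in> F \<Longrightarrow> grid_faces c \<subseteq> F"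
    and A: "\<And>c c'. c \<in> F \<Longrightarrow> A c \<Longrightarrow> c' \<in> grid_faces c \<Longrightarrow> A c'"
    and p: "\<And>c. c \<in> F \<Longrightarrow> A c \<Longrightarrow> continuous_on (grid_box M c) p"
      "\<And>c x. c \<in> F \<Longrightarrow> A c \<Longrightarrow> x \<in> grid_box M c \<Longrightarrow> support (p x) \<subseteq> Wp" "finite Wp"
      "\<And>c x. c \<in> F \<Longrightarrow> A c \<Longrightarrow> x \<in> grid_box M c \<Longrightarrow> x \<in> T \<Longrightarrow> p x \<in> realization_set L"
    and T: "\<And>c. c \<in> F \<Longrightarrow> \<not> A c \<Longrightarrow> grid_box M c \<subseteq> T"
  shows "\<exists>g W. finite W \<and> continuous_on (\<Union>c\<in>F. grid_box M c) g \<and>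
    (\<forall>c\<in>F. \<forall>x\<in>grid_box M c. support (g x) \<subseteq> W \<and> (A c \<longrightarrow> g x = p x) \<and> (\<not> A c \<longrightarrow> g x \<in> realization_set L))"
  using F A p(1,2,4) T
proof (induction "card F" arbitrary: F)
  case 0
  then have "F = {}" by auto
  then show ?case by (intro exI[of _ undefined] exI[of _ "{}"]) auto
next
  case (Suc n)
  note F = Suc.prems(1-3) and A = Suc.prems(4) and p' = Suc.prems(5,6,7) and T = Suc.prems(8)
  have "F \<noteq> {}" using Suc.hyps by auto
  \<comment> \<open>A cell of maximal dimension is a face of no other cell, so the rest stays closed
    under faces and can be treated first.\<close>
  then obtain c where c: "c \<in> F" "\<And>c'. c' \<in> F \<Longrightarrow> card (fst c') \<le> card (fst c)"
  proof -
    have "Max ((\<lambda>c. card (fst c)) ` F) \<in> (\<lambda>c. card (fst c)) ` F"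
      using F(1) \<open>F \<noteq> {}\<close> by (intro Max_in) auto
    then obtain c where "c \<in> F" "card (fst c) = Max ((\<lambda>c. card (fst c)) ` F)" by auto
    then show ?thesis using that[of c] Max_ge[of "(\<lambda>c. card (fst c)) ` F"] F(1) by simp
  qed
  define F' where "F' = F - {c}"
  have face_card: "card (fst c'') < card (fst c')" if c': "c' \<in> F" "c'' \<in> grid_faces c'" for c' c''
  proof -
    obtain i where "i \<in> fst c'" "fst c'' = fst c' - {i}" using c'(2) by (auto simp: grid_faces_def)
    then show ?thesis using F(2)[OF c'(1)] by (metis card_Diff1_less)
  qed
  have F'F: "c' \<in> F" if "c' \<in> F'" for c' using that by (auto simp: F'_def)
  have F'3: "grid_faces c' \<subseteq> F'" if "c' \<in> F" for c'
  proof
    fix c'' assume c'': "c'' \<in> grid_faces c'"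
    have "c'' \<noteq> c" using face_card[OF that c''] c(2)[OF that] by auto
    then show "c'' \<in> F'" using F(3)[OF that] c'' by (auto simp: F'_def)
  qed
  have "\<exists>g W. finite W \<and> continuous_on (\<Union>c\<in>F'. grid_box M c) g \<and>
    (\<forall>c\<in>F'. \<forall>x\<in>grid_box M c. support (g x) \<subseteq> W \<and> (A c \<longrightarrow> g x = p x) \<and> (\<not> A c \<longrightarrow> g x \<in> realization_set L))"
  proof (rule Suc.hyps(1))
    show "n = card F'" using Suc.hyps(2) F(1) c(1) by (simp add: F'_def)
    show "finite F'" using F(1) by (simp add: F'_def)
    show "finite (fst c) \<and> int (card (fst c)) \<le> d + 1" if "c \<in> F'" for c using F(2) F'F that by blast
    show "grid_faces c \<subseteq> F'" if "c \<in> F'" for c using F'3 F'F that by blast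
    show "A c'" if "c \<in> F'" "A c" "c' \<in> grid_faces c" for c c' using A F'F that by blast
    show "continuous_on (grid_box M c) p" if "c \<in> F'" "A c" for c using p'(1) F'F that by blast
    show "support (p x) \<subseteq> Wp" if "c \<in> F'" "A c" "x \<in> grid_box M c" for c x using p'(2) F'F that by blast
    show "p x \<in> realization_set L" if "c \<in> F'" "A c" "x \<in> grid_box M c" "x \<in> T" for c x using p'(3) F'F that by blast
    show "grid_box M c \<subseteq> T" if "c \<in> F'" "\<not> A c" for c using T F'F that by blast
  qed
  then obtain g W where g: "finite W" "continuous_on (\<Union>c\<in>F'. grid_box M c) g"
    "\<And>c x. c \<in> F' \<Longrightarrow> x \<in> grid_box M c \<Longrightarrow> support (g x) \<subseteq> W \<and> (A c \<longrightarrow> g x = p x) \<and> (\<not> A c \<longrightarrow> g x \<in> realization_set L)"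
    by blast
  have bd: "\<exists>c'\<in>F'. c' \<in> grid_faces c \<and> x \<in> grid_box M c'" if "x \<in> grid_box_boundary M c" for x
    using that F'3[OF c(1)] by (elim grid_box_boundaryE) blast
  have overlap: "x \<in> grid_box_boundary M c" if "x \<in> grid_box M c" "c' \<in> F'" "x \<in> grid_box M c'" for x c'
    using grid_box_Int[of c c'] that F(2) c F'F[OF that(2)] by (auto simp: F'_def)
  have "\<exists>h W'. finite W' \<and> continuous_on (grid_box M c) h \<and> (\<forall>x\<in>grid_box_boundary M c. h x = g x) \<and>
     (\<forall>x\<in>grid_box M c. support (h x) \<subseteq> W' \<and> (A c \<longrightarrow> h x = p x) \<and> (\<not> A c \<longrightarrow> h x \<in> realization_set L))"
  proof (cases "A c")
    case True
    have "p x = g x" if "x \<in> grid_box_boundary M c" for x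
      using bd[OF that] A[OF c(1) True] g(3) by metis
    then show ?thesis using p'[OF c(1) True] p(3) True by blast
  next
    case False
    have sub: "grid_box_boundary M c \<subseteq> (\<Union>c\<in>F'. grid_box M c)" using bd by blast
    have "g x \<in> realization_set L \<and> support (g x) \<subseteq> W" if x: "x \<in> grid_box_boundary M c" for x
    proof -
      obtain c' where c': "c' \<in> F'" "x \<in> grid_box M c'" using bd[OF x] by blast
      have "x \<in> T" using T[OF c(1) False] x by (auto simp: grid_box_boundary_def)
      then show ?thesis using g(3)[OF c'] p'(3)[OF F'F[OF c'(1)] _ c'(2)] by auto
    qed
    then have "finite_map L (grid_box_boundary M c) g"
      using finite_mapI[OF L(1) continuous_on_subset[OF g(2) sub] g(1)] by blast
    then obtain h where h: "finite_map L (grid_box M c) h" "\<And>x. x \<in> grid_box_boundary M c \<Longrightarrow> h x = g x"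
      using grid_box_extend[OF M L(2)] F(2)[OF c(1)] by metis
    then show ?thesis using finite_mapE[OF h(1) L(1)] False by metis
  qed
  then obtain h W' where h: "finite W'" "continuous_on (grid_box M c) h"
    "\<And>x. x \<in> grid_box_boundary M c \<Longrightarrow> h x = g x"
    "\<And>x. x \<in> grid_box M c \<Longrightarrow> support (h x) \<subseteq> W' \<and> (A c \<longrightarrow> h x = p x) \<and> (\<not> A c \<longrightarrow> h x \<in> realization_set L)"
    by blast
  define k where "k x = (if x \<in> grid_box M c then h x else g x)" for x
  have "continuous_on (grid_box M c \<union> (\<Union>c\<in>F'. grid_box M c)) k"
    unfolding k_def
  proof (rule continuous_on_cases[OF closed_grid_box _ h(2) g(2)])
    show "closed (\<Union>c\<in>F'. grid_box M c)" using F(1) closed_grid_box by (auto simp: F'_def)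
    show "\<forall>x. x \<in> grid_box M c \<and> x \<notin> grid_box M c \<or> x \<in> (\<Union>c\<in>F'. grid_box M c) \<and> x \<in> grid_box M c \<longrightarrow> h x = g x"
      using overlap h(3) by auto
  qed
  moreover have "grid_box M c \<union> (\<Union>c\<in>F'. grid_box M c) = (\<Union>c\<in>F. grid_box M c)"
    using c(1) by (auto simp: F'_def)
  moreover have kg: "k x = g x" if "c' \<in> F'" "x \<in> grid_box M c'" for x c'
    using overlap[OF _ that] h(3) unfolding k_def by auto
  have "support (k x) \<subseteq> W \<union> W' \<and> (A c' \<longrightarrow> k x = p x) \<and> (\<not> A c' \<longrightarrow> k x \<in> realization_set L)"
    if "c' \<in> F" "x \<in> grid_box M c'" for x c'
  proof (cases "c' = c")
    case True then show ?thesis using h(4)[of x] that by (auto simp: k_def)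
  next
    case False
    then have "c' \<in> F'" using that by (auto simp: F'_def)
    then show ?thesis using g(3)[of c' x] kg[of c' x] that by auto
  qed
  ultimately show ?case
    by (intro exI[of _ k] exI[of _ "W \<union> W'"]) (use g(1) h(1) in auto)
qed

section \<open>Fine grids on the boundary of a cube\<close>

lemma uniform_grid:
  assumes I: "finite I" and \<phi>: "continuous_on (cube_boundary I) (\<phi> :: (nat \<Rightarrow> real) \<Rightarrow> real)" and e: "e > 0"
  obtains M :: nat where "M > 0" "\<And>x y. x \<in> cube_boundary I \<Longrightarrow> y \<in> cube_boundary I \<Longrightarrow>
    (\<And>i. \<bar>x i - y i\<bar> \<le> 1 / real M) \<Longrightarrow> \<bar>\<phi> x - \<phi> y\<bar> < e"
proof -
  have "uniformly_continuous_on (cube_boundary I) \<phi>"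
    by (rule compact_uniformly_continuous[OF \<phi> compact_cube_boundary[OF I]])
  then obtain \<delta> where d: "\<delta> > 0" "\<And>x y. x \<in> cube_boundary I \<Longrightarrow> y \<in> cube_boundary I \<Longrightarrow> dist y x < \<delta> \<Longrightarrow> dist (\<phi> y) (\<phi> x) < e"
    using e unfolding uniformly_continuous_on_def by metis
  obtain M :: nat where M: "M > 0" "1 / real M < \<delta> / 2"
    using reals_Archimedean[of "\<delta>/2"] d(1) by (metis half_gt_zero inverse_eq_divide zero_less_Suc)
  have "\<bar>\<phi> x - \<phi> y\<bar> < e" if x: "x \<in> cube_boundary I" "y \<in> cube_boundary I" and le: "\<And>i. \<bar>x i - y i\<bar> \<le> 1 / real M" for x y
  proof -
    \<comment> \<open>The distance on \<open>nat \<Rightarrow> real\<close> is a sum of coordinate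
      distances, cut off at 1, with weights \<open>(1/2)^n\<close>. A coordinatewise bound
      \<open>1 / real M\<close> therefore gives distance at most \<open>2 / real M\<close>, whence
      the choice of \<open>M\<close> against \<open>\<delta> / 2\<close>.\<close>
    have sg: "summable (\<lambda>n. (1/2)^n * (1 / real M))" "(\<Sum>n. (1/2)^n * (1 / real M)) = 2 * (1 / real M)"
      using suminf_mult2[of "\<lambda>n. (1/2)^n" "1 / real M"] suminf_geometric[of "1/2 :: real"]
      by (auto intro!: summable_mult2 simp: summable_geometric)
    have t: "(1/2)^n * min (dist (x (from_nat n)) (y (from_nat n))) 1 \<le> (1/2)^n * (1 / real M)" for n
      using le[of "from_nat n"] by (intro mult_left_mono) (auto simp: dist_real_def)
    have "dist x y \<le> 2 * (1 / real M)"
      unfolding dist_fun_def sg(2)[symmetric]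
      by (intro suminf_le t sg(1) summable_comparison_test'[OF sg(1)])
        (use t in \<open>auto simp: abs_mult\<close>)
    then have "dist x y < \<delta>" using M(2) by auto
    then show ?thesis using d(2)[OF x(2,1)] by (simp add: dist_real_def)
  qed
  then show ?thesis using that M(1) by blast
qed

lemma grid_covers_boundary:
  fixes M :: nat
  assumes I: "finite I" and M: "M > 0"
  defines "F \<equiv> {(J, a). J \<subseteq> I \<and> (\<forall>i\<in>J. - int M \<le> a i \<and> a i < int M) \<and> (\<forall>i\<in>I - J. - int M \<le> a i \<and> a i \<le> int M)
     \<and> (\<forall>i. i \<notin> I \<longrightarrow> a i = 0) \<and> (\<exists>i\<in>I - J. \<bar>a i\<bar> = int M)}"
  shows "finite F" "\<And>c. c \<in> F \<Longrightarrow> finite (fst c) \<and> card (fst c) < card I" "\<And>c. c \<in> F \<Longrightarrow> grid_faces c \<subseteq> F"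
    "(\<Union>c\<in>F. grid_box (real M) c) = cube_boundary I"
proof -
  have fin: "finite {a :: nat \<Rightarrow> int. (\<forall>i. i \<in> I \<longrightarrow> a i \<in> {- int M..int M}) \<and> (\<forall>i. i \<notin> I \<longrightarrow> a i = 0)}"
    by (rule finite_set_of_finite_funs[OF I finite_atLeastAtMost_int, unfolded all_conj_distrib])
  have "F \<subseteq> Pow I \<times> {a :: nat \<Rightarrow> int. (\<forall>i. i \<in> I \<longrightarrow> a i \<in> {- int M..int M}) \<and> (\<forall>i. i \<notin> I \<longrightarrow> a i = 0)}"
  proof (clarify, intro conjI)
    fix J a assume F: "(J, a) \<in> F"
    then show "J \<in> Pow I" by (auto simp: F_def)
    have "a i \<in> {- int M..int M}" if "i \<in> I" for i
    proof (cases "i \<in> J")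
      case True
      then show ?thesis using F by (simp add: F_def less_imp_le)
    next
      case False
      then show ?thesis using F that by (simp add: F_def)
    qed
    then show "a \<in> {a. (\<forall>i. i \<in> I \<longrightarrow> a i \<in> {- int M..int M}) \<and> (\<forall>i. i \<notin> I \<longrightarrow> a i = 0)}"
      using F by (auto simp: F_def)
  qed
  then show "finite F" using fin I by (meson finite_SigmaI finite_Pow_iff finite_subset)
  show "finite (fst c) \<and> card (fst c) < card I" if "c \<in> F" for c
  proof -
    have "fst c \<subset> I" using that by (auto simp: F_def)
    then show ?thesis using I by (auto intro: finite_subset psubset_card_mono)
  qed
  show "grid_faces c \<subseteq> F" if "c \<in> F" for c
  proof
    fix c' assume "c' \<in> grid_faces c"
    then obtain i \<delta> where i: "i \<in> fst c" "\<delta> \<in> {0, 1}" "c' = (fst c - {i}, (snd c)(i := snd c i + \<delta>))"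
      by (auto simp: grid_faces_def)
    obtain J a where c: "c = (J, a)" by (cases c)
    have J: "J \<subseteq> I" "\<And>j. j \<in> J \<Longrightarrow> - int M \<le> a j \<and> a j < int M" "\<And>j. j \<in> I - J \<Longrightarrow> - int M \<le> a j \<and> a j \<le> int M"
      "\<And>j. j \<notin> I \<Longrightarrow> a j = 0" "\<exists>j\<in>I - J. \<bar>a j\<bar> = int M"
      using \<open>c \<in> F\<close> by (simp_all add: F_def c)
    have i': "i \<in> J" "i \<in> I" using i(1) J(1) by (auto simp: c)
    have q1: "- int M \<le> (a(i := a i + \<delta>)) j \<and> (a(i := a i + \<delta>)) j \<le> int M" if "j \<in> I - (J - {i})" for j
      using that i(2) J(2)[OF i'(1)] J(3)[of j] by (cases "j = i") auto
    have q2: "\<exists>j\<in>I - (J - {i}). \<bar>(a(i := a i + \<delta>)) j\<bar> = int M"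
    proof -
      obtain j where "j \<in> I - J" "\<bar>a j\<bar> = int M" using J(5) by blast
      then show ?thesis using i' by (intro bexI[of _ j]) auto
    qed
    have q3: "- int M \<le> (a(i := a i + \<delta>)) j \<and> (a(i := a i + \<delta>)) j < int M" if "j \<in> J - {i}" for j
      using that J(2)[of j] by auto
    have q4: "J - {i} \<subseteq> I" "\<And>j. j \<notin> I \<Longrightarrow> (a(i := a i + \<delta>)) j = 0" using J(1,4) i' by auto
    show "c' \<in> F"
      unfolding F_def i(3) c mem_Collect_eq case_prod_conv fst_conv snd_conv
      using q1 q2 q3 q4 by blast
  qed
  have MM: "real M > 0" using M by simp
  show "(\<Union>c\<in>F. grid_box (real M) c) = cube_boundary I"
  proof (intro equalityI subsetI)
    fix x assume "x \<in> (\<Union>c\<in>F. grid_box (real M) c)"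
    then obtain J a where c: "(J, a) \<in> F" "x \<in> grid_box (real M) (J, a)" by auto
    have le: "\<bar>x i\<bar> \<le> 1" if "i \<in> I" for i
    proof -
      have "- real M \<le> real M * x i \<and> real M * x i \<le> real M"
      proof (cases "i \<in> J")
        case True
        then have "- int M \<le> a i" "a i + 1 \<le> int M" using c(1) by (auto simp: F_def)
        then have "- real M \<le> real_of_int (a i)" "real_of_int (a i) + 1 \<le> real M" by linarith+
        moreover have "real_of_int (a i) \<le> real M * x i" "real M * x i \<le> real_of_int (a i) + 1"
          using c(2) True by (auto simp: grid_box_def)
        ultimately show ?thesis by linarith
      next
        case False
        then have "- int M \<le> a i" "a i \<le> int M" using c(1) that by (auto simp: F_def)
        then have "- real M \<le> real_of_int (a i)" "real_of_int (a i) \<le> real M" by linarith+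
        moreover have "real M * x i = real_of_int (a i)" using c(2) False by (auto simp: grid_box_def)
        ultimately show ?thesis by linarith
      qed
      then have "real M * \<bar>x i\<bar> \<le> real M * 1" by (auto simp: abs_if)
      then show ?thesis using MM by simp
    qed
    have z: "x i = 0" if "i \<notin> I" for i
    proof -
      have "a i = 0" "i \<notin> J" using c(1) that by (auto simp: F_def)
      then have "real M * x i = 0" using c(2) by (auto simp: grid_box_def)
      then show ?thesis using MM by simp
    qed
    obtain i where i: "i \<in> I - J" "\<bar>a i\<bar> = int M" using c by (auto simp: F_def)
    then have "real M * x i = real_of_int (a i)" using c by (auto simp: grid_box_def)
    then have "real M * \<bar>x i\<bar> = real M" using i(2) MM by (metis abs_mult abs_of_pos of_int_abs of_int_of_nat_eq)
    then have "\<bar>x i\<bar> = 1" using MM by simp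
    then show "x \<in> cube_boundary I" using le z i(1) by (auto simp: cube_boundary_def cube_def)
  next
    fix x assume x: "x \<in> cube_boundary I"
    then obtain i where i: "i \<in> I" "\<bar>x i\<bar> = 1" by (auto simp: cube_boundary_def)
    \<comment> \<open>At \<open>x j = 1\<close> the floor would be \<open>int M\<close> and the cell
      would leave the cube; the cell below is taken instead, with the point on its upper
      face.\<close>
    define a where "a j = (if j = i then (if x i = 1 then int M else - int M) else if x j = 1 then int M - 1 else \<lfloor>real M * x j\<rfloor>)" for j
    have xj: "- real M \<le> real M * x j \<and> real M * x j \<le> real M" if "j \<in> I" for j
    proof -
      have "\<bar>x j\<bar> \<le> 1" using x that by (auto simp: cube_boundary_def cube_def)
      then have "real M * (-1) \<le> real M * x j" "real M * x j \<le> real M * 1"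
        by (intro mult_left_mono; simp)+
      then show ?thesis by simp
    qed
    have a: "- int M \<le> a j \<and> a j < int M" if "j \<in> I - {i}" for j
    proof (cases "x j = 1")
      case True then show ?thesis using that M by (auto simp: a_def)
    next
      case False
      then have "x j < 1" using x that by (fastforce simp: cube_boundary_def cube_def)
      then have "real M * x j < real M" using MM by simp
      then have "\<lfloor>real M * x j\<rfloor> < int M" by (simp add: floor_less_iff)
      moreover have "- int M \<le> \<lfloor>real M * x j\<rfloor>" using xj[of j] that by (simp add: le_floor_iff)
      ultimately show ?thesis using False that by (auto simp: a_def)
    qed
    have ai: "\<bar>a i\<bar> = int M" by (simp add: a_def)
    have off: "a j = 0" "x j = 0" if "j \<notin> I" for j
      using that x i(1) by (auto simp: a_def cube_boundary_def cube_def)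
    have ex: "\<exists>j\<in>I - (I - {i}). \<bar>a j\<bar> = int M" using ai i(1) by blast
    have r: "- int M \<le> a j \<and> a j \<le> int M" if "j \<in> I - (I - {i})" for j using that by (auto simp: a_def)
    have "(I - {i}, a) \<in> F"
      unfolding F_def mem_Collect_eq case_prod_conv using a ex r off(1) by blast
    moreover have "x \<in> grid_box (real M) (I - {i}, a)"
      unfolding grid_box_def mem_Collect_eq fst_conv snd_conv
    proof (intro conjI ballI allI impI)
      fix j assume j: "j \<in> I - {i}"
      show "real_of_int (a j) \<le> real M * x j" "real M * x j \<le> real_of_int (a j) + 1"
        using j by (auto simp: a_def)
    next
      fix j assume "j \<notin> I - {i}"
      then consider "j = i" | "j \<notin> I" by auto
      then show "real M * x j = real_of_int (a j)"
      proof cases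
        case 1
        have "x i = 1 \<or> x i = -1" using i(2) by linarith
        then show ?thesis using 1 by (auto simp: a_def)
      qed (simp add: off)
    qed
    ultimately show "x \<in> (\<Union>c\<in>F. grid_box (real M) c)" by blast
  qed
qed

lemma grid_box_small:
  assumes "M > 0" "x \<in> grid_box M c" "y \<in> grid_box M c"
  shows "\<bar>x i - y i\<bar> \<le> 1 / M"
proof -
  have "\<bar>M * x i - M * y i\<bar> \<le> 1"
    using assms(2,3) by (cases "i \<in> fst c") (fastforce simp: grid_box_def abs_le_iff)+
  then have "M * \<bar>x i - y i\<bar> \<le> 1" using assms(1) by (simp add: right_diff_distrib[symmetric] abs_mult)
  then show ?thesis using assms(1) by (simp add: field_simps)
qed

text \<open>In the application \<open>\<phi>\<close> is the weight of a vertex and \<open>p\<close>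
  the radial projection away from it, undefined where \<open>\<phi>\<close> is 1. On a fine grid the
  cells meeting that locus stay in the region \<open>\<phi> x > 2/3\<close>, where \<open>p\<close>
  is \<open>L\<close>-valued wherever it is defined; on these cells \<open>p\<close> is discarded
  and refilled inside \<open>L\<close>. Cells in the boundary have dimension at most
  \<open>d\<close>, so connectivity of \<open>L\<close> in degree \<open>d - 1\<close> is
  enough.\<close>

lemma push_into_link:
  assumes I: "finite I" "int (card I) \<le> d + 1" and K: "abstract_complex K"
    and L: "abstract_complex L" "L \<subseteq> K" "cconn (d - 1) L"
    and \<phi>: "continuous_on (cube_boundary I) (\<phi> :: (nat \<Rightarrow> real) \<Rightarrow> real)"
    and p: "continuous_on {x \<in> cube_boundary I. \<phi> x < 1} p" "finite W"
      "\<And>x. x \<in> cube_boundary I \<Longrightarrow> \<phi> x < 1 \<Longrightarrow> p x \<in> realization_set K \<and> support (p x) \<subseteq> W"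
      "\<And>x. x \<in> cube_boundary I \<Longrightarrow> \<phi> x < 1 \<Longrightarrow> 0 < \<phi> x \<Longrightarrow> p x \<in> realization_set L"
  obtains f' where "finite_map K (cube_boundary I) f'"
    "\<And>x. x \<in> cube_boundary I \<Longrightarrow> \<phi> x \<le> 2/3 \<Longrightarrow> f' x = p x"
    "\<And>x. x \<in> cube_boundary I \<Longrightarrow> 0 < \<phi> x \<Longrightarrow> f' x \<in> realization_set L"
proof -
  obtain M :: nat where M: "M > 0" "\<And>x y. x \<in> cube_boundary I \<Longrightarrow> y \<in> cube_boundary I \<Longrightarrow>
    (\<And>i. \<bar>x i - y i\<bar> \<le> 1 / real M) \<Longrightarrow> \<bar>\<phi> x - \<phi> y\<bar> < 1/3"
    using uniform_grid[OF I(1) \<phi>, of "1/3"] by auto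
  define F where "F = {(J, a). J \<subseteq> I \<and> (\<forall>i\<in>J. - int M \<le> a i \<and> a i < int M) \<and> (\<forall>i\<in>I - J. - int M \<le> a i \<and> a i \<le> int M)
     \<and> (\<forall>i. i \<notin> I \<longrightarrow> a i = 0) \<and> (\<exists>i\<in>I - J. \<bar>a i\<bar> = int M)}"
  note F = grid_covers_boundary[OF I(1) M(1), folded F_def]
  define A where "A c \<longleftrightarrow> (\<forall>x\<in>grid_box (real M) c. \<phi> x < 1)" for c
  have box: "x \<in> cube_boundary I" if "c \<in> F" "x \<in> grid_box (real M) c" for c x
    using F(4) that by blast
  have notA: "\<phi> x > 2/3" if c: "c \<in> F" "\<not> A c" and x: "x \<in> grid_box (real M) c" for c x
  proof -
    obtain y where y: "y \<in> grid_box (real M) c" "\<phi> y \<ge> 1" using c(2) by (auto simp: A_def not_less)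
    have "\<bar>\<phi> x - \<phi> y\<bar> < 1/3"
      using M(1) by (intro M(2)[OF box[OF c(1) x] box[OF c(1) y(1)]] grid_box_small[OF _ x y(1)]) simp
    then show ?thesis using y(2) by linarith
  qed
  have "\<exists>g W. finite W \<and> continuous_on (\<Union>c\<in>F. grid_box (real M) c) g \<and>
    (\<forall>c\<in>F. \<forall>x\<in>grid_box (real M) c. support (g x) \<subseteq> W \<and> (A c \<longrightarrow> g x = p x) \<and> (\<not> A c \<longrightarrow> g x \<in> realization_set L))"
  proof (rule grid_extend[OF _ L(1,3) F(1) _ F(3), where T = "{x. \<phi> x > 0}" and Wp = W])
    show "real M > 0" using M(1) by simp
    show "finite (fst c) \<and> int (card (fst c)) \<le> d - 1 + 1" if "c \<in> F" for c
      using F(2)[OF that] I(2) by auto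
    show "A c'" if "A c" "c' \<in> grid_faces c" for c c'
      using that grid_face_subset[OF that(2)] by (auto simp: A_def)
    show "continuous_on (grid_box (real M) c) p" if "c \<in> F" "A c" for c
      by (rule continuous_on_subset[OF p(1)]) (use that(2) box[OF that(1)] in \<open>auto simp: A_def\<close>)
    show "support (p x) \<subseteq> W" if "c \<in> F" "A c" "x \<in> grid_box (real M) c" for c x
      using that box p(3) by (auto simp: A_def)
    show "p x \<in> realization_set L" if "c \<in> F" "A c" "x \<in> grid_box (real M) c" "x \<in> {x. \<phi> x > 0}" for c x
      using that box p(4) by (auto simp: A_def)
    show "grid_box (real M) c \<subseteq> {x. \<phi> x > 0}" if "c \<in> F" "\<not> A c" for c
      using notA[OF that] by force
  qed (use p(2) in auto)
  then obtain g W' where g: "finite W'" "continuous_on (cube_boundary I) g"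
    "\<And>c x. c \<in> F \<Longrightarrow> x \<in> grid_box (real M) c \<Longrightarrow> support (g x) \<subseteq> W' \<and> (A c \<longrightarrow> g x = p x) \<and> (\<not> A c \<longrightarrow> g x \<in> realization_set L)"
    unfolding F(4) by blast
  have ex: "\<exists>c\<in>F. x \<in> grid_box (real M) c" if "x \<in> cube_boundary I" for x using F(4) that by blast
  show ?thesis
  proof
    show "finite_map K (cube_boundary I) g"
    proof (rule finite_mapI[OF K g(2,1)])
      fix x assume "x \<in> cube_boundary I"
      then obtain c where c: "c \<in> F" "x \<in> grid_box (real M) c" using ex by blast
      show "g x \<in> realization_set K"
        using g(3)[OF c] p(3)[OF box[OF c]] c(2) realization_set_mono[OF L(2)] unfolding A_def by (metis subsetD)
      show "support (g x) \<subseteq> W'" using g(3)[OF c] by auto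
    qed
    fix x assume x: "x \<in> cube_boundary I"
    then obtain c where c: "c \<in> F" "x \<in> grid_box (real M) c" using ex by blast
    show "g x = p x" if "\<phi> x \<le> 2/3"
      using g(3)[OF c] notA[OF c(1) _ c(2)] that by (meson not_le)
    show "g x \<in> realization_set L" if "0 < \<phi> x"
      using g(3)[OF c] p(4)[OF x _ that] c(2) unfolding A_def by metis
  qed
qed

section \<open>Gluing\<close>

text \<open>Radial projection from the vertex \<open>v\<close> onto the opposite face, meaningful
  only for \<open>\<alpha> v < 1\<close>.\<close>

definition project_away :: "'v \<Rightarrow> ('v \<Rightarrow> real) \<Rightarrow> 'v \<Rightarrow> real" where
  "project_away v \<alpha> = (\<lambda>w. if w = v then 0 else \<alpha> w / (1 - \<alpha> v))"

lemma project_away_in: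
  assumes "finite \<sigma>" "\<alpha> \<in> closed_simplex \<sigma>" "\<alpha> v < 1"
  shows "project_away v \<alpha> \<in> closed_simplex (\<sigma> - {v})"
proof -
  have "sum (project_away v \<alpha>) (\<sigma> - {v}) = (\<Sum>w\<in>\<sigma> - {v}. \<alpha> w / (1 - \<alpha> v))"
    by (intro sum.cong) (auto simp: project_away_def)
  also have "\<dots> = sum \<alpha> (\<sigma> - {v}) / (1 - \<alpha> v)" by (simp add: sum_divide_distrib)
  also have "sum \<alpha> (\<sigma> - {v}) = 1 - \<alpha> v"
    using assms(1,2) by (cases "v \<in> \<sigma>") (auto simp: sum_diff1 closed_simplex_def)
  finally show ?thesis using assms by (auto simp: closed_simplex_def project_away_def)
qed

lemma support_project_away: "\<alpha> v < 1 \<Longrightarrow> support (project_away v \<alpha>) = support \<alpha> - {v}"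
  by (auto simp: support_def project_away_def)

text \<open>\<open>K\<close> arises from the full subcomplex avoiding \<open>v\<close> by attaching
  a cone over the link of \<open>v\<close>. A map of a sphere is deformed off the apex: at some
  distance from \<open>v\<close> by radial projection, close to \<open>v\<close> through the
  connectivity of the link. The result lies in the subcomplex, where it can be filled.\<close>

lemma cconn_glue_vertex:
  assumes K: "abstract_complex K" and D: "cconn d (induced K (- {v}))" and L: "cconn (d - 1) (link K {v})"
  shows "cconn d K"
proof (rule cconnI)
  fix I f assume I: "finite I" "int (card I) \<le> d + 1" and f: "finite_map K (cube_boundary I) f"
  let ?D = "induced K (- {v})" and ?L = "link K {v}" and ?S = "cube_boundary I"
  have Dc: "abstract_complex ?D" and Lc: "abstract_complex ?L"
    using abstract_complex_induced[OF K] abstract_complex_link[OF K] by auto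
  have LD: "?L \<subseteq> ?D" by (auto simp: link_def induced_def)
  have DK: "?D \<subseteq> K" by (auto simp: induced_def)
  define \<phi> where "\<phi> x = f x v" for x
  obtain W where W: "finite W" "continuous_on ?S f" "\<And>x. x \<in> ?S \<Longrightarrow> f x \<in> realization_set K"
    "\<And>x. x \<in> ?S \<Longrightarrow> support (f x) \<subseteq> W"
    using finite_mapE[OF f K] by metis
  define \<sigma> where "\<sigma> x = support (f x)" for x
  have s: "\<sigma> x \<in> K" "f x \<in> closed_simplex (\<sigma> x)" "finite (\<sigma> x)" if "x \<in> ?S" for x
    using W(3)[OF that] abstract_complexD(1)[OF K] by (auto simp: realization_set_iff[OF K] \<sigma>_def)
  have \<phi>0: "0 \<le> \<phi> x" "\<phi> x \<le> 1" "0 < \<phi> x \<Longrightarrow> v \<in> \<sigma> x" if "x \<in> ?S" for x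
    using s[OF that] closed_simplex_le_1[OF s(3,2)[OF that]]
    by (auto simp: \<phi>_def \<sigma>_def support_def closed_simplex_def)
  have \<phi>c: "continuous_on ?S \<phi>"
    unfolding \<phi>_def by (rule continuous_on_product_then_coordinatewise[OF W(2)])
  define p where "p x = project_away v (f x)" for x
  have pc: "continuous_on {x \<in> ?S. \<phi> x < 1} p"
    unfolding p_def project_away_def
  proof (rule continuous_on_coordinatewise_then_product)
    fix w
    have "continuous_on {x \<in> ?S. \<phi> x < 1} (\<lambda>x. f x u)" for u
      by (rule continuous_on_subset[OF continuous_on_product_then_coordinatewise[OF W(2)]]) auto
    then show "continuous_on {x \<in> ?S. \<phi> x < 1} (\<lambda>x. if w = v then 0 else f x w / (1 - f x v))"
      by (cases "w = v") (auto intro!: continuous_intros simp: \<phi>_def)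
  qed
  have ps: "p x \<in> closed_simplex (\<sigma> x - {v})" "support (p x) = \<sigma> x - {v}" "\<sigma> x - {v} \<noteq> {}" if "x \<in> ?S" "\<phi> x < 1" for x
    using project_away_in[OF s(3,2)[OF that(1)], of v] support_project_away[of "f x" v] that(2)
      closed_simplex_support(3)[OF _ project_away_in[OF s(3,2)[OF that(1)], of v]] s(3)[OF that(1)]
    by (auto simp: p_def \<phi>_def \<sigma>_def)
  have pD: "p x \<in> realization_set ?D \<and> support (p x) \<subseteq> W" if x: "x \<in> ?S" "\<phi> x < 1" for x
    using ps[OF x] abstract_complexD(3)[OF K s(1)[OF x(1)], of "\<sigma> x - {v}"] W(4)[OF x(1)]
    unfolding realization_set_iff[OF Dc] by (auto simp: induced_def \<sigma>_def)
  have pL: "p x \<in> realization_set ?L" if x: "x \<in> ?S" "\<phi> x < 1" "0 < \<phi> x" for x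
    using ps[OF x(1,2)] abstract_complexD(3)[OF K s(1)[OF x(1)], of "\<sigma> x - {v}"] s(1)[OF x(1)] \<phi>0(3)[OF x(1,3)]
    unfolding realization_set_iff[OF Lc] by (auto simp: link_def insert_absorb)
  obtain f' where f': "finite_map ?D ?S f'" "\<And>x. x \<in> ?S \<Longrightarrow> \<phi> x \<le> 2/3 \<Longrightarrow> f' x = p x"
    "\<And>x. x \<in> ?S \<Longrightarrow> 0 < \<phi> x \<Longrightarrow> f' x \<in> realization_set ?L"
    using push_into_link[OF I Dc Lc LD L \<phi>c pc W(1)] pD pL by blast
  obtain W' where W': "finite W'" "continuous_on ?S f'" "\<And>x. x \<in> ?S \<Longrightarrow> f' x \<in> realization_set ?D"
    "\<And>x. x \<in> ?S \<Longrightarrow> support (f' x) \<subseteq> W'"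
    using finite_mapE[OF f'(1) Dc] by metis
  obtain g' where g': "finite_map ?D (cube I) g'" "\<And>x. x \<in> ?S \<Longrightarrow> g' x = f' x"
    using cconnE[OF D I f'(1)] by metis
  \<comment> \<open>Each step of \<open>f \<rightarrow> f1 \<rightarrow> f2 \<rightarrow> f'\<close> is a straight-line homotopy: \<open>c\<close> vanishes where \<open>f\<close> misses the open
    star of \<open>v\<close>, and \<open>c = 1\<close> wherever \<open>f'\<close> may differ from the projection of \<open>f\<close>.\<close>
  define c where "c x = min 1 (3/2 * \<phi> x)" for x
  define f1 where "f1 x = (\<lambda>w. (1 - c x) * f x w + c x * vertex_point v w)" for x
  define f2 where "f2 x = (\<lambda>w. (1 - c x) * f' x w + c x * vertex_point v w)" for x
  have c01: "0 \<le> c x" "c x \<le> 1" "\<phi> x = 0 \<Longrightarrow> c x = 0" "2/3 < \<phi> x \<Longrightarrow> c x = 1" if "x \<in> ?S" for x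
    using \<phi>0[OF that] by (auto simp: c_def)
  have cc: "continuous_on ?S c" unfolding c_def by (intro continuous_intros \<phi>c)
  have a: "f x \<in> closed_simplex (\<sigma> x) \<and> f1 x \<in> closed_simplex (\<sigma> x)" if x: "x \<in> ?S" for x
  proof (cases "\<phi> x = 0")
    case True then show ?thesis using s(2)[OF x] c01(3)[OF x] by (simp add: f1_def)
  next
    case False
    then have "v \<in> \<sigma> x" using \<phi>0[OF x] by auto
    then show ?thesis unfolding f1_def
      by (intro conjI closed_simplex_convex s(2)[OF x] vertex_point_in[OF s(3)[OF x]] c01(1,2)[OF x])
  qed
  have b: "f1 x \<in> closed_simplex (\<sigma> x) \<and> f2 x \<in> closed_simplex (\<sigma> x)" if x: "x \<in> ?S" for x
  proof (cases "\<phi> x \<le> 2/3")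
    case True
    then have p: "f' x \<in> closed_simplex (\<sigma> x)"
      using f'(2)[OF x] closed_simplex_mono[OF s(3)[OF x] _ ps(1)[OF x]] by auto
    show ?thesis
    proof (cases "\<phi> x = 0")
      case True then show ?thesis using p a[OF x] c01(3)[OF x] by (simp add: f2_def)
    next
      case False
      then have "v \<in> \<sigma> x" using \<phi>0[OF x] by auto
      then show ?thesis using a[OF x] unfolding f2_def
        by (intro conjI closed_simplex_convex p vertex_point_in[OF s(3)[OF x]] c01(1,2)[OF x]) auto
    qed
  next
    case False
    then have "f1 x = f2 x" using c01(4)[OF x] by (simp add: f1_def f2_def)
    then show ?thesis using a[OF x] by simp
  qed
  have e: "\<exists>\<tau>\<in>K. f2 x \<in> closed_simplex \<tau> \<and> f' x \<in> closed_simplex \<tau>" if x: "x \<in> ?S" for x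
  proof (cases "\<phi> x = 0")
    case True
    then have "f2 x = f' x" using c01(3)[OF x] by (simp add: f2_def)
    then show ?thesis using W'(3)[OF x] realization_set_mono[OF DK] by (auto simp: realization_set_def)
  next
    case False
    then have "f' x \<in> realization_set ?L" using f'(3)[OF x] \<phi>0(1)[OF x] by auto
    then obtain \<tau> where t: "\<tau> \<in> ?L" "f' x \<in> closed_simplex \<tau>" by (auto simp: realization_set_def)
    have tK: "\<tau> \<union> {v} \<in> K" using t(1) by (auto simp: link_def)
    have fin: "finite (\<tau> \<union> {v})" by (rule abstract_complexD(1)[OF K tK])
    have t': "f' x \<in> closed_simplex (\<tau> \<union> {v})" by (rule closed_simplex_mono[OF fin _ t(2)]) auto
    then have "f2 x \<in> closed_simplex (\<tau> \<union> {v})" unfolding f2_def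
      by (intro closed_simplex_convex vertex_point_in[OF fin] c01(1,2)[OF x]) auto
    then show ?thesis using t' tK by blast
  qed
  have "finite_map K ?S f1"
  proof (rule finite_mapI[OF K, of _ _ "insert v W"])
    show "continuous_on ?S f1" unfolding f1_def
      by (intro continuous_on_coordinatewise_then_product continuous_intros cc
          continuous_on_product_then_coordinatewise[OF W(2)])
    fix x assume x: "x \<in> ?S"
    show "f1 x \<in> realization_set K" using a[OF x] s(1)[OF x] by (auto simp: realization_set_def)
    show "support (f1 x) \<subseteq> insert v W"
      using W(4)[OF x] by (auto simp: f1_def support_def vertex_point_def split: if_splits)
  qed (use W(1) in auto)
  moreover have f2: "finite_map K ?S f2"
  proof (rule finite_mapI[OF K, of _ _ "insert v W'"])
    show "continuous_on ?S f2" unfolding f2_def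
      by (intro continuous_on_coordinatewise_then_product continuous_intros cc
          continuous_on_product_then_coordinatewise[OF W'(2)])
    fix x assume x: "x \<in> ?S"
    show "f2 x \<in> realization_set K" using b[OF x] s(1)[OF x] by (auto simp: realization_set_def)
    show "support (f2 x) \<subseteq> insert v W'"
      using W'(4)[OF x] by (auto simp: f2_def support_def vertex_point_def split: if_splits)
  qed (use W'(1) in auto)
  ultimately have fm: "finite_map K ?S f1" "finite_map K ?S f2" by auto
  obtain g2 where g2: "finite_map K (cube I) g2" "\<And>x. x \<in> ?S \<Longrightarrow> g2 x = f2 x"
    using straight_homotopy[OF K I(1) fm(2) finite_map_mono[OF f'(1) DK] e finite_map_mono[OF g'(1) DK] g'(2)] by metis
  obtain g1 where g1: "finite_map K (cube I) g1" "\<And>x. x \<in> ?S \<Longrightarrow> g1 x = f1 x"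
    using straight_homotopy[OF K I(1) fm(1,2) _ g2] b s(1) by metis
  show "\<exists>g. finite_map K (cube I) g \<and> (\<forall>x\<in>?S. g x = f x)"
    using straight_homotopy[OF K I(1) f fm(1) _ g1] a s(1) by metis
qed

lemma link_link:
  assumes "abstract_complex K" "\<sigma> \<in> link K \<tau>"
  shows "link (link K \<tau>) \<sigma> = link K (\<sigma> \<union> \<tau>)"
proof (intro equalityI subsetI)
  fix \<rho> assume "\<rho> \<in> link (link K \<tau>) \<sigma>"
  then show "\<rho> \<in> link K (\<sigma> \<union> \<tau>)" by (auto simp: link_def Un_assoc)
next
  fix \<rho> assume r: "\<rho> \<in> link K (\<sigma> \<union> \<tau>)"
  then have K: "\<rho> \<in> K" "\<rho> \<union> (\<sigma> \<union> \<tau>) \<in> K" "\<rho> \<inter> (\<sigma> \<union> \<tau>) = {}" by (auto simp: link_def)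
  have ne: "\<rho> \<noteq> {}" using abstract_complexD(2)[OF assms(1) K(1)] .
  have "\<rho> \<union> \<tau> \<in> K" "\<rho> \<union> \<sigma> \<in> K"
    using abstract_complexD(3)[OF assms(1) K(2), of "\<rho> \<union> \<tau>"]
      abstract_complexD(3)[OF assms(1) K(2), of "\<rho> \<union> \<sigma>"] ne by auto
  then show "\<rho> \<in> link (link K \<tau>) \<sigma>" using K assms(2) by (auto simp: link_def Un_assoc)
qed

text \<open>Vertices are added one at a time. The link of the new vertex \<open>w\<close> is the
  full subcomplex of \<open>link K {w}\<close> on \<open>V \<union> W\<close>, a problem of the same
  kind one degree lower. Hence the induction varies \<open>K\<close> and \<open>d\<close>, and the
  hypothesis speaks of every simplex on the new vertices.\<close>

lemma cconn_add_finitely_many_vertices: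
  assumes "finite W" "V \<inter> W = {}" "abstract_complex K" "cconn d (induced K V)"
    and "\<And>\<sigma>. \<sigma> \<in> K \<Longrightarrow> \<sigma> \<subseteq> W \<Longrightarrow> cconn (d - int (card \<sigma>)) (induced (link K \<sigma>) V)"
  shows "cconn d (induced K (V \<union> W))"
  using assms
proof (induction W arbitrary: d K rule: finite_induct)
  case empty then show ?case by simp
next
  case (insert w W)
  note K = insert.prems(2)
  let ?X = "induced K (V \<union> insert w W)"
  have D: "cconn d (induced K (V \<union> W))"
    using insert.prems by (intro insert.IH) auto
  show ?case
  proof (cases "{w} \<in> K")
    case False
    have "w \<notin> \<sigma>" if "\<sigma> \<in> K" for \<sigma>
      using abstract_complexD(3)[OF K that, of "{w}"] False by auto
    then have "?X = induced K (V \<union> W)" by (auto simp: induced_def)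
    then show ?thesis using D by simp
  next
    case True
    have 1: "induced ?X (- {w}) = induced K (V \<union> W)"
      using insert.hyps insert.prems(1) by (auto simp: induced_def)
    have 2: "link ?X {w} = induced (link K {w}) (V \<union> W)"
      by (auto simp: induced_def link_def)
    have "cconn (d - 1) (induced (link K {w}) (V \<union> W))"
    proof (rule insert.IH)
      show "cconn (d - 1) (induced (link K {w}) V)" using insert.prems(4)[OF True] by simp
      fix \<sigma> assume s: "\<sigma> \<in> link K {w}" "\<sigma> \<subseteq> W"
      then have s': "insert w \<sigma> \<in> K" "w \<notin> \<sigma>" "finite \<sigma>"
        using abstract_complexD(1)[OF K] by (auto simp: link_def)
      then have "cconn (d - int (card (insert w \<sigma>))) (induced (link K (insert w \<sigma>)) V)"
        using insert.prems(4)[of "insert w \<sigma>"] s(2) by blast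
      moreover have "d - int (card (insert w \<sigma>)) = d - 1 - int (card \<sigma>)" using s' by simp
      ultimately show "cconn (d - 1 - int (card \<sigma>)) (induced (link (link K {w}) \<sigma>) V)"
        using link_link[OF K s(1)] by simp
    qed (use insert.prems(1) abstract_complex_link[OF K] in auto)
    then show ?thesis
      by (intro cconn_glue_vertex[OF abstract_complex_induced[OF K], of _ _ w]) (use D 1 2 in auto)
  qed
qed

text \<open>A map to be filled meets only finitely many vertices, so the finite case applies to
  those outside \<open>V\<close>.\<close>

lemma cconn_add_vertices:
  assumes K: "abstract_complex K" and V: "cconn d (induced K V)"
    and L: "\<And>\<sigma>. \<sigma> \<in> K \<Longrightarrow> \<sigma> \<inter> V = {} \<Longrightarrow> cconn (d - int (card \<sigma>)) (induced (link K \<sigma>) V)"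
  shows "cconn d K"
proof (rule cconnI)
  fix I f assume I: "finite I" "int (card I) \<le> d + 1" and f: "finite_map K (cube_boundary I) f"
  obtain W where W: "finite W" "continuous_on (cube_boundary I) f" "f ` cube_boundary I \<subseteq> realization_set (induced K W)"
    using f unfolding finite_map_def by blast
  let ?X = "induced K (V \<union> (W - V))"
  have "cconn d ?X"
    by (rule cconn_add_finitely_many_vertices) (use W(1) K V L in blast)+
  moreover have "induced ?X W = induced K W" by (auto simp: induced_def)
  then have "finite_map ?X (cube_boundary I) f" using W unfolding finite_map_def by metis
  ultimately obtain g where "finite_map ?X (cube I) g" "\<And>x. x \<in> cube_boundary I \<Longrightarrow> g x = f x"
    using cconnE[of d ?X I f] I by metis
  moreover have "?X \<subseteq> K" by (auto simp: induced_def)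
  ultimately show "\<exists>g. finite_map K (cube I) g \<and> (\<forall>x\<in>cube_boundary I. g x = f x)"
    using finite_map_mono by blast
qed

section \<open>Attaching single simplices\<close>

definition simplex_boundary :: "'v set \<Rightarrow> 'v set set" where
  "simplex_boundary \<tau> = {\<rho>. \<rho> \<subset> \<tau> \<and> \<rho> \<noteq> {}}"

text \<open>A sphere of dimension \<open>card \<tau> - 2\<close>: removing a vertex \<open>v\<close>
  leaves a full simplex, hence a cone, and the link of \<open>v\<close> is the boundary of the
  opposite face.\<close>

lemma cconn_simplex_boundary:
  assumes "finite \<tau>" "\<tau> \<noteq> {}" shows "cconn (int (card \<tau>) - 3) (simplex_boundary \<tau>)"
  using assms
proof (induction \<tau> rule: finite_ne_induct)
  case (singleton v) then show ?case by (intro cconn_trivial) simp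
next
  case (insert v \<tau>)
  have K: "abstract_complex (simplex_boundary (insert v \<tau>))"
    using insert.hyps by (auto simp: abstract_complex_def simplex_boundary_def intro: finite_subset)
  obtain w where w: "w \<in> \<tau>" using insert.hyps by auto
  have "induced (simplex_boundary (insert v \<tau>)) (- {v}) = {\<rho>. \<rho> \<subseteq> \<tau> \<and> \<rho> \<noteq> {}}"
    using insert.hyps by (auto simp: induced_def simplex_boundary_def)
  moreover have "abstract_complex {\<rho>. \<rho> \<subseteq> \<tau> \<and> \<rho> \<noteq> {}}"
    using insert.hyps by (auto simp: abstract_complex_def intro: finite_subset)
  then have "cconn (int (card (insert v \<tau>)) - 3) {\<rho>. \<rho> \<subseteq> \<tau> \<and> \<rho> \<noteq> {}}"
    by (rule cconn_cone[of _ w]) (use w in auto)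
  moreover have "link (simplex_boundary (insert v \<tau>)) {v} = simplex_boundary \<tau>"
    using insert.hyps by (auto simp: link_def simplex_boundary_def)
  ultimately show ?case
    using insert by (intro cconn_glue_vertex[OF K, of _ v]) auto
qed

text \<open>The inserted 1 keeps the minimum defined for every \<open>\<tau>\<close>; barycentric
  coordinates are at most 1, so it changes nothing for nonempty \<open>\<tau>\<close>.\<close>

definition min_weight :: "'v set \<Rightarrow> ('v \<Rightarrow> real) \<Rightarrow> real" where
  "min_weight \<tau> \<alpha> = Min (insert 1 (\<alpha> ` \<tau>))"

text \<open>The linear subdivision of the simplex \<open>\<tau>\<close> at its barycentre, with the barycentre renamed \<open>u\<close>.\<close>

definition star_out :: "'v set \<Rightarrow> 'v \<Rightarrow> ('v \<Rightarrow> real) \<Rightarrow> 'v \<Rightarrow> real" where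
  "star_out \<tau> u \<alpha> = (\<lambda>x. \<alpha> x - (if x \<in> \<tau> then min_weight \<tau> \<alpha> else 0) + (if x = u then real (card \<tau>) * min_weight \<tau> \<alpha> else 0))"

lemma continuous_on_min_weight:
  assumes "finite \<tau>" "continuous_on S f"
  shows "continuous_on S (\<lambda>x. min_weight \<tau> (f x))"
  unfolding min_weight_def using assms(1)
proof (induction \<tau> rule: finite_induct)
  case (insert v \<tau>)
  have "Min (insert 1 (f x ` insert v \<tau>)) = min (f x v) (Min (insert 1 (f x ` \<tau>)))" for x
    using insert.hyps by (simp add: insert_commute[of 1])
  then show ?case
    using insert by (simp add: continuous_on_min continuous_on_product_then_coordinatewise[OF assms(2)])
qed simp

lemma continuous_on_star_out:
  assumes "finite \<tau>" "continuous_on S f"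
  shows "continuous_on S (\<lambda>x. star_out \<tau> u (f x))"
  unfolding star_out_def
proof (rule continuous_on_coordinatewise_then_product)
  fix w
  show "continuous_on S (\<lambda>x. f x w - (if w \<in> \<tau> then min_weight \<tau> (f x) else 0)
      + (if w = u then real (card \<tau>) * min_weight \<tau> (f x) else 0))"
    by (cases "w \<in> \<tau>"; cases "w = u")
      (auto intro!: continuous_intros continuous_on_product_then_coordinatewise[OF assms(2)] continuous_on_min_weight[OF assms])
qed

text \<open>Since \<open>\<tau>\<close> is not a simplex of \<open>K\<close>, every point of
  \<open>K\<close> has weight 0 at some vertex of \<open>\<tau>\<close>, so the amount moved to
  \<open>u\<close> is zero.\<close>

lemma star_out_fixed:
  assumes K: "abstract_complex K" and t: "finite \<tau>" "\<tau> \<noteq> {}" "\<tau> \<notin> K" and a: "\<alpha> \<in> realization_set K"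
  shows "star_out \<tau> u \<alpha> = \<alpha>"
proof -
  have s: "support \<alpha> \<in> K" "\<alpha> \<in> closed_simplex (support \<alpha>)" using a by (auto simp: realization_set_iff[OF K])
  have "\<not> \<tau> \<subseteq> support \<alpha>" using abstract_complexD(3)[OF K s(1)] t by auto
  then obtain x where x: "x \<in> \<tau>" "\<alpha> x = 0" by (auto simp: support_def)
  have "min_weight \<tau> \<alpha> = 0" unfolding min_weight_def
    using x t(1) s(2) by (intro Min_eqI) (force simp: closed_simplex_def)+
  then show ?thesis by (auto simp: star_out_def)
qed

text \<open>Subtracting the minimal weight kills the coordinate at some \<open>x0\<close>, and the
  mass collected at \<open>u\<close> is exactly what was removed. So a point of
  \<open>\<tau>\<close> lands in the cone from \<open>u\<close> over the face opposite
  \<open>x0\<close>.\<close>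

lemma star_out_in:
  assumes K: "abstract_complex K" and t: "finite \<tau>" "\<tau> \<noteq> {}" "\<tau> \<notin> K" "u \<notin> \<tau>"
    and u: "\<And>\<rho>. \<rho> \<subset> \<tau> \<Longrightarrow> insert u \<rho> \<in> K"
    and a: "\<alpha> \<in> realization_set (insert \<tau> K)"
  shows "star_out \<tau> u \<alpha> \<in> realization_set K"
proof (cases "\<alpha> \<in> realization_set K")
  case True then show ?thesis using star_out_fixed[OF K t(1-3)] by simp
next
  case False
  then have at: "\<alpha> \<in> closed_simplex \<tau>" using a by (auto simp: realization_set_def)
  let ?m = "min_weight \<tau> \<alpha>"
  have "?m \<in> insert 1 (\<alpha> ` \<tau>)" unfolding min_weight_def using t(1) by (intro Min_in) auto
  have le: "?m \<le> \<alpha> x" if "x \<in> \<tau>" for x unfolding min_weight_def using that t(1) by (intro Min_le) auto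
  have m0: "0 \<le> ?m" unfolding min_weight_def using t(1) at by (intro Min.boundedI) (auto simp: closed_simplex_def)
  have "\<exists>x\<in>\<tau>. \<alpha> x = ?m"
  proof (cases "?m = 1")
    case True
    obtain x where "x \<in> \<tau>" using t(2) by auto
    then show ?thesis using le[of x] closed_simplex_le_1[OF t(1) at, of x] True by force
  next
    case False then show ?thesis using \<open>?m \<in> insert 1 (\<alpha> ` \<tau>)\<close> by auto
  qed
  then obtain x0 where x0: "x0 \<in> \<tau>" "\<alpha> x0 = ?m" by auto
  let ?\<rho> = "\<tau> - {x0}" and ?b = "star_out \<tau> u \<alpha>"
  have rK: "insert u ?\<rho> \<in> K" using u[of ?\<rho>] x0(1) by blast
  have au: "\<alpha> u = 0" using at t(4) by (auto simp: closed_simplex_def)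
  have "?b \<in> closed_simplex (insert u ?\<rho>)"
    unfolding closed_simplex_def mem_Collect_eq
  proof (intro conjI allI impI)
    fix x
    show "0 \<le> ?b x" using le m0 at t(4) by (auto simp: star_out_def closed_simplex_def)
    show "?b x = 0" if "x \<notin> insert u ?\<rho>" using that x0 at by (auto simp: star_out_def closed_simplex_def)
  next
    have "sum ?b (insert u ?\<rho>) = ?b u + sum ?b ?\<rho>" using t(1,4) by (intro sum.insert) auto
    also have "sum ?b ?\<rho> = sum ?b \<tau>"
      using t(1,4) x0 by (intro sum.mono_neutral_left) (auto simp: star_out_def)
    also have "sum ?b \<tau> = (\<Sum>x\<in>\<tau>. \<alpha> x - ?m)"
      using t(4) by (intro sum.cong) (auto simp: star_out_def)
    also have "\<dots> = 1 - real (card \<tau>) * ?m" using at by (simp add: sum_subtractf closed_simplex_def)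
    also have "?b u = real (card \<tau>) * ?m" using t(4) au by (simp add: star_out_def)
    finally show "sum ?b (insert u ?\<rho>) = 1" by simp
  qed
  then show ?thesis using rK by (auto simp: realization_set_def)
qed

lemma support_star_out: "support (star_out \<tau> u \<alpha>) \<subseteq> support \<alpha> \<union> insert u \<tau>"
  by (auto simp: support_def star_out_def split: if_splits)

lemma abstract_complex_insert:
  assumes "abstract_complex K" "finite \<tau>" "\<tau> \<noteq> {}" "simplex_boundary \<tau> \<subseteq> K"
  shows "abstract_complex (insert \<tau> K)"
  using assms unfolding abstract_complex_def simplex_boundary_def by blast

lemma finite_map_star_out:
  assumes K: "abstract_complex K" and t: "finite \<tau>" "\<tau> \<noteq> {}" "\<tau> \<notin> K" "u \<notin> \<tau>" "simplex_boundary \<tau> \<subseteq> K"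
    and u: "\<And>\<rho>. \<rho> \<subset> \<tau> \<Longrightarrow> insert u \<rho> \<in> K"
    and g: "finite_map (insert \<tau> K) S g"
  shows "finite_map K S (\<lambda>x. star_out \<tau> u (g x))"
proof -
  obtain W where W: "finite W" "continuous_on S g" "\<And>x. x \<in> S \<Longrightarrow> g x \<in> realization_set (insert \<tau> K)"
    "\<And>x. x \<in> S \<Longrightarrow> support (g x) \<subseteq> W"
    using finite_mapE[OF g abstract_complex_insert[OF K t(1,2,5)]] by metis
  show ?thesis
  proof (rule finite_mapI[OF K continuous_on_star_out[OF t(1) W(2)], of "W \<union> insert u \<tau>"])
    show "star_out \<tau> u (g x) \<in> realization_set K" if "x \<in> S" for x
      using star_out_in[OF K t(1-4) u W(3)[OF that]] by simp
    show "support (star_out \<tau> u (g x)) \<subseteq> W \<union> insert u \<tau>" if "x \<in> S" for x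
      using support_star_out[of \<tau> u "g x"] W(4)[OF that] by blast
  qed (use W(1) t(1) in auto)
qed

text \<open>A filling in \<open>U\<close> meets only finitely many simplices outside
  \<open>B\<close>. Each of them is traded for the cone from \<open>u\<close> over its boundary,
  which lies in \<open>B\<close>. As the proper faces of such a simplex are in \<open>B\<close>
  already, the simplices can be pushed away one after another, while points of \<open>B\<close>
  never move.\<close>

lemma cconn_delete_simplices:
  assumes B: "abstract_complex B" and U: "abstract_complex U" "B \<subseteq> U" "cconn d U"
    and del: "\<And>\<tau>. \<tau> \<in> U - B \<Longrightarrow> simplex_boundary \<tau> \<subseteq> B \<and> (\<exists>u. \<forall>\<rho>. \<rho> \<subset> \<tau> \<longrightarrow> insert u \<rho> \<in> B)"
  shows "cconn d B"
proof (rule cconnI)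
  fix I f assume I: "finite I" "int (card I) \<le> d + 1" and f: "finite_map B (cube_boundary I) f"
  have elim: "\<exists>g'. finite_map B (cube I) g' \<and> (\<forall>x\<in>cube I. g x \<in> realization_set B \<longrightarrow> g' x = g x)"
    if "finite \<T>" "\<T> \<subseteq> U - B" "finite_map (B \<union> \<T>) (cube I) g" for \<T> g
    using that
  proof (induction \<T> arbitrary: g rule: finite_induct)
    case empty then show ?case by auto
  next
    case (insert \<tau> \<T>)
    have t: "\<tau> \<in> U - B" using insert.prems by auto
    then have tf: "finite \<tau>" "\<tau> \<noteq> {}" using abstract_complexD[OF U(1)] by auto
    obtain u where u: "\<And>\<rho>. \<rho> \<subset> \<tau> \<Longrightarrow> insert u \<rho> \<in> B" and bd: "simplex_boundary \<tau> \<subseteq> B" using del[OF t] by auto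
    \<comment> \<open>Otherwise the cone condition for \<open>\<tau> - {u}\<close> would put
      \<open>\<tau>\<close> itself into \<open>B\<close>.\<close>
    have un: "u \<notin> \<tau>"
    proof
      assume "u \<in> \<tau>"
      then have "insert u (\<tau> - {u}) = \<tau>" "\<tau> - {u} \<subset> \<tau>" by auto
      then show False using u[of "\<tau> - {u}"] t by auto
    qed
    have K: "abstract_complex (B \<union> \<T>)"
      unfolding abstract_complex_def
    proof (intro ballI conjI allI impI)
      fix \<sigma> assume s: "\<sigma> \<in> B \<union> \<T>"
      then have "\<sigma> \<in> U" using U(2) insert.prems by auto
      then show "finite \<sigma>" "\<sigma> \<noteq> {}" using abstract_complexD[OF U(1)] by auto
      fix \<rho> assume r: "\<rho> \<subseteq> \<sigma> \<and> \<rho> \<noteq> {}"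
      show "\<rho> \<in> B \<union> \<T>"
      proof (cases "\<sigma> \<in> B")
        case True then show ?thesis using r abstract_complexD(3)[OF B True] by auto
      next
        case False
        then have "simplex_boundary \<sigma> \<subseteq> B" using del[of \<sigma>] \<open>\<sigma> \<in> U\<close> by auto
        then show ?thesis using r s by (cases "\<rho> = \<sigma>") (auto simp: simplex_boundary_def)
      qed
    qed
    have g: "finite_map (insert \<tau> (B \<union> \<T>)) (cube I) g" using insert.prems(2) by simp
    have tn: "\<tau> \<notin> B \<union> \<T>" using t insert.hyps by auto
    have "finite_map (B \<union> \<T>) (cube I) (\<lambda>x. star_out \<tau> u (g x))"
      by (rule finite_map_star_out[OF K tf tn un _ _ g]) (use u bd in auto)
    then have "\<exists>g'. finite_map B (cube I) g' \<and>
        (\<forall>x\<in>cube I. star_out \<tau> u (g x) \<in> realization_set B \<longrightarrow> g' x = star_out \<tau> u (g x))"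
      using insert.prems(1) by (intro insert.IH) auto
    then obtain g' where g': "finite_map B (cube I) g'"
      "\<And>x. x \<in> cube I \<Longrightarrow> star_out \<tau> u (g x) \<in> realization_set B \<Longrightarrow> g' x = star_out \<tau> u (g x)"
      by blast
    have "g' x = g x" if "x \<in> cube I" "g x \<in> realization_set B" for x
      using star_out_fixed[OF B tf _ that(2), of u] g'(2)[OF that(1)] that(2) t by auto
    then show ?case using g'(1) by blast
  qed
  obtain g where g: "finite_map U (cube I) g" "\<And>x. x \<in> cube_boundary I \<Longrightarrow> g x = f x"
    using cconnE[OF U(3) I finite_map_mono[OF f U(2)]] by metis
  obtain W where W: "finite W" "continuous_on (cube I) g" "g ` cube I \<subseteq> realization_set (induced U W)"
    using g(1) unfolding finite_map_def by blast
  let ?T = "induced U W - B"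
  have fin: "finite ?T" by (rule finite_subset[of _ "Pow W"]) (use W(1) in \<open>auto simp: induced_def\<close>)
  have "realization_set (induced U W) \<subseteq> realization_set (induced (B \<union> ?T) W)"
    by (rule realization_set_mono) (auto simp: induced_def)
  then have fm: "finite_map (B \<union> ?T) (cube I) g" using W unfolding finite_map_def by blast
  have sub: "?T \<subseteq> U - B" by (auto simp: induced_def)
  obtain g' where g': "finite_map B (cube I) g'" "\<And>x. x \<in> cube I \<Longrightarrow> g x \<in> realization_set B \<Longrightarrow> g' x = g x"
    using elim[OF fin sub fm] by blast
  have "g' x = f x" if "x \<in> cube_boundary I" for x
  proof -
    have "f x \<in> realization_set B" using that finite_mapE[OF f B] by metis
    then show ?thesis using g'(2)[of x] g(2)[OF that] that cube_boundary_subset by auto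
  qed
  then show "\<exists>g. finite_map B (cube I) g \<and> (\<forall>x\<in>cube_boundary I. g x = f x)" using g'(1) by blast
qed

text \<open>In place of \<open>\<tau>\<close> the cone from a fresh vertex \<open>b\<close> over its
  boundary is attached. By \<open>cconn_glue_vertex\<close> this keeps the connectivity, because the
  boundary is a sphere of dimension \<open>card \<tau> - 2 \<ge> d\<close>. The two complexes differ
  by a subdivision of \<open>\<tau>\<close>: maps are carried over by \<open>star_out\<close>, and
  the filling is carried back by \<open>\<pi>\<close>.\<close>

lemma cconn_insert_simplex:
  assumes K: "abstract_complex K" and t: "finite \<tau>" "\<tau> \<noteq> {}" "\<tau> \<notin> K" "simplex_boundary \<tau> \<subseteq> K"
    and c: "cconn d K" "d + 2 \<le> int (card \<tau>)" and b: "b \<notin> \<Union>K" "b \<notin> \<tau>"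
  shows "cconn d (insert \<tau> K)"
proof (rule cconnI)
  fix I f assume I: "finite I" "int (card I) \<le> d + 1" and f: "finite_map (insert \<tau> K) (cube_boundary I) f"
  let ?K = "K \<union> {insert b \<rho> | \<rho>. \<rho> \<subset> \<tau>}"
  have sub: "\<rho> \<in> K" if "\<rho> \<subset> \<tau>" "\<rho> \<noteq> {}" for \<rho> using that t(4) by (auto simp: simplex_boundary_def)
  have Kc: "abstract_complex ?K"
    unfolding abstract_complex_def
  proof (intro ballI conjI allI impI)
    fix \<sigma> assume s: "\<sigma> \<in> ?K"
    then show "finite \<sigma>" "\<sigma> \<noteq> {}" using abstract_complexD[OF K] t(1) by (auto intro: finite_subset)
    fix \<rho> assume r: "\<rho> \<subseteq> \<sigma> \<and> \<rho> \<noteq> {}"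
    show "\<rho> \<in> ?K"
    proof (cases "\<sigma> \<in> K")
      case True then show ?thesis using r abstract_complexD(3)[OF K True] by auto
    next
      case False
      then obtain \<rho>' where r': "\<sigma> = insert b \<rho>'" "\<rho>' \<subset> \<tau>" using s by auto
      show ?thesis
      proof (cases "b \<in> \<rho>")
        case True
        then have "\<rho> = insert b (\<rho> - {b})" "\<rho> - {b} \<subset> \<tau>" using r r' b(2) by auto
        then show ?thesis by blast
      next
        case False
        then have "\<rho> \<subset> \<tau>" using r r' by auto
        then show ?thesis using sub r by auto
      qed
    qed
  qed
  have 1: "induced ?K (- {b}) = K" using b(1) by (auto simp: induced_def)
  have 2: "link ?K {b} = simplex_boundary \<tau>"
  proof (intro equalityI subsetI)
    fix \<rho> assume "\<rho> \<in> link ?K {b}"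
    then have r: "\<rho> \<in> ?K" "b \<notin> \<rho>" "insert b \<rho> \<in> ?K" by (auto simp: link_def)
    then have "\<rho> \<in> K" by auto
    then have ne: "\<rho> \<noteq> {}" using abstract_complexD(2)[OF K] by auto
    obtain \<rho>' where "insert b \<rho> = insert b \<rho>'" "\<rho>' \<subset> \<tau>" using r(3) b(1) by auto
    then have "\<rho> = \<rho>'" using r(2) b(2) by (metis insert_ident psubsetD)
    then show "\<rho> \<in> simplex_boundary \<tau>" using ne \<open>\<rho>' \<subset> \<tau>\<close> by (auto simp: simplex_boundary_def)
  next
    fix \<rho> assume r: "\<rho> \<in> simplex_boundary \<tau>"
    then have "\<rho> \<in> K" using t(4) by auto
    then show "\<rho> \<in> link ?K {b}" using r b by (auto simp: link_def simplex_boundary_def)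
  qed
  have conn: "cconn d ?K"
    by (rule cconn_glue_vertex[OF Kc, of _ b])
      (use 1 2 c cconn_le[OF cconn_simplex_boundary[OF t(1,2)]] in auto)
  have "finite_map (insert \<tau> ?K) (cube_boundary I) f"
    by (rule finite_map_mono[OF f]) auto
  moreover have tn: "\<tau> \<notin> ?K" using t(3) b(2) by auto
  ultimately have fb: "finite_map ?K (cube_boundary I) (\<lambda>x. star_out \<tau> b (f x))"
    using t(4) by (intro finite_map_star_out[OF Kc t(1,2) _ b(2)]) auto
  obtain g where g: "finite_map ?K (cube I) g" "\<And>x. x \<in> cube_boundary I \<Longrightarrow> g x = star_out \<tau> b (f x)"
    by (rule cconnE[OF conn I fb]) blast
  \<comment> \<open>\<open>\<pi>\<close> sends \<open>b\<close> to the barycentre of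
    \<open>\<tau>\<close>, undoing the subdivision.\<close>
  define \<pi> where "\<pi> \<beta> = (\<lambda>x. (if x = b then 0 else \<beta> x) + (if x \<in> \<tau> then \<beta> b / real (card \<tau>) else 0))" for \<beta> :: "'a \<Rightarrow> real"
  obtain W where W: "finite W" "continuous_on (cube I) g" "\<And>x. x \<in> cube I \<Longrightarrow> g x \<in> realization_set ?K"
    "\<And>x. x \<in> cube I \<Longrightarrow> support (g x) \<subseteq> W"
    by (rule finite_mapE[OF g(1) Kc]) blast
  have K': "abstract_complex (insert \<tau> K)" by (rule abstract_complex_insert[OF K t(1,2,4)])
  have \<pi>: "\<pi> \<beta> \<in> realization_set (insert \<tau> K)" if be: "\<beta> \<in> realization_set ?K" for \<beta>
  proof -
    have s: "support \<beta> \<in> ?K" "\<beta> \<in> closed_simplex (support \<beta>)" using be by (auto simp: realization_set_iff[OF Kc])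
    show ?thesis
    proof (cases "b \<in> support \<beta>")
      case False
      then have "\<beta> b = 0" by (auto simp: support_def)
      then have "\<pi> \<beta> = \<beta>" by (auto simp: \<pi>_def)
      moreover have "support \<beta> \<in> K" using s(1) False by auto
      ultimately show ?thesis using s(2) by (auto simp: realization_set_def)
    next
      case True
      then obtain \<rho> where r: "support \<beta> = insert b \<rho>" "\<rho> \<subset> \<tau>" using s(1) b(1) by auto
      have bt: "\<beta> \<in> closed_simplex (insert b \<tau>)"
        by (rule closed_simplex_mono[OF _ _ s(2)]) (use t(1) r in auto)
      have "sum (\<pi> \<beta>) \<tau> = (\<Sum>x\<in>\<tau>. \<beta> x + \<beta> b / real (card \<tau>))"
        using b(2) by (intro sum.cong) (auto simp: \<pi>_def)
      also have "\<dots> = sum \<beta> \<tau> + \<beta> b" using t(1,2) by (simp add: sum.distrib)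
      also have "\<dots> = 1" using bt b(2) t(1) by (simp add: closed_simplex_def)
      finally have "\<pi> \<beta> \<in> closed_simplex \<tau>" using bt by (auto simp: closed_simplex_def \<pi>_def)
      then show ?thesis by (auto simp: realization_set_def)
    qed
  qed
  have \<pi>s: "\<pi> (star_out \<tau> b \<alpha>) = \<alpha>" if "\<alpha> \<in> realization_set (insert \<tau> K)" for \<alpha>
  proof -
    have "support \<alpha> \<in> insert \<tau> K" using that by (auto simp: realization_set_iff[OF K'])
    then have "b \<notin> support \<alpha>" using b by auto
    then have "\<alpha> b = 0" by (auto simp: support_def)
    then show ?thesis using b(2) t(1,2) by (auto simp: \<pi>_def star_out_def)
  qed
  have "finite_map (insert \<tau> K) (cube I) (\<lambda>x. \<pi> (g x))"
  proof (rule finite_mapI[OF K', of _ _ "W \<union> \<tau>"])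
    have gw: "continuous_on (cube I) (\<lambda>x. g x w)" for w
      by (rule continuous_on_product_then_coordinatewise[OF W(2)])
    show "continuous_on (cube I) (\<lambda>x. \<pi> (g x))" unfolding \<pi>_def
    proof (rule continuous_on_coordinatewise_then_product)
      fix w
      show "continuous_on (cube I) (\<lambda>x. (if w = b then 0 else g x w) + (if w \<in> \<tau> then g x b / real (card \<tau>) else 0))"
        by (cases "w = b"; cases "w \<in> \<tau>") (use t(1,2) in \<open>auto intro!: continuous_intros gw\<close>)
    qed
    show "support (\<pi> (g x)) \<subseteq> W \<union> \<tau>" if "x \<in> cube I" for x
      using W(4)[OF that] by (auto simp: support_def \<pi>_def split: if_splits)
  qed (use W \<pi> t(1) in auto)
  moreover have "\<pi> (g x) = f x" if "x \<in> cube_boundary I" for x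
  proof -
    have "f x \<in> realization_set (insert \<tau> K)" using that finite_mapE[OF f K'] by metis
    then show ?thesis using g(2)[OF that] \<pi>s by simp
  qed
  ultimately show "\<exists>g. finite_map (insert \<tau> K) (cube I) g \<and> (\<forall>x\<in>cube_boundary I. g x = f x)" by blast
qed

text \<open>Attaching cells of dimension above \<open>d\<close> does not spoil connectivity in
  degree \<open>d\<close>. The finitely many simplices met by a given map are attached in order of
  increasing size, and \<open>b\<close> serves as the fresh vertex at every stage.\<close>

lemma cconn_add_large_simplices:
  assumes K0: "abstract_complex K0" "cconn d K0" and K: "abstract_complex K" "K0 \<subseteq> K"
    and big: "\<And>\<tau>. \<tau> \<in> K - K0 \<Longrightarrow> d + 2 \<le> int (card \<tau>)" and b: "b \<notin> \<Union>K"
  shows "cconn d K"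
proof (rule cconnI)
  fix I f assume I: "finite I" "int (card I) \<le> d + 1" and f: "finite_map K (cube_boundary I) f"
  have add: "cconn d (K0 \<union> \<T>)" if "finite \<T>" "\<T> \<subseteq> K - K0" "abstract_complex (K0 \<union> \<T>)" for \<T>
    using that
  proof (induction "card \<T>" arbitrary: \<T>)
    case 0 then show ?case using K0 by auto
  next
    case (Suc n)
    have ne: "\<T> \<noteq> {}" using Suc.hyps(2) by auto
    have "Max (card ` \<T>) \<in> card ` \<T>" using Suc.prems(1) ne by (intro Max_in) auto
    then obtain \<tau> where t: "\<tau> \<in> \<T>" "card \<tau> = Max (card ` \<T>)" by auto
    have mx: "card \<sigma> \<le> card \<tau>" if "\<sigma> \<in> \<T>" for \<sigma> using that t(2) Suc.prems(1) by simp
    let ?T = "\<T> - {\<tau>}"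
    have tK: "\<tau> \<in> K - K0" using t(1) Suc.prems(2) by auto
    note tf = abstract_complexD[OF K(1), of \<tau>]
    have notin: "\<tau> \<noteq> \<rho>" if "\<rho> \<subseteq> \<sigma>" "\<sigma> \<in> K0 \<union> ?T" "\<rho> \<noteq> {}" for \<rho> \<sigma>
    proof
      assume eq: "\<tau> = \<rho>"
      show False
      proof (cases "\<sigma> \<in> K0")
        case True then show False using abstract_complexD(3)[OF K0(1) True, of \<rho>] that tK eq by auto
      next
        case False
        then have s: "\<sigma> \<in> \<T>" "\<sigma> \<noteq> \<tau>" using that(2) by auto
        have "finite \<sigma>" using abstract_complexD(1)[OF Suc.prems(3), of \<sigma>] s by auto
        then have "card \<tau> < card \<sigma>" using that(1) eq s(2) by (intro psubset_card_mono) auto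
        then show False using mx[OF s(1)] by simp
      qed
    qed
    have c': "abstract_complex (K0 \<union> ?T)"
      unfolding abstract_complex_def
    proof (intro ballI conjI allI impI)
      fix \<sigma> assume s: "\<sigma> \<in> K0 \<union> ?T"
      then have s': "\<sigma> \<in> K0 \<union> \<T>" by auto
      show "finite \<sigma>" "\<sigma> \<noteq> {}" using abstract_complexD[OF Suc.prems(3) s'] by auto
      fix \<rho> assume r: "\<rho> \<subseteq> \<sigma> \<and> \<rho> \<noteq> {}"
      then show "\<rho> \<in> K0 \<union> ?T"
        using abstract_complexD(3)[OF Suc.prems(3) s', of \<rho>] notin[of \<rho> \<sigma>] s by auto
    qed
    have "cconn d (insert \<tau> (K0 \<union> ?T))"
    proof (rule cconn_insert_simplex[OF c'])
      show "simplex_boundary \<tau> \<subseteq> K0 \<union> ?T"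
        using abstract_complexD(3)[OF Suc.prems(3), of \<tau>] t(1) by (auto simp: simplex_boundary_def)
      show "cconn d (K0 \<union> ?T)"
        using Suc.hyps(2) Suc.prems t(1) c' by (intro Suc.hyps(1)) auto
      show "b \<notin> \<Union> (K0 \<union> ?T)" using b K(2) Suc.prems(2) by auto
      show "b \<notin> \<tau>" using b tK by auto
    qed (use tf tK big in auto)
    moreover have "insert \<tau> (K0 \<union> ?T) = K0 \<union> \<T>" using t(1) by auto
    ultimately show ?case by simp
  qed
  obtain W where W: "finite W" "continuous_on (cube_boundary I) f" "f ` cube_boundary I \<subseteq> realization_set (induced K W)"
    using f unfolding finite_map_def by blast
  let ?T = "induced K W - K0"
  have fin: "finite ?T" by (rule finite_subset[of _ "Pow W"]) (use W(1) in \<open>auto simp: induced_def\<close>)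
  have eq: "K0 \<union> ?T = K0 \<union> induced K W" by auto
  have cx: "abstract_complex (K0 \<union> ?T)"
    unfolding eq using K0(1) abstract_complex_induced[OF K(1), of W] unfolding abstract_complex_def by blast
  have conn: "cconn d (K0 \<union> ?T)" by (rule add[OF fin _ cx]) (auto simp: induced_def)
  have "realization_set (induced K W) \<subseteq> realization_set (induced (K0 \<union> ?T) W)"
    by (rule realization_set_mono) (auto simp: induced_def)
  then have "finite_map (K0 \<union> ?T) (cube_boundary I) f" using W unfolding finite_map_def by blast
  then obtain g where g: "finite_map (K0 \<union> ?T) (cube I) g" "\<And>x. x \<in> cube_boundary I \<Longrightarrow> g x = f x"
    using cconnE[OF conn I] by metis
  have "finite_map K (cube I) g" by (rule finite_map_mono[OF g(1)]) (use K(2) in \<open>auto simp: induced_def\<close>)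
  then show "\<exists>g. finite_map K (cube I) g \<and> (\<forall>x\<in>cube_boundary I. g x = f x)" using g(2) by blast
qed

section \<open>The weak topology\<close>

lemma openin_realization:
  "openin (realization K) U \<longleftrightarrow> U \<subseteq> realization_set K \<and>
      (\<forall>\<sigma>\<in>K. openin (top_of_set (closed_simplex \<sigma>)) (U \<inter> closed_simplex \<sigma>))"
  unfolding realization_def topology_inverse'[OF istopology_realization] unfolding euclidean_product_topology by simp

lemma topspace_realization: "topspace (realization K) = realization_set K"
proof -
  have "openin (realization K) (realization_set K)"
    unfolding openin_realization
  proof (intro conjI ballI)
    fix \<sigma> assume "\<sigma> \<in> K"
    then have "realization_set K \<inter> closed_simplex \<sigma> = closed_simplex \<sigma>" by (auto simp: realization_set_def)
    then show "openin (top_of_set (closed_simplex \<sigma>)) (realization_set K \<inter> closed_simplex \<sigma>)" by simp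
  qed simp
  then show ?thesis
    by (metis openin_realization openin_subset openin_topspace subset_antisym)
qed

lemma closed_closed_simplex: "closed (closed_simplex \<sigma>)"
proof -
  have "closed_simplex \<sigma> = (\<Inter>v. {\<alpha>. 0 \<le> \<alpha> v}) \<inter> (\<Inter>v\<in>-\<sigma>. {\<alpha>. \<alpha> v = 0}) \<inter> {\<alpha>. sum \<alpha> \<sigma> = 1}"
    by (auto simp: closed_simplex_def)
  then show ?thesis
    by (auto intro!: closed_Int closed_INT closed_Collect_le closed_Collect_eq continuous_intros continuous_on_apply
        simp del: INT_simps)
qed

lemma closedin_realization:
  "closedin (realization K) C \<longleftrightarrow> C \<subseteq> realization_set K \<and> (\<forall>\<sigma>\<in>K. closed (C \<inter> closed_simplex \<sigma>))"
proof -
  have "openin (top_of_set (closed_simplex \<sigma>)) ((realization_set K - C) \<inter> closed_simplex \<sigma>) \<longleftrightarrow> closed (C \<inter> closed_simplex \<sigma>)"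
    if "\<sigma> \<in> K" for \<sigma>
  proof -
    have "(realization_set K - C) \<inter> closed_simplex \<sigma> = closed_simplex \<sigma> - C \<inter> closed_simplex \<sigma>"
      using that by (auto simp: realization_set_def)
    moreover have "closedin (top_of_set (closed_simplex \<sigma>)) (C \<inter> closed_simplex \<sigma>) \<longleftrightarrow> closed (C \<inter> closed_simplex \<sigma>)"
      using closedin_closed_eq[OF closed_closed_simplex, of \<sigma>] by auto
    ultimately show ?thesis by (simp add: closedin_def)
  qed
  then show ?thesis
    unfolding closedin_def topspace_realization openin_realization by auto
qed

text \<open>The preimage of a weakly closed set is a union over the finitely many simplices on
  \<open>W\<close>, and each piece is closed by coordinatewise continuity.\<close>

lemma continuous_map_realization:
  assumes K: "abstract_complex K" and h: "finite_map K S h"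
  shows "continuous_map (top_of_set S) (realization K) h"
proof -
  obtain W where W: "finite W" "continuous_on S h" "h ` S \<subseteq> realization_set (induced K W)"
    using h unfolding finite_map_def by blast
  have fin: "finite (induced K W)"
    by (rule finite_subset[of _ "Pow W"]) (use W(1) in \<open>auto simp: induced_def\<close>)
  show ?thesis
    unfolding continuous_map_closedin
  proof (intro conjI allI impI)
    have "realization_set (induced K W) \<subseteq> realization_set K"
      by (rule realization_set_mono) (auto simp: induced_def)
    then show "h \<in> topspace (top_of_set S) \<rightarrow> topspace (realization K)"
      using W(3) by (auto simp: topspace_realization)
    fix C assume C: "closedin (realization K) C"
    have "{x \<in> topspace (top_of_set S). h x \<in> C} = (\<Union>\<sigma>\<in>induced K W. S \<inter> h -` (C \<inter> closed_simplex \<sigma>))"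
      using W(3) unfolding realization_set_def by fastforce
    moreover have "closedin (top_of_set S) (\<Union>\<sigma>\<in>induced K W. S \<inter> h -` (C \<inter> closed_simplex \<sigma>))"
    proof (rule closedin_Union)
      show "finite ((\<lambda>\<sigma>. S \<inter> h -` (C \<inter> closed_simplex \<sigma>)) ` induced K W)" using fin by simp
      fix T assume "T \<in> (\<lambda>\<sigma>. S \<inter> h -` (C \<inter> closed_simplex \<sigma>)) ` induced K W"
      then obtain \<sigma> where s: "\<sigma> \<in> induced K W" "T = S \<inter> h -` (C \<inter> closed_simplex \<sigma>)" by auto
      then have "closed (C \<inter> closed_simplex \<sigma>)" using C by (auto simp: closedin_realization induced_def)
      then show "closedin (top_of_set S) T" unfolding s(2) by (rule continuous_closedin_preimage[OF W(2)])
    qed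
    ultimately show "closedin (top_of_set S) {x \<in> topspace (top_of_set S). h x \<in> C}" by simp
  qed
qed

lemma closed_point: "closed {\<alpha> :: 'v \<Rightarrow> real}"
proof -
  have "{\<alpha>} = (\<Inter>v. {\<beta>. \<beta> v = \<alpha> v})" by auto
  then show ?thesis
    by (simp only:) (intro closed_INT ballI closed_Collect_eq continuous_on_apply continuous_on_const)
qed

text \<open>One point is picked for each support occurring in \<open>C\<close>. A closed simplex
  contains only finitely many of the picked points, so every set of them is closed in the weak
  topology; a closed discrete subset of a compact set is finite.\<close>

lemma compact_finite_supports:
  assumes K: "abstract_complex K" and C: "compactin (realization K) C"
  shows "finite (support ` C)"
proof -
  have CK: "C \<subseteq> realization_set K" using C compactin_subset_topspace topspace_realization by metis
  define T where "T = inv_into C support ` (support ` C)"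
  have TC: "T \<subseteq> C" unfolding T_def by (auto simp: inv_into_into)
  have sT: "support ` T = support ` C"
    unfolding T_def image_image[of support] by (simp add: f_inv_into_f cong: image_cong)
  have inj: "inj_on support T" unfolding T_def by (rule inj_onI) (auto simp: f_inv_into_f)
  have cl: "closedin (realization K) T'" if "T' \<subseteq> T" for T'
    unfolding closedin_realization
  proof (intro conjI ballI)
    show "T' \<subseteq> realization_set K" using that TC CK by blast
    fix \<sigma> assume s: "\<sigma> \<in> K"
    have fs: "finite \<sigma>" using abstract_complexD(1)[OF K s] .
    have "support ` (T' \<inter> closed_simplex \<sigma>) \<subseteq> Pow \<sigma>" using closed_simplex_support(2)[OF fs] by auto
    then have "finite (support ` (T' \<inter> closed_simplex \<sigma>))" using fs by (meson finite_Pow_iff finite_subset)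
    moreover have "inj_on support (T' \<inter> closed_simplex \<sigma>)" using inj that by (auto intro: inj_on_subset)
    ultimately have "finite (T' \<inter> closed_simplex \<sigma>)" by (rule finite_imageD)
    then have "closed (\<Union>x\<in>T' \<inter> closed_simplex \<sigma>. {x})" by (intro closed_UN ballI closed_point)
    then show "closed (T' \<inter> closed_simplex \<sigma>)" by simp
  qed
  define \<U> where "\<U> = (\<lambda>x. realization_set K - (T - {x})) ` C"
  have "\<exists>\<F>. finite \<F> \<and> \<F> \<subseteq> \<U> \<and> C \<subseteq> \<Union>\<F>"
  proof (rule compactinD[OF C])
    show "openin (realization K) U" if "U \<in> \<U>" for U
    proof -
      obtain x where "U = realization_set K - (T - {x})" using \<open>U \<in> \<U>\<close> by (auto simp: \<U>_def)
      then show ?thesis using cl[of "T - {x}"] by (auto simp: closedin_def topspace_realization)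
    qed
    show "C \<subseteq> \<Union>\<U>" using CK by (auto simp: \<U>_def)
  qed
  then obtain \<F> where F: "finite \<F>" "\<F> \<subseteq> \<U>" "C \<subseteq> \<Union>\<F>" by blast
  have "finite (U \<inter> T)" if U: "U \<in> \<F>" for U
  proof -
    obtain x where "U = realization_set K - (T - {x})" using U F(2) by (auto simp: \<U>_def)
    then have "U \<inter> T \<subseteq> {x}" by auto
    then show ?thesis using finite_subset by blast
  qed
  then have "finite (\<Union>U\<in>\<F>. U \<inter> T)" using F(1) by blast
  moreover have "T \<subseteq> (\<Union>U\<in>\<F>. U \<inter> T)" using F(3) TC by blast
  ultimately have "finite T" by (rule rev_finite_subset)
  then show ?thesis using sT by (metis finite_imageI)
qed

text \<open>Every set open in the product topology has a weakly open trace, so a weakly continuous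
  map has continuous coordinates; compactness bounds the supports.\<close>

lemma finite_map_from_compact:
  assumes K: "abstract_complex K" and S: "compact S" and f: "continuous_map (top_of_set S) (realization K) f"
  shows "finite_map K S f"
proof -
  have fK: "f x \<in> realization_set K" if "x \<in> S" for x
    using f that by (auto simp: continuous_map_def topspace_realization)
  have "compactin (realization K) (f ` S)"
    by (rule image_compactin[OF _ f]) (simp add: compactin_subtopology S)
  then have "finite (support ` f ` S)" by (rule compact_finite_supports[OF K])
  moreover have "finite (support (f x))" if "x \<in> S" for x
    using fK[OF that] abstract_complexD(1)[OF K] by (auto simp: realization_set_iff[OF K])
  ultimately have fin: "finite (\<Union>(support ` f ` S))" by (intro finite_Union) auto
  have "continuous_map (top_of_set S) euclidean f"
    unfolding continuous_map
  proof (intro conjI allI impI)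
    fix U :: "('a \<Rightarrow> real) set" assume "openin euclidean U"
    then have "openin (realization K) (U \<inter> realization_set K)"
      unfolding openin_realization
    proof (intro conjI ballI)
      fix \<sigma> assume "openin euclidean U" "\<sigma> \<in> K"
      then have "U \<inter> realization_set K \<inter> closed_simplex \<sigma> = closed_simplex \<sigma> \<inter> U" "open U"
        by (auto simp: realization_set_def)
      then show "openin (top_of_set (closed_simplex \<sigma>)) (U \<inter> realization_set K \<inter> closed_simplex \<sigma>)"
        by (simp add: openin_open_Int)
    qed auto
    then have "openin (top_of_set S) {x \<in> S. f x \<in> U \<inter> realization_set K}"
      using f unfolding continuous_map topspace_euclidean_subtopology by blast
    moreover have "{x \<in> S. f x \<in> U \<inter> realization_set K} = {x \<in> S. f x \<in> U}" using fK by auto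
    ultimately show "openin (top_of_set S) {x \<in> topspace (top_of_set S). f x \<in> U}" by simp
  qed auto
  then have "continuous_on S f" by simp
  then show ?thesis by (rule finite_mapI[OF K _ fin]) (use fK in auto)
qed

text \<open>The radial maps \<open>\<nu>\<close> and \<open>\<mu>\<close> identify the round sphere
  with the boundary of a cube. A filling of the cube, read along rays towards the centre, is the
  null-homotopy \<open>H\<close>.\<close>

lemma cconn_imp_cx_connected:
  assumes K: "abstract_complex K" and c: "cconn d K"
  shows "cx_connected d K"
  unfolding cx_connected_def d_connected_space_def
proof (intro conjI impI allI)
  assume "-1 \<le> d"
  \<comment> \<open>The cube on no coordinates is a point with empty boundary, so filling it
    produces a point of the realization.\<close>
  moreover have "finite_map K (cube_boundary {}) f" for f
    by (auto simp: finite_map_def cube_boundary_def intro!: exI[of _ "{}"])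
  ultimately obtain g where "finite_map K (cube {}) g"
    using c[unfolded cconn_def, rule_format, of "{}" undefined] by auto
  then have "g (\<lambda>_. 0) \<in> realization_set K"
    by (rule finite_mapE[OF _ K]) (auto simp: cube_def)
  then show "topspace (realization K) \<noteq> {}" by (auto simp: topspace_realization)
next
  fix m :: nat and f assume m: "int m \<le> d" and f: "continuous_map (nsphere m) (realization K) f"
  define S where "S = {x :: nat \<Rightarrow> real. (\<Sum>i\<le>m. x i ^ 2) = 1 \<and> (\<forall>i>m. x i = 0)}"
  have nS: "nsphere m = top_of_set S" unfolding nsphere S_def euclidean_product_topology ..
  have clS: "closed S"
  proof -
    have "S = {x. (\<Sum>i\<le>m. x i ^ 2) = 1} \<inter> (\<Inter>i\<in>{m<..}. {x. x i = 0})" by (auto simp: S_def)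
    then show ?thesis
      by (auto intro!: closed_Int closed_INT closed_Collect_eq continuous_intros continuous_on_apply simp del: INT_simps)
  qed
  have sq: "(x i)\<^sup>2 \<le> 1" if "x \<in> S" "i \<le> m" for x i
    using that member_le_sum[of i "{..m}" "\<lambda>i. (x i)\<^sup>2"] by (auto simp: S_def)
  have Sc: "S \<subseteq> cube {..m}"
    using sq by (force simp: cube_def S_def abs_square_le_1)
  have cS: "compact S" using clS compact_cube Sc by (metis compact_Int_closed inf.absorb_iff2)
  obtain W where W: "finite W" "continuous_on S f" "\<And>x. x \<in> S \<Longrightarrow> f x \<in> realization_set K"
    "\<And>x. x \<in> S \<Longrightarrow> support (f x) \<subseteq> W"
    using finite_mapE[OF finite_map_from_compact[OF K cS f[unfolded nS]] K] by metis
  let ?I = "{..m}"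
  define n where "n x = sqrt (\<Sum>i\<le>m. (x i)\<^sup>2)" for x :: "nat \<Rightarrow> real"
  define \<nu> where "\<nu> x = (\<lambda>i. x i / n x)" for x
  have npos: "n x > 0" if b: "x \<in> cube_boundary ?I" for x
  proof -
    obtain i where i: "i \<le> m" "\<bar>x i\<bar> = 1" using b by (auto simp: cube_boundary_def)
    then have "(x i)\<^sup>2 = 1" by (metis power2_abs power_one)
    then have "0 < (\<Sum>i\<le>m. (x i)\<^sup>2)" using i(1) by (intro sum_pos2[of _ i]) auto
    then show ?thesis by (simp add: n_def)
  qed
  have \<nu>S: "\<nu> x \<in> S" if "x \<in> cube_boundary ?I" for x
  proof -
    have "(\<Sum>i\<le>m. (\<nu> x i)\<^sup>2) = (\<Sum>i\<le>m. (x i)\<^sup>2) / (n x)\<^sup>2" by (simp add: \<nu>_def power_divide sum_divide_distrib)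
    also have "\<dots> = 1" using npos[OF that] by (simp add: n_def sum_nonneg)
    finally show ?thesis using that by (auto simp: S_def \<nu>_def cube_boundary_def cube_def)
  qed
  have \<nu>c: "continuous_on (cube_boundary ?I) \<nu>"
    unfolding \<nu>_def n_def
    by (intro continuous_on_coordinatewise_then_product continuous_intros continuous_on_apply)
      (use npos in \<open>force simp: n_def\<close>)
  have "finite_map K (cube_boundary ?I) (\<lambda>x. f (\<nu> x))"
    by (rule finite_mapI[OF K continuous_on_compose2[OF W(2) \<nu>c] W(1)]) (use \<nu>S W in auto)
  then obtain g where g: "finite_map K (cube ?I) g" "\<And>x. x \<in> cube_boundary ?I \<Longrightarrow> g x = f (\<nu> x)"
    using cconnE[OF c, of ?I] m by auto
  obtain W' where W': "finite W'" "continuous_on (cube ?I) g" "\<And>x. x \<in> cube ?I \<Longrightarrow> g x \<in> realization_set K"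
    "\<And>x. x \<in> cube ?I \<Longrightarrow> support (g x) \<subseteq> W'"
    using finite_mapE[OF g(1) K] by metis
  define \<mu> where "\<mu> x = (\<lambda>i. (1 / max_norm ?I x) * x i)" for x
  have mpos: "max_norm ?I x > 0" if "x \<in> S" for x
  proof -
    have "\<exists>i\<le>m. x i \<noteq> 0"
    proof (rule ccontr)
      assume "\<not> (\<exists>i\<le>m. x i \<noteq> 0)"
      then have "(\<Sum>i\<le>m. (x i)\<^sup>2) = 0" by simp
      then show False using that by (simp add: S_def)
    qed
    then show ?thesis using max_norm_ge[of ?I _ x] by fastforce
  qed
  have \<mu>b: "\<mu> x \<in> cube_boundary ?I" if "x \<in> S" for x
    using that mpos[OF that] max_norm_scale[of ?I "1 / max_norm ?I x" x]
    by (auto simp: cube_boundary_iff_max_norm \<mu>_def S_def)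
  have \<nu>\<mu>: "\<nu> (\<mu> x) = x" if x: "x \<in> S" for x
  proof -
    have "(\<Sum>i\<le>m. (\<mu> x i)\<^sup>2) = (\<Sum>i\<le>m. (x i)\<^sup>2) / (max_norm ?I x)\<^sup>2"
      by (simp add: \<mu>_def power_divide sum_divide_distrib)
    then have "n (\<mu> x) = 1 / max_norm ?I x"
      using x mpos[OF x] by (simp add: n_def S_def real_sqrt_divide)
    then show ?thesis using mpos[OF x] by (auto simp: \<nu>_def \<mu>_def)
  qed
  define H where "H = (\<lambda>(t, x). g (\<lambda>i. (1 - t) * \<mu> x i))"
  have sc: "(\<lambda>i. (1 - t) * \<mu> x i) \<in> cube ?I" if "t \<in> {0..1}" "x \<in> S" for t x
  proof -
    have mx: "max_norm ?I (\<mu> x) = 1" "\<forall>i. i \<notin> ?I \<longrightarrow> \<mu> x i = 0"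
      using \<mu>b[OF that(2)] unfolding cube_boundary_iff_max_norm[of ?I, simplified] by auto
    have "max_norm ?I (\<lambda>i. (1 - t) * \<mu> x i) \<le> 1"
      using max_norm_scale[of ?I "1 - t" "\<mu> x"] that(1) mx(1) by auto
    then show ?thesis using mx(2) by (subst cube_iff_max_norm) auto
  qed
  have \<mu>c: "continuous_on S \<mu>" unfolding \<mu>_def
    by (intro continuous_on_coordinatewise_then_product continuous_intros continuous_on_apply continuous_on_max_norm)
      (use mpos in force)+
  have "continuous_on ({0..1} \<times> S) H"
    unfolding H_def case_prod_beta
  proof (rule continuous_on_compose2[OF W'(2)])
    have \<mu>s: "continuous_on ({0..1} \<times> S) (\<lambda>z. \<mu> (snd z))"
      by (rule continuous_on_compose2[OF \<mu>c]) (auto intro: continuous_intros)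
    show "continuous_on ({0..1} \<times> S) (\<lambda>z i. (1 - fst z) * \<mu> (snd z) i)"
      by (intro continuous_on_coordinatewise_then_product continuous_on_mult continuous_on_diff continuous_on_const
          continuous_on_fst continuous_on_id continuous_on_product_then_coordinatewise[OF \<mu>s])
  qed (use sc in auto)
  then have "finite_map K ({0..1} \<times> S) H"
    by (rule finite_mapI[OF K _ W'(1)]) (use W'(3,4)[OF sc] in \<open>fastforce simp: H_def\<close>)+
  then have cH: "continuous_map (prod_topology (top_of_set {0..1}) (nsphere m)) (realization K) H"
    using continuous_map_realization[OF K] by (simp add: nS prod_topology_subtopology_eu)
  have z: "(\<lambda>_. 0) \<in> cube ?I" by (auto simp: cube_def)
  have "homotopic_with (\<lambda>_. True) (nsphere m) (realization K) f (\<lambda>_. g (\<lambda>_. 0))"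
  proof (subst homotopic_with, simp, intro exI[of _ H] conjI)
    show "continuous_map (prod_topology (top_of_set {0..1}) (nsphere m)) (realization K) H" by (rule cH)
    show "\<forall>x\<in>topspace (nsphere m). H (0, x) = f x" using g(2) \<mu>b \<nu>\<mu> by (auto simp: H_def nS)
    show "\<forall>x\<in>topspace (nsphere m). H (1, x) = g (\<lambda>_. 0)" by (auto simp: H_def)
  qed simp
  then show "\<exists>c\<in>topspace (realization K). homotopic_with (\<lambda>_. True) (nsphere m) (realization K) f (\<lambda>_. c)"
    using W'(3)[OF z] by (auto simp: topspace_realization)
qed

section \<open>Stable range\<close>

text \<open>The last two elements are merged into the combination \<open>q\<close> in which they
  enter the unit relation, and the hypothesis is applied with \<open>q\<close> in the last place. A
  multiple of \<open>q\<close> splits into a multiple of \<open>r k\<close>, which may be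
  subtracted, and a multiple of \<open>r m\<close>. The latter is absorbed, since \<open>r m\<close>
  is kept as a generator by \<open>t' m = 0\<close>.\<close>

lemma SR_Suc:
  assumes "SR TYPE('a::comm_ring_1) k" "k \<ge> 1"
  shows "SR TYPE('a) (Suc k)"
proof -
  obtain m where k: "k = Suc m" using assms(2) by (cases k) auto
  show ?thesis unfolding SR_def
  proof (intro allI impI)
    fix r :: "nat \<Rightarrow> 'a" assume "gen_unit_ideal (Suc k) r"
    then obtain a where a: "(\<Sum>i<m. a i * r i) + a m * r m + a (Suc m) * r (Suc m) = 1"
      by (auto simp: gen_unit_ideal_def k)
    define q where "q = a m * r m + a (Suc m) * r (Suc m)"
    define r' where "r' i = (if i < m then r i else q)" for i
    have "gen_unit_ideal k r'"
      unfolding gen_unit_ideal_def k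
      by (intro exI[of _ "\<lambda>i. if i < m then a i else 1"]) (use a in \<open>simp add: r'_def q_def add.assoc\<close>)
    then obtain t where "gen_unit_ideal (k - 1) (\<lambda>i. r' i - t i * r' (k - 1))"
      using assms(1) unfolding SR_def by blast
    then obtain c where c: "(\<Sum>i<m. c i * (r i - t i * q)) = 1"
      by (auto simp: gen_unit_ideal_def k r'_def)
    define t' where "t' i = (if i < m then t i * a (Suc m) else 0)" for i
    have "(\<Sum>i<m. c i * (r i - t i * a (Suc m) * r (Suc m))) + (- (\<Sum>i<m. c i * t i * a m)) * r m
        = (\<Sum>i<m. c i * (r i - t i * a (Suc m) * r (Suc m)) - c i * t i * a m * r m)"
      by (simp add: sum_subtractf sum_distrib_right)
    also have "\<dots> = (\<Sum>i<m. c i * (r i - t i * q))"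
      by (intro sum.cong) (auto simp: q_def algebra_simps)
    finally have "(\<Sum>i<m. c i * (r i - t i * a (Suc m) * r (Suc m))) + (- (\<Sum>i<m. c i * t i * a m)) * r m = 1"
      using c by simp
    then have "gen_unit_ideal k (\<lambda>i. r i - t' i * r k)"
      unfolding gen_unit_ideal_def k
      by (intro exI[of _ "\<lambda>i. if i < m then c i else - (\<Sum>i<m. c i * t i * a m)"]) (simp add: t'_def)
    then show "\<exists>t. gen_unit_ideal (Suc k - 1) (\<lambda>i. r i - t i * r (Suc k - 1))" by auto
  qed
qed

lemma SR_mono:
  assumes "SR TYPE('a::comm_ring_1) k" "k \<ge> 1" "k \<le> m" shows "SR TYPE('a) m"
  using assms(3,1,2) by (induction m rule: dec_induct) (auto intro: SR_Suc)

section \<open>Unimodular sets\<close>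

text \<open>Submodules are carrier sets \<open>M\<close> in one ambient module, so that kernels and
  projections never change the type of the vertices; \<open>subspace\<close> and \<open>span\<close>
  are the module notions over the ring. Functionals are total functions constrained on
  \<open>M\<close> only, hence they restrict to submodules unchanged.\<close>

locale unimodular = module scale
  for scale :: "'a::comm_ring_1 \<Rightarrow> 'b::ab_group_add \<Rightarrow> 'b" (infixr \<open>\<odot>\<close> 75)
begin

definition linear_on :: "'b set \<Rightarrow> ('b \<Rightarrow> 'a) \<Rightarrow> bool" where
  "linear_on M c \<longleftrightarrow> (\<forall>x\<in>M. \<forall>y\<in>M. c (x + y) = c x + c y) \<and> (\<forall>r. \<forall>x\<in>M. c (r \<odot> x) = r * c x)"

definition dual_family :: "'b set \<Rightarrow> 'b set \<Rightarrow> ('b \<Rightarrow> 'b \<Rightarrow> 'a) \<Rightarrow> bool" where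
  "dual_family M B \<xi> \<longleftrightarrow> finite B \<and> B \<subseteq> M \<and> (\<forall>b\<in>B. linear_on M (\<xi> b))
     \<and> (\<forall>b\<in>B. \<forall>b'\<in>B. \<xi> b b' = (if b' = b then 1 else 0))"

definition unimod :: "'b set \<Rightarrow> 'b set \<Rightarrow> bool" where
  "unimod M B \<longleftrightarrow> (\<exists>\<xi>. dual_family M B \<xi>)"

definition ker_on :: "'b set \<Rightarrow> ('b \<Rightarrow> 'a) \<Rightarrow> 'b set" where
  "ker_on M c = {y \<in> M. c y = 0}"

text \<open>A basis kept together with its coordinate functionals, so that kernels and sheared
  complements can be given frames by explicit formulas.\<close>

definition frame :: "nat \<Rightarrow> 'b set \<Rightarrow> (nat \<Rightarrow> 'b) \<Rightarrow> (nat \<Rightarrow> 'b \<Rightarrow> 'a) \<Rightarrow> bool" where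
  "frame n M b x \<longleftrightarrow> subspace M \<and> (\<forall>i<n. b i \<in> M \<and> linear_on M (x i))
     \<and> (\<forall>i<n. \<forall>j<n. x i (b j) = (if j = i then 1 else 0)) \<and> (\<forall>y\<in>M. y = (\<Sum>i<n. x i y \<odot> b i))"

definition free :: "nat \<Rightarrow> 'b set \<Rightarrow> bool" where
  "free n M \<longleftrightarrow> (\<exists>b x. frame n M b x)"

lemma linear_on_add: "linear_on M c \<Longrightarrow> x \<in> M \<Longrightarrow> y \<in> M \<Longrightarrow> c (x + y) = c x + c y"
  and linear_on_scale: "linear_on M c \<Longrightarrow> x \<in> M \<Longrightarrow> c (r \<odot> x) = r * c x"
  by (auto simp: linear_on_def)

lemma linear_on_subset: "linear_on M c \<Longrightarrow> N \<subseteq> M \<Longrightarrow> linear_on N c"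
  by (simp add: linear_on_def subset_iff)

lemma linear_on_0: "linear_on M c \<Longrightarrow> subspace M \<Longrightarrow> c 0 = 0"
  using linear_on_scale[of M c 0 0] subspace_0 by auto

lemma linear_on_diff: "linear_on M c \<Longrightarrow> subspace M \<Longrightarrow> x \<in> M \<Longrightarrow> y \<in> M \<Longrightarrow> c (x - y) = c x - c y"
  using linear_on_add[of M c x "(-1) \<odot> y"] linear_on_scale[of M c y "-1"] subspace_scale[of M y "-1"]
  by (simp add: scale_minus_left)

lemma linear_on_sum:
  assumes "linear_on M c" "subspace M" "\<And>i. i \<in> A \<Longrightarrow> f i \<in> M"
  shows "c (sum f A) = (\<Sum>i\<in>A. c (f i))"
  using assms(3)
proof (induction A rule: infinite_finite_induct)
  case (insert i A)
  have "sum f A \<in> M" by (rule subspace_sum[OF assms(2)]) (use insert.prems in auto)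
  then show ?case using insert by (simp add: linear_on_add[OF assms(1)])
qed (use linear_on_0[OF assms(1,2)] in auto)

lemma linear_on_lincomb:
  assumes "linear_on M c" "subspace M" "\<And>i. i \<in> A \<Longrightarrow> b i \<in> M"
  shows "c (\<Sum>i\<in>A. r i \<odot> b i) = (\<Sum>i\<in>A. r i * c (b i))"
  using linear_on_sum[OF assms(1,2), of A "\<lambda>i. r i \<odot> b i"] assms
  by (simp add: linear_on_scale subspace_scale)

lemma subspace_ker_on: "subspace M \<Longrightarrow> linear_on M c \<Longrightarrow> subspace (ker_on M c)"
  by (simp add: subspace_def ker_on_def linear_on_add linear_on_scale linear_on_0[unfolded subspace_def])

lemma unimod_subset:
  assumes "unimod M B" "A \<subseteq> B" shows "unimod M A"
proof -
  obtain \<xi> where "dual_family M B \<xi>" using assms(1) by (auto simp: unimod_def)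
  then have "dual_family M A \<xi>"
    using assms(2) finite_subset unfolding dual_family_def by (simp add: subset_iff) blast
  then show ?thesis by (auto simp: unimod_def)
qed

lemma unimod_finite: "unimod M B \<Longrightarrow> finite B" and unimod_carrier: "unimod M B \<Longrightarrow> B \<subseteq> M"
  by (auto simp: unimod_def dual_family_def)

lemma unimod_empty: "unimod M {}"
  by (simp add: unimod_def dual_family_def)

lemma unimod_singleton: "unimod M {a} \<longleftrightarrow> a \<in> M \<and> (\<exists>\<xi>. linear_on M \<xi> \<and> \<xi> a = 1)"
proof
  assume "a \<in> M \<and> (\<exists>\<xi>. linear_on M \<xi> \<and> \<xi> a = 1)"
  then obtain \<xi> where "a \<in> M" "linear_on M \<xi>" "\<xi> a = 1" by blast
  then show "unimod M {a}" unfolding unimod_def dual_family_def by (intro exI[of _ "\<lambda>_. \<xi>"]) auto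
qed (auto simp: unimod_def dual_family_def)

lemma frame_expand: "frame n M b x \<Longrightarrow> y \<in> M \<Longrightarrow> (\<Sum>i<n. x i y \<odot> b i) = y"
  by (simp add: frame_def)

lemma unimod_singleton_frame:
  assumes f: "frame n M b x" and a: "a \<in> M"
  shows "unimod M {a} \<longleftrightarrow> gen_unit_ideal n (\<lambda>i. x i a)"
proof
  have M: "subspace M" "\<And>i. i < n \<Longrightarrow> b i \<in> M" "\<And>i. i < n \<Longrightarrow> linear_on M (x i)" using f by (auto simp: frame_def)
  assume "unimod M {a}"
  then obtain \<xi> where x: "linear_on M \<xi>" "\<xi> a = 1" by (auto simp: unimod_singleton)
  have "\<xi> (\<Sum>i<n. x i a \<odot> b i) = (\<Sum>i<n. x i a * \<xi> (b i))"
    by (rule linear_on_lincomb[OF x(1) M(1)]) (use M(2) in auto)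
  then have "(\<Sum>i<n. \<xi> (b i) * x i a) = 1" using frame_expand[OF f a] x(2) by (simp add: mult.commute)
  then show "gen_unit_ideal n (\<lambda>i. x i a)" by (auto simp: gen_unit_ideal_def)
next
  have M: "\<And>i. i < n \<Longrightarrow> linear_on M (x i)" using f by (auto simp: frame_def)
  assume "gen_unit_ideal n (\<lambda>i. x i a)"
  then obtain c where c: "(\<Sum>i<n. c i * x i a) = 1" by (auto simp: gen_unit_ideal_def)
  have "linear_on M (\<lambda>y. \<Sum>i<n. c i * x i y)"
    using M by (simp add: linear_on_def sum.distrib[symmetric] sum_distrib_left algebra_simps)
  then show "unimod M {a}" using a c unfolding unimod_singleton by (intro conjI exI[of _ "\<lambda>y. \<Sum>i<n. c i * x i y"]) auto
qed

section \<open>Single vectors under the stable range condition\<close>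

text \<open>The coordinates of \<open>v\<close> together with \<open>l\<close> generate the unit
  ideal, with the values of \<open>\<xi>\<close> on the basis and \<open>r\<close> as coefficients.
  The stable range condition with \<open>l\<close> in the last place gives the coordinates of
  \<open>t\<close> up to sign.\<close>

lemma stable_range_vector:
  assumes sr: "SR TYPE('a) (Suc n)" and N: "free n N" and v: "v \<in> N"
    and \<xi>: "linear_on N \<xi>" "\<xi> v + r * l = 1"
  obtains t where "t \<in> N" "unimod N {v + l \<odot> t}"
proof -
  obtain b x where f: "frame n N b x" using N by (auto simp: free_def)
  have M: "subspace N" "\<And>i. i < n \<Longrightarrow> b i \<in> N" "\<And>i. i < n \<Longrightarrow> linear_on N (x i)"
    "\<And>i j. i < n \<Longrightarrow> j < n \<Longrightarrow> x i (b j) = (if j = i then 1 else 0)"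
    using f by (auto simp: frame_def)
  have "\<xi> (\<Sum>i<n. x i v \<odot> b i) = (\<Sum>i<n. x i v * \<xi> (b i))"
    by (rule linear_on_lincomb[OF \<xi>(1) M(1)]) (use M(2) in auto)
  then have "(\<Sum>i<n. \<xi> (b i) * x i v) + r * l = 1" using frame_expand[OF f v] \<xi>(2) by (simp add: mult.commute)
  then have "gen_unit_ideal (Suc n) (\<lambda>i. if i < n then x i v else l)"
    unfolding gen_unit_ideal_def by (intro exI[of _ "\<lambda>i. if i < n then \<xi> (b i) else r"]) simp
  then obtain s where s: "gen_unit_ideal n (\<lambda>i. (if i < n then x i v else l) - s i * l)"
    using sr unfolding SR_def by fastforce
  define t where "t = (\<Sum>i<n. (- s i) \<odot> b i)"
  have t: "t \<in> N" unfolding t_def by (intro subspace_sum[OF M(1)] subspace_scale[OF M(1)] M(2)) auto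
  have xt: "x i t = - s i" if "i < n" for i
  proof -
    have "x i t = (\<Sum>j<n. (- s j) * x i (b j))"
      unfolding t_def by (rule linear_on_lincomb[OF M(3)[OF that] M(1)]) (use M(2) in auto)
    also have "\<dots> = (\<Sum>j<n. if j = i then - s i else 0)" by (intro sum.cong) (use M(4) that in auto)
    finally show ?thesis using that by simp
  qed
  have vt: "v + l \<odot> t \<in> N" using v t M(1) subspace_add subspace_scale by blast
  have "x i (v + l \<odot> t) = x i v - s i * l" if "i < n" for i
    using linear_on_add[OF M(3)[OF that] v subspace_scale[OF M(1) t]] linear_on_scale[OF M(3)[OF that] t] xt[OF that]
    by (simp add: mult.commute)
  then have "gen_unit_ideal n (\<lambda>i. x i (v + l \<odot> t))" using s unfolding gen_unit_ideal_def by auto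
  then show ?thesis using that t unimod_singleton_frame[OF f vt] by blast
qed

lemma frame_ker:
  assumes "frame (Suc n) M b x"
  shows "frame n (ker_on M (x n)) b x" "linear_on M (x n)" "b n \<in> M" "x n (b n) = 1"
proof -
  have M: "subspace M" "\<And>i. i \<le> n \<Longrightarrow> b i \<in> M" "\<And>i. i \<le> n \<Longrightarrow> linear_on M (x i)"
    "\<And>i j. i \<le> n \<Longrightarrow> j \<le> n \<Longrightarrow> x i (b j) = (if j = i then 1 else 0)"
    using assms by (auto simp: frame_def less_Suc_eq_le)
  show "linear_on M (x n)" "b n \<in> M" "x n (b n) = 1" using M by auto
  have "y = (\<Sum>i<n. x i y \<odot> b i)" if "y \<in> ker_on M (x n)" for y
    using frame_expand[OF assms, of y] that by (auto simp: ker_on_def)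
  then show "frame n (ker_on M (x n)) b x"
    unfolding frame_def
  proof (intro conjI allI impI ballI)
    show "subspace (ker_on M (x n))" by (rule subspace_ker_on[OF M(1) M(3)]) simp
    fix i assume i: "i < n"
    show "b i \<in> ker_on M (x n)" using i M(2,4) by (simp add: ker_on_def)
    show "linear_on (ker_on M (x n)) (x i)"
      by (rule linear_on_subset[OF M(3)]) (use i in \<open>auto simp: ker_on_def\<close>)
    show "x i (b j) = (if j = i then 1 else 0)" if "j < n" for j using M(4) i that by simp
  qed
qed

lemma free_Suc_split:
  assumes "free (Suc n) M"
  obtains \<phi> e where "linear_on M \<phi>" "e \<in> M" "\<phi> e = 1" "free n (ker_on M \<phi>)"
  using assms frame_ker unfolding free_def by metis

lemma split_off:
  assumes M: "subspace M" "linear_on M \<phi>" "e \<in> M" "\<phi> e = 1" and y: "y \<in> M"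
  shows "y - \<phi> y \<odot> e \<in> ker_on M \<phi>"
  using linear_on_diff[OF M(2,1) y subspace_scale[OF M(1,3)], of "\<phi> y"] linear_on_scale[OF M(2,3)] M(4)
    subspace_diff[OF M(1) y subspace_scale[OF M(1,3)]]
  by (auto simp: ker_on_def)

lemma linear_on_comp_split:
  assumes M: "subspace M" "linear_on M \<phi>" "e \<in> M" "\<phi> e = 1" and \<xi>: "linear_on (ker_on M \<phi>) \<xi>"
  shows "linear_on M (\<lambda>y. \<xi> (y - \<phi> y \<odot> e))"
  unfolding linear_on_def
proof (intro conjI ballI allI)
  fix x y assume x: "x \<in> M" "y \<in> M"
  have "(x + y) - \<phi> (x + y) \<odot> e = (x - \<phi> x \<odot> e) + (y - \<phi> y \<odot> e)"
    using linear_on_add[OF M(2) x] by (simp add: scale_left_distrib)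
  then show "\<xi> ((x + y) - \<phi> (x + y) \<odot> e) = \<xi> (x - \<phi> x \<odot> e) + \<xi> (y - \<phi> y \<odot> e)"
    using linear_on_add[OF \<xi>] split_off[OF M] x by metis
next
  fix r x assume x: "x \<in> M"
  have "r \<odot> x - \<phi> (r \<odot> x) \<odot> e = r \<odot> (x - \<phi> x \<odot> e)"
    using linear_on_scale[OF M(2) x] by (simp add: scale_right_diff_distrib)
  then show "\<xi> (r \<odot> x - \<phi> (r \<odot> x) \<odot> e) = r * \<xi> (x - \<phi> x \<odot> e)"
    using linear_on_scale[OF \<xi>] split_off[OF M x] by metis
qed

text \<open>Replacing \<open>e\<close> by \<open>e - t\<close> with \<open>t\<close> in the kernel
  changes the kernel component of \<open>v\<close> by \<open>\<phi> v \<odot> t\<close>. That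
  component and the number \<open>\<phi> v\<close> are jointly unimodular, so the stable range
  condition can make the component unimodular by itself.\<close>

lemma shear_to_unimod:
  assumes sr: "SR TYPE('a) (Suc n)" and M: "subspace M" "linear_on M \<phi>" "e \<in> M" "\<phi> e = 1" "free n (ker_on M \<phi>)"
    and v: "unimod M {v}"
  obtains e' where "e' \<in> M" "\<phi> e' = 1" "e - e' \<in> ker_on M \<phi>" "unimod (ker_on M \<phi>) {v - \<phi> v \<odot> e'}"
proof -
  let ?N = "ker_on M \<phi>"
  obtain \<xi> where x: "v \<in> M" "linear_on M \<xi>" "\<xi> v = 1" using v by (auto simp: unimod_singleton)
  have NM: "?N \<subseteq> M" by (auto simp: ker_on_def)
  have "\<xi> (v - \<phi> v \<odot> e) + \<xi> e * \<phi> v = 1"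
    using linear_on_diff[OF x(2) M(1) x(1) subspace_scale[OF M(1,3)]] linear_on_scale[OF x(2) M(3)] x(3)
    by (simp add: mult.commute)
  then obtain t where t: "t \<in> ?N" "unimod ?N {v - \<phi> v \<odot> e + \<phi> v \<odot> t}"
    using stable_range_vector[OF sr M(5) split_off[OF M(1-4) x(1)] linear_on_subset[OF x(2) NM]] by metis
  have tM: "t \<in> M" "\<phi> t = 0" using t(1) by (auto simp: ker_on_def)
  show ?thesis
  proof
    show "e - t \<in> M" using M(1,3) tM subspace_diff by blast
    show "\<phi> (e - t) = 1" using linear_on_diff[OF M(2,1,3) tM(1)] tM(2) M(4) by simp
    show "e - (e - t) \<in> ?N" using t(1) by simp
    show "unimod ?N {v - \<phi> v \<odot> (e - t)}" using t(2) by (simp add: scale_right_diff_distrib algebra_simps)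
  qed
qed

text \<open>After a shear the component of \<open>a\<close> in the kernel of \<open>\<phi>\<close>
  is unimodular, with \<open>\<xi>\<close> equal to 1 on it. Adding a multiple of
  \<open>\<xi>\<close> to \<open>\<phi>\<close> corrects the value at \<open>a\<close> to 1 without
  changing the value 1 at \<open>e\<close>. So the kernels of \<open>c\<close> and of
  \<open>\<phi>\<close> are both complements of the line through \<open>e\<close>, and projection
  along \<open>e\<close> transports the frame of one to the other.\<close>

lemma unimod_vector_complement:
  assumes sr: "SR TYPE('a) (Suc m)" and N: "free (Suc m) N" and a: "unimod N {a}"
  obtains c where "linear_on N c" "c a = 1" "free m (ker_on N c)"
proof -
  obtain b x where f: "frame (Suc m) N b x" using N by (auto simp: free_def)
  define \<phi> where "\<phi> = x m"
  have N: "subspace N" "linear_on N \<phi>" "b m \<in> N" "\<phi> (b m) = 1" and f0: "frame m (ker_on N \<phi>) b x"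
    using frame_ker[OF f] f by (auto simp: \<phi>_def frame_def)
  let ?N = "ker_on N \<phi>"
  have NN: "?N \<subseteq> N" by (auto simp: ker_on_def)
  obtain e where e: "e \<in> N" "\<phi> e = 1" "unimod ?N {a - \<phi> a \<odot> e}"
    using shear_to_unimod[OF sr N _ a] f0 by (auto simp: free_def)
  have aN: "a \<in> N" using a by (auto simp: unimod_singleton)
  obtain \<xi> where x: "linear_on ?N \<xi>" "\<xi> (a - \<phi> a \<odot> e) = 1" using e(3) by (auto simp: unimod_singleton)
  note sp = split_off[OF N(1,2) e(1,2)]
  define l where "l = 1 - \<phi> a"
  define c where "c y = \<phi> y + l * \<xi> (y - \<phi> y \<odot> e)" for y
  have cl: "linear_on N c"
    using linear_on_comp_split[OF N(1,2) e(1,2) x(1)] N(2)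
    by (simp add: linear_on_def c_def algebra_simps)
  have ca: "c a = 1" by (simp add: c_def x(2) l_def)
  define b' where "b' i = b i - (l * \<xi> (b i)) \<odot> e" for i
  define x' where "x' i y = x i (y - \<phi> y \<odot> e)" for i y
  have b: "b i \<in> ?N" "b i \<in> N" "\<phi> (b i) = 0" if "i < m" for i using f0 that by (auto simp: frame_def ker_on_def)
  have lb: "\<phi> (b' i) = - (l * \<xi> (b i))" "b' i \<in> N" if "i < m" for i
    using linear_on_diff[OF N(2,1) b(2)[OF that] subspace_scale[OF N(1) e(1)]] linear_on_scale[OF N(2) e(1)] e(2) b[OF that]
      subspace_diff[OF N(1) b(2)[OF that] subspace_scale[OF N(1) e(1)]] by (auto simp: b'_def)
  have pb: "b' i - \<phi> (b' i) \<odot> e = b i" if "i < m" for i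
    unfolding lb(1)[OF that] by (simp add: b'_def)
  have "frame m (ker_on N c) b' x'"
    unfolding frame_def
  proof (intro conjI allI impI ballI)
    show "subspace (ker_on N c)" by (rule subspace_ker_on[OF N(1) cl])
    fix i assume i: "i < m"
    show "b' i \<in> ker_on N c" using lb[OF i] pb[OF i] by (simp add: ker_on_def c_def)
    have "linear_on ?N (x i)" using f0 i by (auto simp: frame_def)
    then show "linear_on (ker_on N c) (x' i)"
      unfolding x'_def by (intro linear_on_subset[OF linear_on_comp_split[OF N(1,2) e(1,2)]]) (auto simp: ker_on_def)
    fix j assume "j < m"
    then show "x' i (b' j) = (if j = i then 1 else 0)" unfolding x'_def using pb i f0 by (auto simp: frame_def)
  next
    fix y assume "y \<in> ker_on N c"
    then have y: "y \<in> N" "c y = 0" by (auto simp: ker_on_def)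
    let ?y = "y - \<phi> y \<odot> e"
    have ly: "\<phi> y = - (l * \<xi> ?y)" using y(2) by (simp add: c_def eq_neg_iff_add_eq_0)
    have ex: "(\<Sum>i<m. x i ?y \<odot> b i) = ?y" by (rule frame_expand[OF f0 sp[OF y(1)]])
    have "\<xi> (\<Sum>i<m. x i ?y \<odot> b i) = (\<Sum>i<m. x i ?y * \<xi> (b i))"
      by (rule linear_on_lincomb[OF x(1) subspace_ker_on[OF N(1,2)]]) (use b in auto)
    then have xy: "(\<Sum>i<m. x i ?y * \<xi> (b i)) = \<xi> ?y" using ex by simp
    have "(\<Sum>i<m. x' i y \<odot> b' i) = (\<Sum>i<m. x i ?y \<odot> b i) - (\<Sum>i<m. (x i ?y * (l * \<xi> (b i))) \<odot> e)"
      by (simp add: x'_def b'_def scale_right_diff_distrib sum_subtractf)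
    also have "(\<Sum>i<m. (x i ?y * (l * \<xi> (b i))) \<odot> e) = (l * (\<Sum>i<m. x i ?y * \<xi> (b i))) \<odot> e"
      by (simp add: scale_sum_left[symmetric] sum_distrib_left mult.left_commute)
    also have "(\<Sum>i<m. x i ?y \<odot> b i) - (l * (\<Sum>i<m. x i ?y * \<xi> (b i))) \<odot> e = y"
    proof -
      have "l * \<xi> ?y = - \<phi> y" unfolding equation_minus_iff[of "l * \<xi> ?y"] by (rule ly)
      then show ?thesis unfolding ex xy by (simp add: scale_minus_left)
    qed
    finally show "y = (\<Sum>i<m. x' i y \<odot> b' i)" by simp
  qed
  then show ?thesis using that cl ca by (auto simp: free_def)
qed

text \<open>The functional found on the kernel of \<open>\<phi>\<close> is extended by 0 on
  \<open>e'\<close>. Its kernel in \<open>M\<close> contains \<open>e'\<close> and so carries the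
  same data as \<open>M\<close>, one rank lower: the functional \<open>\<phi>\<close>, a vector of
  height 1 and a free kernel. This is what lets the slab induction continue.\<close>

lemma adapted_complement:
  assumes sr: "SR TYPE('a) (Suc m)" "SR TYPE('a) (Suc (Suc m))"
    and M: "subspace M" "linear_on M \<phi>" "e \<in> M" "\<phi> e = 1" "free (Suc m) (ker_on M \<phi>)" and v: "unimod M {v}"
  obtains c e' where "linear_on M c" "c v = 1" "e' \<in> ker_on M c" "\<phi> e' = 1" "free m (ker_on (ker_on M c) \<phi>)"
proof -
  obtain e' where e': "e' \<in> M" "\<phi> e' = 1" "unimod (ker_on M \<phi>) {v - \<phi> v \<odot> e'}"
    using shear_to_unimod[OF sr(2) M v] by metis
  obtain c where c: "linear_on (ker_on M \<phi>) c" "c (v - \<phi> v \<odot> e') = 1" "free m (ker_on (ker_on M \<phi>) c)"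
    using unimod_vector_complement[OF sr(1) M(5) e'(3)] by metis
  let ?c = "\<lambda>y. c (y - \<phi> y \<odot> e')"
  have c0: "c 0 = 0" using linear_on_0[OF c(1) subspace_ker_on[OF M(1,2)]] .
  have "ker_on (ker_on M ?c) \<phi> = ker_on (ker_on M \<phi>) c" by (auto simp: ker_on_def)
  then show ?thesis
    using that[of ?c e'] linear_on_comp_split[OF M(1,2) e'(1,2) c(1)] c c0 e' by (auto simp: ker_on_def)
qed

section \<open>Projection along a member of a unimodular set\<close>

text \<open>The functionals dual to the members other than \<open>v\<close> vanish at
  \<open>v\<close>, so they do not notice the subtraction of multiples of \<open>v\<close>. They
  stay dual to the projected vectors, which also forces injectivity.\<close>

lemma unimod_project:
  assumes M: "subspace M" "linear_on M c" "c v = 1" and r: "unimod M \<rho>" "v \<in> \<rho>"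
  shows "inj_on (\<lambda>y. y - c y \<odot> v) (\<rho> - {v})" "unimod (ker_on M c) ((\<lambda>y. y - c y \<odot> v) ` (\<rho> - {v}))"
proof -
  let ?p = "\<lambda>y. y - c y \<odot> v"
  obtain \<xi> where x: "dual_family M \<rho> \<xi>" using r(1) by (auto simp: unimod_def)
  have rM: "\<rho> \<subseteq> M" "finite \<rho>" and xl: "\<And>b. b \<in> \<rho> \<Longrightarrow> linear_on M (\<xi> b)"
    and xd: "\<And>b b'. b \<in> \<rho> \<Longrightarrow> b' \<in> \<rho> \<Longrightarrow> \<xi> b b' = (if b' = b then 1 else 0)"
    using x by (auto simp: dual_family_def)
  have vM: "v \<in> M" using r rM by auto
  have xp: "\<xi> b (?p b') = (if b' = b then 1 else 0)" if "b \<in> \<rho> - {v}" "b' \<in> \<rho> - {v}" for b b'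
  proof -
    have "\<xi> b (?p b') = \<xi> b b' - c b' * \<xi> b v"
      using that rM vM linear_on_diff[OF xl M(1), of b b' "c b' \<odot> v"] linear_on_scale[OF xl, of b v] subspace_scale[OF M(1) vM] by auto
    moreover have "\<xi> b v = 0" using xd[of b v] that r(2) by auto
    ultimately show ?thesis using xd[of b b'] that by auto
  qed
  show inj: "inj_on ?p (\<rho> - {v})"
  proof (rule inj_onI)
    fix b b' assume b: "b \<in> \<rho> - {v}" "b' \<in> \<rho> - {v}" "?p b = ?p b'"
    then have "\<xi> b (?p b') = 1" using xp[of b b] by simp
    then show "b = b'" using xp[OF b(1,2)] by (auto split: if_splits)
  qed
  define \<eta> where "\<eta> z = \<xi> (inv_into (\<rho> - {v}) ?p z)" for z
  have eta: "\<eta> (?p b) = \<xi> b" if "b \<in> \<rho> - {v}" for b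
    unfolding \<eta>_def using inv_into_f_f[OF inj that] by simp
  have "dual_family (ker_on M c) (?p ` (\<rho> - {v})) \<eta>"
    unfolding dual_family_def
  proof (intro conjI ballI)
    show "?p ` (\<rho> - {v}) \<subseteq> ker_on M c" using split_off[OF M(1,2) vM M(3)] rM by auto
    fix z assume "z \<in> ?p ` (\<rho> - {v})"
    then obtain b where b: "b \<in> \<rho> - {v}" "z = ?p b" by auto
    show "linear_on (ker_on M c) (\<eta> z)"
      unfolding b(2) eta[OF b(1)] by (rule linear_on_subset[OF xl]) (use b in \<open>auto simp: ker_on_def\<close>)
    fix z' assume "z' \<in> ?p ` (\<rho> - {v})"
    then obtain b' where b': "b' \<in> \<rho> - {v}" "z' = ?p b'" by auto
    show "\<eta> z z' = (if z' = z then 1 else 0)"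
      unfolding b(2) eta[OF b(1)] b'(2) using xp[OF b(1) b'(1)] inj_on_eq_iff[OF inj b'(1) b(1)] by simp
  qed (use rM in auto)
  then show "unimod (ker_on M c) (?p ` (\<rho> - {v}))" by (auto simp: unimod_def)
qed

text \<open>Functionals on the kernel, pulled back along the projection, are dual to the members
  other than \<open>v\<close>. The one for \<open>v\<close> is \<open>c\<close>, corrected by the
  pulled-back ones so as to vanish on those members.\<close>

lemma unimod_lift:
  assumes M: "subspace M" "linear_on M c" "c v = 1" and r: "finite \<rho>" "\<rho> \<subseteq> M" "v \<in> \<rho>"
    and inj: "inj_on (\<lambda>y. y - c y \<odot> v) (\<rho> - {v})" and u: "unimod (ker_on M c) ((\<lambda>y. y - c y \<odot> v) ` (\<rho> - {v}))"
  shows "unimod M \<rho>"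
proof -
  let ?p = "\<lambda>y. y - c y \<odot> v"
  have vM: "v \<in> M" using r by auto
  obtain \<eta> where e: "dual_family (ker_on M c) (?p ` (\<rho> - {v})) \<eta>" using u by (auto simp: unimod_def)
  have el: "linear_on M (\<lambda>y. \<eta> (?p b) (?p y))" if "b \<in> \<rho> - {v}" for b
    by (rule linear_on_comp_split[OF M(1,2) vM M(3)]) (use e that in \<open>auto simp: dual_family_def\<close>)
  have ed: "\<eta> (?p b) (?p b') = (if b' = b then 1 else 0)" if "b \<in> \<rho> - {v}" "b' \<in> \<rho> - {v}" for b b'
  proof -
    have "\<eta> (?p b) (?p b') = (if ?p b' = ?p b then 1 else 0)"
      using e that unfolding dual_family_def by blast
    then show ?thesis using inj_on_eq_iff[OF inj that(2,1)] by simp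
  qed
  have ev: "\<eta> (?p b) (?p v) = 0" if "b \<in> \<rho> - {v}" for b
  proof -
    have "linear_on (ker_on M c) (\<eta> (?p b))" using e that unfolding dual_family_def by blast
    then show ?thesis using linear_on_0[OF _ subspace_ker_on[OF M(1,2)]] M(3) by simp
  qed
  define \<xi> where "\<xi> b y = (if b = v then c y - (\<Sum>w\<in>\<rho> - {v}. c w * \<eta> (?p w) (?p y)) else \<eta> (?p b) (?p y))" for b y
  have "dual_family M \<rho> \<xi>"
    unfolding dual_family_def
  proof (intro conjI ballI)
    fix b assume b: "b \<in> \<rho>"
    show "linear_on M (\<xi> b)"
    proof (cases "b = v")
      case True
      have "linear_on M (\<lambda>y. c y - (\<Sum>w\<in>\<rho> - {v}. c w * \<eta> (?p w) (?p y)))"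
        unfolding linear_on_def
      proof (intro conjI ballI allI)
        fix x y assume "x \<in> M" "y \<in> M"
        then show "c (x + y) - (\<Sum>w\<in>\<rho> - {v}. c w * \<eta> (?p w) (?p (x + y))) =
          c x - (\<Sum>w\<in>\<rho> - {v}. c w * \<eta> (?p w) (?p x)) + (c y - (\<Sum>w\<in>\<rho> - {v}. c w * \<eta> (?p w) (?p y)))"
          using linear_on_add[OF M(2)] linear_on_add[OF el]
          by (simp add: distrib_left sum.distrib)
      next
        fix r x assume "x \<in> M"
        then show "c (r \<odot> x) - (\<Sum>w\<in>\<rho> - {v}. c w * \<eta> (?p w) (?p (r \<odot> x))) =
          r * (c x - (\<Sum>w\<in>\<rho> - {v}. c w * \<eta> (?p w) (?p x)))"
          using linear_on_scale[OF M(2)] linear_on_scale[OF el]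
          by (simp add: right_diff_distrib sum_distrib_left mult.left_commute)
      qed
      then show ?thesis using True by (simp add: \<xi>_def[abs_def])
    next
      case False then show ?thesis using el[of b] b by (simp add: \<xi>_def[abs_def])
    qed
    fix b' assume b': "b' \<in> \<rho>"
    show "\<xi> b b' = (if b' = b then 1 else 0)"
    proof (cases "b = v")
      case bv: True
      show ?thesis
      proof (cases "b' = v")
        case True
        then have "\<xi> b b' = c v - (\<Sum>w\<in>\<rho> - {v}. c w * 0)" using bv ev by (simp add: \<xi>_def)
        then show ?thesis using bv True M(3) by simp
      next
        case False
        have "(\<Sum>w\<in>\<rho> - {v}. c w * \<eta> (?p w) (?p b')) = (\<Sum>w\<in>\<rho> - {v}. if w = b' then c b' else 0)"
          by (intro sum.cong) (use ed b' False in auto)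
        also have "\<dots> = c b'" using r(1) b' False by simp
        finally show ?thesis using bv False by (simp add: \<xi>_def)
      qed
    next
      case False
      then show ?thesis using ed[of b b'] ev[of b] b b' by (cases "b' = v") (auto simp: \<xi>_def)
    qed
  qed (use r in auto)
  then show ?thesis by (auto simp: unimod_def)
qed

text \<open>Written with sums to avoid truncated subtraction. Cutting off above dimension
  \<open>n - k + 1\<close> costs nothing for connectivity in degree \<open>n - k\<close>.\<close>

definition unimod_complex :: "nat \<Rightarrow> nat \<Rightarrow> 'b set \<Rightarrow> 'b set set" where
  "unimod_complex k n M = {\<tau>. \<tau> \<noteq> {} \<and> unimod M \<tau> \<and> card \<tau> + k \<le> n + 2}"

lemma abstract_complex_unimod_complex: "abstract_complex (unimod_complex k n M)"
  unfolding abstract_complex_def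
proof (intro ballI conjI allI impI)
  fix \<sigma> assume s: "\<sigma> \<in> unimod_complex k n M"
  then show f: "finite \<sigma>" "\<sigma> \<noteq> {}" by (auto simp: unimod_complex_def unimod_finite)
  fix \<tau> assume t: "\<tau> \<subseteq> \<sigma> \<and> \<tau> \<noteq> {}"
  then have "card \<tau> \<le> card \<sigma>" using f(1) by (simp add: card_mono)
  then show "\<tau> \<in> unimod_complex k n M" using s t by (auto simp: unimod_complex_def intro: unimod_subset)
qed

text \<open>The source of the rank induction. Vectors in the kernel of \<open>c\<close> are fixed by
  the projection along \<open>v\<close>, so being compatible with \<open>\<sigma>\<close> becomes
  being compatible with the projected set. That set has one member less and the rank is one less, so
  the size bounds agree.\<close>

lemma link_unimod_complex_ker:
  assumes M: "subspace M" "linear_on M c" "c v = 1" and s: "unimod M \<sigma>" "v \<in> \<sigma>"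
  shows "induced (link (unimod_complex k (Suc n) M) \<sigma>) {y. c y = 0} =
    link (unimod_complex k n (ker_on M c)) ((\<lambda>y. y - c y \<odot> v) ` (\<sigma> - {v}))"
proof -
  let ?p = "\<lambda>y. y - c y \<odot> v"
  let ?s = "?p ` (\<sigma> - {v})" and ?N = "ker_on M c"
  note sp = unimod_project[OF M s]
  have fs: "finite \<sigma>" "\<sigma> \<subseteq> M" using unimod_finite[OF s(1)] unimod_carrier[OF s(1)] by auto
  have cs: "card ?s = card \<sigma> - 1" "card \<sigma> \<ge> 1"
    using card_image[OF sp(1)] fs s(2) by (auto simp: card_gt_0_iff Suc_le_eq)
  have img: "?p ` (\<tau> \<union> \<sigma> - {v}) = \<tau> \<union> ?s" if "\<And>y. y \<in> \<tau> \<Longrightarrow> c y = 0" for \<tau>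
  proof -
    have "v \<notin> \<tau>" using that[of v] M(3) by auto
    then have "\<tau> \<union> \<sigma> - {v} = \<tau> \<union> (\<sigma> - {v})" by auto
    moreover have "?p ` \<tau> = \<tau>" using that by (force simp: image_iff)
    ultimately show ?thesis by (simp add: image_Un)
  qed
  show ?thesis
  proof (intro equalityI subsetI)
    fix \<tau> assume "\<tau> \<in> induced (link (unimod_complex k (Suc n) M) \<sigma>) {y. c y = 0}"
    then have t: "\<tau> \<noteq> {}" "\<tau> \<inter> \<sigma> = {}" "unimod M (\<tau> \<union> \<sigma>)" "card (\<tau> \<union> \<sigma>) + k \<le> n + 3" "\<And>y. y \<in> \<tau> \<Longrightarrow> c y = 0"
      by (auto simp: induced_def link_def unimod_complex_def)
    have tsp: "inj_on ?p (\<tau> \<union> \<sigma> - {v})" "unimod ?N (\<tau> \<union> ?s)"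
      using unimod_project[OF M t(3)] s(2) img[OF t(5)] by auto
    have ft: "finite \<tau>" using unimod_finite[OF t(3)] by auto
    have dis: "\<tau> \<inter> ?s = {}"
    proof (rule ccontr)
      assume "\<tau> \<inter> ?s \<noteq> {}"
      then obtain x where x: "x \<in> \<tau>" "x \<in> ?s" by blast
      then obtain w where w: "w \<in> \<sigma> - {v}" "x = ?p w" by blast
      have "?p x = ?p w" using t(5)[OF x(1)] w(2) by simp
      moreover have "x \<noteq> v" using t(5)[OF x(1)] M(3) by auto
      ultimately have "x = w" using inj_onD[OF tsp(1), of x w] x(1) w(1) by auto
      then show False using x(1) w(1) t(2) by auto
    qed
    have "card (\<tau> \<union> ?s) = card \<tau> + (card \<sigma> - 1)" using card_Un_disjoint[OF ft _ dis] fs cs by simp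
    moreover have "card (\<tau> \<union> \<sigma>) = card \<tau> + card \<sigma>" using card_Un_disjoint[OF ft fs(1) t(2)] .
    ultimately have "card (\<tau> \<union> ?s) + k \<le> n + 2" "card \<tau> + k \<le> n + 2" using t(4) cs(2) by auto
    then show "\<tau> \<in> link (unimod_complex k n ?N) ?s"
      using t(1) tsp(2) dis by (auto simp: link_def unimod_complex_def intro: unimod_subset)
  next
    fix \<tau> assume "\<tau> \<in> link (unimod_complex k n ?N) ?s"
    then have t: "\<tau> \<noteq> {}" "\<tau> \<inter> ?s = {}" "unimod ?N (\<tau> \<union> ?s)" "card (\<tau> \<union> ?s) + k \<le> n + 2"
      by (auto simp: link_def unimod_complex_def)
    have tN: "\<tau> \<subseteq> ?N" "finite \<tau>" using unimod_carrier[OF t(3)] unimod_finite[OF t(3)] by auto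
    then have t0: "c y = 0" if "y \<in> \<tau>" for y using that by (auto simp: ker_on_def)
    have vt: "v \<notin> \<tau>" using t0[of v] M(3) by auto
    have pt: "?p y = y" if "y \<in> \<tau>" for y using t0[OF that] by simp
    have dis: "\<tau> \<inter> \<sigma> = {}"
    proof (rule ccontr)
      assume "\<tau> \<inter> \<sigma> \<noteq> {}"
      then obtain x where x: "x \<in> \<tau>" "x \<in> \<sigma>" by blast
      then have "?p x \<in> ?s" using vt by auto
      then show False using x(1) pt[OF x(1)] t(2) by auto
    qed
    have "inj_on ?p (\<tau> \<union> (\<sigma> - {v}))"
      unfolding inj_on_Un
    proof (intro conjI)
      show "inj_on ?p \<tau>" by (rule inj_onI) (use pt in metis)
      have "?p ` \<tau> = \<tau>" using pt by (force simp: image_iff)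
      then show "?p ` (\<tau> - (\<sigma> - {v})) \<inter> ?p ` (\<sigma> - {v} - \<tau>) = {}" using t(2) by blast
    qed (rule sp(1))
    moreover have "\<tau> \<union> \<sigma> - {v} = \<tau> \<union> (\<sigma> - {v})" using vt by auto
    ultimately have um: "unimod M (\<tau> \<union> \<sigma>)"
      using img[of \<tau>] t0 t(3) tN fs s(2) by (intro unimod_lift[OF M]) (auto simp: ker_on_def)
    have "card (\<tau> \<union> ?s) = card \<tau> + (card \<sigma> - 1)" using card_Un_disjoint[OF tN(2) _ t(2)] fs cs by simp
    moreover have "card (\<tau> \<union> \<sigma>) = card \<tau> + card \<sigma>" using card_Un_disjoint[OF tN(2) fs(1) dis] .
    ultimately have "card (\<tau> \<union> \<sigma>) + k \<le> n + 3" "card \<tau> + k \<le> n + 3" using t(4) cs(2) by auto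
    then show "\<tau> \<in> induced (link (unimod_complex k (Suc n) M) \<sigma>) {y. c y = 0}"
      using t(1) um dis t0 by (auto simp: induced_def link_def unimod_complex_def intro: unimod_subset)
  qed
qed

end

section \<open>Connectivity of the complex of unimodular sets\<close>

lemma induced_induced: "induced (induced K V) W = induced K (V \<inter> W)"
  by (auto simp: induced_def)

lemma link_induced: "\<sigma> \<subseteq> V \<Longrightarrow> link (induced K V) \<sigma> = induced (link K \<sigma>) V"
  by (auto simp: link_def induced_def)

lemma link_empty [simp]: "link K {} = K"
  by (auto simp: link_def)

context unimodular
begin

text \<open>The empty \<open>\<sigma>\<close> is allowed and gives the whole complex.
  \<open>M \<noteq> UNIV\<close> provides a fresh vertex for attaching large simplices, and it
  passes to kernels.\<close>

definition link_conn :: "nat \<Rightarrow> nat \<Rightarrow> bool" where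
  "link_conn k n \<longleftrightarrow> (\<forall>M \<sigma>. free n M \<longrightarrow> M \<noteq> UNIV \<longrightarrow> unimod M \<sigma> \<longrightarrow>
     cconn (int n - int k - int (card \<sigma>)) (link (unimod_complex k n M) \<sigma>))"

text \<open>The index is the rank of the kernel of \<open>\<phi>\<close>: the ambient module has rank \<open>Suc n\<close>.\<close>

definition slab_conn :: "nat \<Rightarrow> nat \<Rightarrow> bool" where
  "slab_conn k n \<longleftrightarrow> (\<forall>M \<phi> e \<sigma>. subspace M \<longrightarrow> linear_on M \<phi> \<longrightarrow> e \<in> M \<longrightarrow> \<phi> e = 1 \<longrightarrow>
     free n (ker_on M \<phi>) \<longrightarrow> M \<noteq> UNIV \<longrightarrow> unimod M \<sigma> \<longrightarrow>
     cconn (int (Suc n) - int k - int (card \<sigma>)) (induced (link (unimod_complex k (Suc n) M) \<sigma>) {y. \<phi> y \<in> {0, 1}}))"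

lemma link_unimod_complex_simplex:
  assumes "\<tau> \<in> link (unimod_complex k n M) \<sigma>"
  shows "unimod M (\<tau> \<union> \<sigma>)" "card (\<tau> \<union> \<sigma>) = card \<tau> + card \<sigma>"
proof -
  have t: "unimod M (\<tau> \<union> \<sigma>)" "\<tau> \<inter> \<sigma> = {}" using assms by (auto simp: link_def unimod_complex_def)
  then show "unimod M (\<tau> \<union> \<sigma>)" "card (\<tau> \<union> \<sigma>) = card \<tau> + card \<sigma>"
    using unimod_finite[OF t(1)] by (auto simp: card_Un_disjoint)
qed

text \<open>Vertices of any height can be added, because the hypothesis already covers the slab part
  of the link of every unimodular set, in particular of
  \<open>\<tau> \<union> \<sigma>\<close>.\<close>

lemma slab_conn_imp_link_conn:
  assumes "slab_conn k n" shows "link_conn k (Suc n)"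
  unfolding link_conn_def
proof (intro allI impI)
  fix M \<sigma> assume M: "free (Suc n) M" "M \<noteq> UNIV" and s: "unimod M \<sigma>"
  obtain \<phi> e where p: "linear_on M \<phi>" "e \<in> M" "\<phi> e = 1" "free n (ker_on M \<phi>)"
    using free_Suc_split[OF M(1)] by metis
  have sub: "subspace M" using M(1) by (auto simp: free_def frame_def)
  let ?U = "unimod_complex k (Suc n) M" and ?V = "{y. \<phi> y \<in> {0, 1}}"
  have slab: "cconn (int (Suc n) - int k - int (card \<sigma>)) (induced (link ?U \<sigma>) ?V)" if "unimod M \<sigma>" for \<sigma>
    using assms sub p M(2) that unfolding slab_conn_def by blast
  show "cconn (int (Suc n) - int k - int (card \<sigma>)) (link ?U \<sigma>)"
  proof (rule cconn_add_vertices[OF abstract_complex_link[OF abstract_complex_unimod_complex] slab[OF s]])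
    fix \<tau> assume t: "\<tau> \<in> link ?U \<sigma>"
    show "cconn (int (Suc n) - int k - int (card \<sigma>) - int (card \<tau>)) (induced (link (link ?U \<sigma>) \<tau>) ?V)"
      unfolding link_link[OF abstract_complex_unimod_complex t]
      using slab[OF link_unimod_complex_simplex(1)[OF t]] link_unimod_complex_simplex(2)[OF t] by (simp add: algebra_simps)
  qed
qed

lemma card_proj_image:
  assumes "subspace M" "linear_on M c" "c v = 1" "unimod M \<rho>" "v \<in> \<rho>"
  shows "int (card ((\<lambda>y. y - c y \<odot> v) ` (\<rho> - {v}))) = int (card \<rho>) - 1"
proof -
  have "card \<rho> > 0" using assms(4,5) unimod_finite[OF assms(4)] by (auto simp: card_gt_0_iff)
  then show ?thesis
    using card_image[OF unimod_project(1)[OF assms]] unimod_finite[OF assms(4)] assms(5) by simp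
qed

text \<open>A vector of height 1 has \<open>\<phi>\<close> itself as adapted functional, so the
  height 0 part of the link is a link in the kernel.\<close>

lemma link_conn_ker:
  assumes A: "link_conn k n" and M: "subspace M" "linear_on M \<phi>" "free n (ker_on M \<phi>)" "M \<noteq> UNIV"
    and r: "unimod M \<rho>" "v \<in> \<rho>" "\<phi> v = 1"
  shows "cconn (int (Suc n) - int k - int (card \<rho>)) (induced (link (unimod_complex k (Suc n) M) \<rho>) {y. \<phi> y = 0})"
proof -
  let ?s = "(\<lambda>y. y - \<phi> y \<odot> v) ` (\<rho> - {v})"
  have "ker_on M \<phi> \<noteq> UNIV" using M(4) by (auto simp: ker_on_def)
  then have "cconn (int n - int k - int (card ?s)) (link (unimod_complex k n (ker_on M \<phi>)) ?s)"
    using A M(3) unimod_project(2)[OF M(1,2) r(3,1,2)] unfolding link_conn_def by blast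
  then show ?thesis
    unfolding link_unimod_complex_ker[OF M(1,2) r(3,1,2)] card_proj_image[OF M(1,2) r(3,1,2)] by (simp add: algebra_simps)
qed

text \<open>The unimodular sets of the kernel joined with \<open>e\<close> form a cone. The full
  subcomplex on the kernel and \<open>e\<close> has beyond this only simplices of too high dimension
  to matter, and the other vectors of height 1 are then added as vertices.\<close>

lemma slab_conn_empty:
  assumes A: "link_conn k n" and M: "subspace M" "linear_on M \<phi>" "e \<in> M" "\<phi> e = 1" "free n (ker_on M \<phi>)" "M \<noteq> UNIV"
  shows "cconn (int (Suc n) - int k) (induced (unimod_complex k (Suc n) M) {y. \<phi> y \<in> {0, 1}})"
proof (cases "k \<le> n + 2")
  case False
  then show ?thesis by (intro cconn_trivial) simp
next
  case kn: True
  let ?U = "unimod_complex k (Suc n) M" and ?V = "{y. \<phi> y \<in> {0, 1}}" and ?N = "ker_on M \<phi>" and ?d = "int (Suc n) - int k"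
  let ?X = "induced ?U ?V" and ?Vz = "{y. \<phi> y = 0}"
  let ?Ve = "insert e ?Vz"
  have V01: "?Vz \<subseteq> ?Ve" "?Ve \<subseteq> ?V" using M(4) by auto
  have Xc: "abstract_complex ?X" by (rule abstract_complex_induced[OF abstract_complex_unimod_complex])
  have NM: "?N \<subseteq> M" by (auto simp: ker_on_def)
  obtain b where b: "b \<notin> M" using M(6) by auto
  have lift: "unimod M (insert e \<tau>)" if t: "unimod ?N \<tau>" for \<tau>
  proof (rule unimod_lift[OF M(1,2,4)])
    have t': "\<tau> \<subseteq> ?N" "finite \<tau>" using unimod_carrier[OF t] unimod_finite[OF t] by auto
    have et: "e \<notin> \<tau>" using t'(1) M(4) by (auto simp: ker_on_def)
    have p: "y - \<phi> y \<odot> e = y" if "y \<in> \<tau>" for y using t'(1) that by (auto simp: ker_on_def)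
    show "finite (insert e \<tau>)" "insert e \<tau> \<subseteq> M" "e \<in> insert e \<tau>" using t' NM M(3) by auto
    have eq: "insert e \<tau> - {e} = \<tau>" using et by auto
    show "inj_on (\<lambda>y. y - \<phi> y \<odot> e) (insert e \<tau> - {e})" unfolding eq by (rule inj_onI) (metis p)
    have "(\<lambda>y. y - \<phi> y \<odot> e) ` \<tau> = \<tau>" using p by (force simp: image_iff)
    then show "unimod ?N ((\<lambda>y. y - \<phi> y \<odot> e) ` (insert e \<tau> - {e}))" unfolding eq using t by simp
  qed
  \<comment> \<open>The size bound ignores \<open>e\<close>, so that \<open>e\<close> is a genuine
    cone point; with \<open>e\<close> counted the size still respects the bound for rank
    \<open>Suc n\<close>.\<close>
  let ?C = "{\<tau>. \<tau> \<noteq> {} \<and> \<tau> \<subseteq> insert e ?N \<and> unimod ?N (\<tau> - {e}) \<and> card (\<tau> - {e}) + k \<le> n + 2}"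
  have K0f: "finite \<tau>" if "\<tau> \<in> ?C" for \<tau> using that unimod_finite[of ?N "\<tau> - {e}"] by auto
  have K0c: "abstract_complex ?C"
    unfolding abstract_complex_def
  proof (intro ballI conjI allI impI)
    fix \<sigma> assume s: "\<sigma> \<in> ?C"
    show fs: "finite \<sigma>" "\<sigma> \<noteq> {}" using s K0f[OF s] by auto
    fix \<tau> assume t: "\<tau> \<subseteq> \<sigma> \<and> \<tau> \<noteq> {}"
    have sub: "\<tau> - {e} \<subseteq> \<sigma> - {e}" using t by auto
    have "card (\<tau> - {e}) \<le> card (\<sigma> - {e})" using card_mono[OF _ sub] fs by auto
    then show "\<tau> \<in> ?C" using s t unimod_subset[OF _ sub] by auto
  qed
  have K0: "cconn ?d ?C"
  proof (rule cconn_cone[OF K0c, of e])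
    show "{e} \<in> ?C" using kn unimod_empty by auto
    show "insert e \<sigma> \<in> ?C" if "\<sigma> \<in> ?C" for \<sigma> using that by auto
  qed
  have K0X: "?C \<subseteq> induced ?X ?Ve"
  proof
    fix \<tau> assume t: "\<tau> \<in> ?C"
    have "card \<tau> \<le> Suc (card (\<tau> - {e}))" using K0f[OF t] by (cases "e \<in> \<tau>") (auto simp: card_Diff_singleton)
    moreover have "unimod M \<tau>"
      by (rule unimod_subset[OF lift[of "\<tau> - {e}"]]) (use t in auto)
    ultimately show "\<tau> \<in> induced ?X ?Ve" using t M(4) by (auto simp: induced_def unimod_complex_def ker_on_def)
  qed
  \<comment> \<open>Such a simplex is unimodular in the kernel once \<open>e\<close> is deleted, so
    it can only violate the size bound of \<open>?C\<close>. It therefore omits \<open>e\<close> and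
    has exactly \<open>n + 3 - k\<close> members, which is \<open>?d + 2\<close>.\<close>
  have big: "?d + 2 \<le> int (card \<tau>)" if t: "\<tau> \<in> induced ?X ?Ve - ?C" for \<tau>
  proof (rule ccontr)
    assume small: "\<not> ?d + 2 \<le> int (card \<tau>)"
    have t': "\<tau> \<noteq> {}" "unimod M \<tau>" "card \<tau> + k \<le> n + 3" "\<tau> \<subseteq> ?Ve"
      using t by (auto simp: induced_def unimod_complex_def)
    have tN: "\<tau> \<subseteq> insert e ?N" using t'(4) unimod_carrier[OF t'(2)] by (auto simp: ker_on_def)
    have p: "y - \<phi> y \<odot> e = y" if "y \<in> \<tau> - {e}" for y using tN that by (auto simp: ker_on_def)
    have "unimod ?N (\<tau> - {e})"
    proof (cases "e \<in> \<tau>")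
      case True
      have "(\<lambda>y. y - \<phi> y \<odot> e) ` (\<tau> - {e}) = \<tau> - {e}" using p by (force simp: image_iff)
      then show ?thesis using unimod_project(2)[OF M(1,2,4) t'(2) True] by simp
    next
      case False
      then have tt: "\<tau> - {e} = \<tau>" "\<tau> \<subseteq> ?N" using tN by auto
      obtain \<xi> where "dual_family M \<tau> \<xi>" using t'(2) by (auto simp: unimod_def)
      then have "dual_family ?N \<tau> \<xi>" using tt(2) NM linear_on_subset unfolding dual_family_def by blast
      then show ?thesis using tt by (auto simp: unimod_def)
    qed
    moreover have "card (\<tau> - {e}) \<le> card \<tau>" using unimod_finite[OF t'(2)] by (simp add: card_Diff1_le)
    then have "card (\<tau> - {e}) + k \<le> n + 2" using small by auto
    ultimately show False using t t'(1) tN by auto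
  qed
  have bX: "b \<notin> \<Union> (induced ?X ?Ve)" using b unimod_carrier by (auto simp: induced_def unimod_complex_def)
  have step1: "cconn ?d (induced ?X ?Ve)"
    by (rule cconn_add_large_simplices[OF K0c K0 abstract_complex_induced[OF Xc] K0X _ bX]) (rule big)
  show ?thesis
  proof (rule cconn_add_vertices[OF Xc step1])
    fix \<sigma> assume s: "\<sigma> \<in> ?X" "\<sigma> \<inter> ?Ve = {}"
    have sU: "\<sigma> \<in> ?U" "\<sigma> \<subseteq> ?V" "unimod M \<sigma>" "\<sigma> \<noteq> {}" using s(1) by (auto simp: induced_def unimod_complex_def)
    obtain v where v: "v \<in> \<sigma>" "\<phi> v = 1" using sU s(2) by blast
    let ?Z = "induced (link ?X \<sigma>) ?Ve"
    have Lc: "abstract_complex (link ?X \<sigma>)" by (rule abstract_complex_link[OF Xc])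
    note Zc = abstract_complex_induced[OF Lc, of ?Ve]
    \<comment> \<open>Within \<open>?Ve\<close> only \<open>e\<close> has nonzero height, so this
      adds at most the vertex \<open>e\<close> to the height 0 part of the link.\<close>
    show "cconn (?d - int (card \<sigma>)) ?Z"
    proof (rule cconn_add_vertices[OF Zc, of _ ?Vz])
      have eq: "induced ?Z ?Vz = induced (link ?U \<sigma>) ?Vz"
        unfolding link_induced[OF sU(2)] induced_induced using V01 by (simp add: Int_absorb1 Int_absorb2 inf.absorb2)
      show "cconn (?d - int (card \<sigma>)) (induced ?Z ?Vz)"
        unfolding eq by (rule link_conn_ker[OF A M(1,2,5,6) sU(3) v])
      fix \<rho> assume r: "\<rho> \<in> ?Z" "\<rho> \<inter> ?Vz = {}"
      have rL: "\<rho> \<in> link ?X \<sigma>" "\<rho> \<subseteq> ?Ve" using r(1) by (auto simp: induced_def)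
      then have rU: "\<rho> \<in> link ?U \<sigma>" "\<rho> \<union> \<sigma> \<subseteq> ?V" using sU(2) unfolding link_induced[OF sU(2)] by (auto simp: induced_def)
      have "link ?Z \<rho> = induced (link ?X (\<rho> \<union> \<sigma>)) ?Ve"
        unfolding link_induced[OF rL(2)] link_link[OF Xc rL(1)] ..
      then have eq: "induced (link ?Z \<rho>) ?Vz = induced (link ?U (\<rho> \<union> \<sigma>)) ?Vz"
        unfolding link_induced[OF rU(2)] using V01 by (simp add: induced_induced Int_absorb1 Int_absorb2 inf.absorb2)
      show "cconn (?d - int (card \<sigma>) - int (card \<rho>)) (induced (link ?Z \<rho>) ?Vz)"
        unfolding eq
        using link_conn_ker[OF A M(1,2,5,6) link_unimod_complex_simplex(1)[OF rU(1)] _ v(2)] v(1) link_unimod_complex_simplex(2)[OF rU(1)]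
        by (simp add: algebra_simps)
    qed
  qed
qed

text \<open>For nonempty \<open>\<sigma>\<close> with a member \<open>v\<close> and \<open>c\<close>
  from \<open>adapted_complement\<close>, the part of the slab in the kernel of \<open>c\<close> is
  the slab of that kernel, so \<open>B\<close> applies; the remaining slab vertices are added
  afterwards. The stable range condition serves this purpose only for \<open>k \<le> n\<close>, and
  beyond it the claim is at most nonemptiness.\<close>

lemma slab_conn_step:
  assumes k: "k \<ge> 1" "SR TYPE('a) k" and A: "link_conn k n" and B: "\<And>m. n = Suc m \<Longrightarrow> slab_conn k m"
  shows "slab_conn k n"
  unfolding slab_conn_def
proof (intro allI impI)
  fix M \<phi> e \<sigma>
  assume M: "subspace M" "linear_on M \<phi>" "e \<in> M" "\<phi> e = 1" "free n (ker_on M \<phi>)" "M \<noteq> UNIV" and s: "unimod M \<sigma>"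
  let ?U = "unimod_complex k (Suc n) M" and ?V = "{y. \<phi> y \<in> {0, 1}}" and ?d = "int (Suc n) - int k - int (card \<sigma>)"
  show "cconn ?d (induced (link ?U \<sigma>) ?V)"
  proof (cases "\<sigma> = {}")
    case True
    then show ?thesis using slab_conn_empty[OF A M] by simp
  next
    case ne: False
    then obtain v where v: "v \<in> \<sigma>" by auto
    have vu: "unimod M {v}" by (rule unimod_subset[OF s]) (use v in auto)
    have cs: "card \<sigma> \<ge> 1" using ne unimod_finite[OF s] by (simp add: card_gt_0_iff Suc_le_eq)
    show ?thesis
    proof (cases "k \<le> n")
      case True
      then obtain m where m: "n = Suc m" using k(1) by (cases n) auto
      have sr: "SR TYPE('a) (Suc m)" "SR TYPE('a) (Suc (Suc m))"
        using SR_mono[OF k(2,1)] True m by auto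
      obtain c e' where c: "linear_on M c" "c v = 1" "e' \<in> ker_on M c" "\<phi> e' = 1" "free m (ker_on (ker_on M c) \<phi>)"
        using adapted_complement[OF sr M(1-4) M(5)[unfolded m] vu] by metis
      let ?M = "ker_on M c" and ?Vz = "{y. c y = 0}"
      have M': "subspace ?M" "linear_on ?M \<phi>" "?M \<noteq> UNIV"
        using subspace_ker_on[OF M(1) c(1)] linear_on_subset[OF M(2)] M(6) by (auto simp: ker_on_def)
      have red: "cconn (int (Suc n) - int k - int (card \<rho>)) (induced (link ?U \<rho>) (?V \<inter> ?Vz))"
        if r: "unimod M \<rho>" "v \<in> \<rho>" for \<rho>
      proof -
        let ?s = "(\<lambda>y. y - c y \<odot> v) ` (\<rho> - {v})"
        have "cconn (int (Suc m) - int k - int (card ?s)) (induced (link (unimod_complex k (Suc m) ?M) ?s) ?V)"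
          using B[OF m] M' c(3,4,5) unimod_project(2)[OF M(1) c(1,2) r] unfolding slab_conn_def by blast
        moreover have "induced (link ?U \<rho>) (?V \<inter> ?Vz) = induced (link (unimod_complex k (Suc m) ?M) ?s) ?V"
          unfolding m link_unimod_complex_ker[OF M(1) c(1,2) r, symmetric] induced_induced by (simp add: Int_commute)
        ultimately show ?thesis
          unfolding card_proj_image[OF M(1) c(1,2) r] m by (simp add: algebra_simps)
      qed
      have Lc: "abstract_complex (link ?U \<sigma>)" by (rule abstract_complex_link[OF abstract_complex_unimod_complex])
      show ?thesis
      proof (rule cconn_add_vertices[OF abstract_complex_induced[OF Lc], of _ _ ?Vz])
        show "cconn ?d (induced (induced (link ?U \<sigma>) ?V) ?Vz)"
          unfolding induced_induced by (rule red[OF s v])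
        fix \<tau> assume t: "\<tau> \<in> induced (link ?U \<sigma>) ?V"
        then have t': "\<tau> \<in> link ?U \<sigma>" "\<tau> \<subseteq> ?V" by (auto simp: induced_def)
        have "induced (link (induced (link ?U \<sigma>) ?V) \<tau>) ?Vz = induced (link ?U (\<tau> \<union> \<sigma>)) (?V \<inter> ?Vz)"
          unfolding link_induced[OF t'(2)] link_link[OF abstract_complex_unimod_complex t'(1)] induced_induced ..
        then show "cconn (?d - int (card \<tau>)) (induced (link (induced (link ?U \<sigma>) ?V) \<tau>) ?Vz)"
          using red[OF link_unimod_complex_simplex(1)[OF t'(1)]] v link_unimod_complex_simplex(2)[OF t'(1)] by (simp add: algebra_simps)
      qed
    next
      case False
      show ?thesis
      \<comment> \<open>For \<open>k > n\<close> and nonempty \<open>\<sigma>\<close> the degree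
        \<open>?d\<close> is at most -1, with equality only in this case. Then a single vertex of
        the link has to be found, and the sheared vector \<open>e'\<close> is one.\<close>
      proof (cases "k = Suc n \<and> card \<sigma> = 1")
        case kn: True
        then have s1: "\<sigma> = {v}" using v card_1_singletonE by blast
        obtain e' where e': "e' \<in> M" "\<phi> e' = 1" "unimod (ker_on M \<phi>) {v - \<phi> v \<odot> e'}"
          using shear_to_unimod[OF _ M(1-5) vu] k(2) kn by metis
        have ne: "v \<noteq> e'"
        proof
          assume "v = e'"
          then have "unimod (ker_on M \<phi>) {0}" using e' by simp
          then obtain \<xi> where "linear_on (ker_on M \<phi>) \<xi>" "\<xi> 0 = 1" by (auto simp: unimod_singleton)
          then show False using linear_on_0[OF _ subspace_ker_on[OF M(1,2)]] by fastforce
        qed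
        have "v \<in> M" using vu by (auto simp: unimod_singleton)
        then have "unimod M {e', v}"
          using e' ne by (intro unimod_lift[OF M(1,2) e'(2)]) (auto simp: insert_Diff_if)
        then have "{e'} \<in> induced (link ?U \<sigma>) ?V"
          using ne e' kn unimod_subset[of M "{e', v}" "{e'}"] unfolding s1
          by (auto simp: induced_def link_def unimod_complex_def insert_commute)
        moreover have "?d = -1" using kn by simp
        ultimately show ?thesis
          using cconn_minus_one[OF abstract_complex_induced[OF abstract_complex_link[OF abstract_complex_unimod_complex]]] by metis
      next
        case kn: False
        then have "?d \<le> -2" using False cs by linarith
        then show ?thesis by (rule cconn_trivial)
      qed
    qed
  qed
qed

text \<open>Since \<open>slab_conn k n\<close> concerns rank \<open>Suc n\<close>, it is obtained
  from \<open>link_conn k n\<close> and the slab statement one rank below, and it yields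
  \<open>link_conn k (Suc n)\<close>. Rank 0 is void because \<open>k \<ge> 2\<close> puts the
  degree at -2 or less.\<close>

lemma link_conn_all:
  assumes k: "k \<ge> 2" "SR TYPE('a) k"
  shows "link_conn k n"
proof -
  have "link_conn k n \<and> (\<forall>m. n = Suc m \<longrightarrow> slab_conn k m)"
  proof (induction n)
    case 0
    have "link_conn k 0" unfolding link_conn_def
      by (intro allI impI cconn_trivial) (use k(1) in simp)
    then show ?case by simp
  next
    case (Suc n)
    then have "slab_conn k n" using slab_conn_step[OF _ k(2)] k(1) by auto
    then show ?case using slab_conn_imp_link_conn by auto
  qed
  then show ?thesis by simp
qed

end

section \<open>Partial bases\<close>

context unimodular
begin

definition basis_of :: "'b set \<Rightarrow> 'b set \<Rightarrow> bool" where
  "basis_of M B \<longleftrightarrow> unimod M B \<and> M \<subseteq> span B"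

definition partial_basis :: "nat \<Rightarrow> 'b set \<Rightarrow> 'b set \<Rightarrow> bool" where
  "partial_basis n M \<sigma> \<longleftrightarrow> (\<exists>B. basis_of M B \<and> card B = n \<and> \<sigma> \<subseteq> B)"

lemma partial_basis_subset: "partial_basis n M \<sigma> \<Longrightarrow> \<tau> \<subseteq> \<sigma> \<Longrightarrow> partial_basis n M \<tau>"
  unfolding partial_basis_def by blast

lemma linear_on_span_eq_0:
  assumes "linear_on M c" "subspace M" "S \<subseteq> M" "\<And>s. s \<in> S \<Longrightarrow> c s = 0" "x \<in> span S"
  shows "c x = 0"
proof -
  have "span S \<subseteq> ker_on M c"
    by (rule span_minimal[OF _ subspace_ker_on[OF assms(2,1)]]) (use assms(3,4) in \<open>auto simp: ker_on_def\<close>)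
  then show ?thesis using assms(5) by (auto simp: ker_on_def)
qed

lemma free_imp_basis:
  assumes "free n M" shows "\<exists>B. basis_of M B \<and> card B = n"
proof -
  obtain b x where f: "frame n M b x" using assms by (auto simp: free_def)
  have M: "\<And>i. i < n \<Longrightarrow> b i \<in> M" "\<And>i. i < n \<Longrightarrow> linear_on M (x i)"
    "\<And>i j. i < n \<Longrightarrow> j < n \<Longrightarrow> x i (b j) = (if j = i then 1 else 0)"
    using f by (auto simp: frame_def)
  have inj: "inj_on b {..<n}"
  proof (rule inj_onI)
    fix i j assume ij: "i \<in> {..<n}" "j \<in> {..<n}" "b i = b j"
    then have "x i (b j) = 1" using M(3)[of i i] by simp
    then show "i = j" using M(3)[of i j] ij(1,2) by (simp split: if_splits)
  qed
  have "dual_family M (b ` {..<n}) (\<lambda>v. x (inv_into {..<n} b v))"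
    unfolding dual_family_def
  proof (intro conjI ballI)
    fix v assume "v \<in> b ` {..<n}"
    then obtain i where i: "i < n" "v = b i" by auto
    have iv: "inv_into {..<n} b v = i" using inv_into_f_f[OF inj, of i] i by simp
    show "linear_on M (x (inv_into {..<n} b v))" unfolding iv by (rule M(2)[OF i(1)])
    fix v' assume "v' \<in> b ` {..<n}"
    then obtain j where j: "j < n" "v' = b j" by auto
    show "x (inv_into {..<n} b v) v' = (if v' = v then 1 else 0)"
      unfolding iv unfolding i(2) j(2) using M(3)[OF i(1) j(1)] inj_on_eq_iff[OF inj, of j i] i j by simp
  qed (use M(1) in auto)
  then have "unimod M (b ` {..<n})" by (auto simp: unimod_def)
  moreover have "M \<subseteq> span (b ` {..<n})"
  proof
    fix y assume "y \<in> M"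
    then have "y = (\<Sum>i<n. x i y \<odot> b i)" using frame_expand[OF f] by simp
    also have "\<dots> \<in> span (b ` {..<n})" by (intro span_sum span_scale span_base) auto
    finally show "y \<in> span (b ` {..<n})" .
  qed
  ultimately show ?thesis using card_image[OF inj] by (auto simp: basis_of_def)
qed

section \<open>Completing unimodular sets to bases\<close>

text \<open>Vectors of the kernel that complete the projected set also complete
  \<open>\<sigma>\<close>: the span contains \<open>v\<close> and the projected vectors, hence the
  kernel of \<open>c\<close> and all of \<open>M\<close>.\<close>

lemma basis_lift:
  assumes M: "subspace M" "linear_on M c" "c v = 1" and s: "unimod M \<sigma>" "v \<in> \<sigma>"
    and B': "partial_basis m (ker_on M c) ((\<lambda>y. y - c y \<odot> v) ` (\<sigma> - {v}))"
  shows "partial_basis (Suc m) M \<sigma>"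
proof -
  let ?p = "\<lambda>y. y - c y \<odot> v"
  let ?s = "?p ` (\<sigma> - {v})" and ?N = "ker_on M c"
  obtain B where B: "unimod ?N B" "?N \<subseteq> span B" "card B = m" "?s \<subseteq> B"
    using B' by (auto simp: partial_basis_def basis_of_def)
  have fB: "finite B" using unimod_finite[OF B(1)] .
  have fs: "finite \<sigma>" "\<sigma> \<subseteq> M" using unimod_finite[OF s(1)] unimod_carrier[OF s(1)] by auto
  define \<tau> where "\<tau> = B - ?s"
  have tB: "\<tau> \<union> ?s = B" using B(4) by (auto simp: \<tau>_def)
  have "unimod M (\<tau> \<union> \<sigma>) \<and> \<tau> \<inter> \<sigma> = {}"
  proof (cases "\<tau> = {}")
    case True then show ?thesis using s(1) by simp
  next
    case False
    \<comment> \<open>With \<open>k = 0\<close> the size bound is no restriction here, and the link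
      identity yields unimodularity and disjointness at once.\<close>
    have "\<tau> \<in> link (unimod_complex 0 m ?N) ?s"
      unfolding link_def unimod_complex_def
      using False tB B(1,3) card_mono[OF fB, of \<tau>] by (auto simp: \<tau>_def intro: unimod_subset)
    then show ?thesis
      unfolding link_unimod_complex_ker[OF M s, symmetric] by (auto simp: induced_def link_def unimod_complex_def)
  qed
  then have um: "unimod M (\<tau> \<union> \<sigma>)" and dis: "\<tau> \<inter> \<sigma> = {}" by auto
  have "card \<sigma> \<ge> 1" using fs s(2) by (auto simp: card_gt_0_iff Suc_le_eq)
  moreover have "card ?s = card \<sigma> - 1" using card_image[OF unimod_project(1)[OF M s]] fs s(2) by simp
  moreover have "card \<tau> = m - card ?s" "card ?s \<le> m"
    unfolding \<tau>_def using card_Diff_subset[OF _ B(4)] card_mono[OF fB B(4)] fs B(3) by auto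
  moreover have "card (\<tau> \<union> \<sigma>) = card \<tau> + card \<sigma>"
    using card_Un_disjoint[OF _ fs(1) dis] fB by (simp add: \<tau>_def)
  ultimately have card: "card (\<tau> \<union> \<sigma>) = Suc m" by simp
  let ?S = "span (\<tau> \<union> \<sigma>)"
  have vS: "v \<in> ?S" using s(2) by (intro span_base) auto
  have "B \<subseteq> ?S"
  proof
    fix y assume "y \<in> B"
    then consider "y \<in> \<tau>" | w where "w \<in> \<sigma>" "y = ?p w" using tB by blast
    then show "y \<in> ?S" by cases (auto intro: span_base span_diff span_scale vS)
  qed
  then have NS: "?N \<subseteq> ?S" using B(2) span_minimal[OF _ subspace_span] by blast
  have "M \<subseteq> ?S"
  proof
    fix y assume y: "y \<in> M"
    have "?p y + c y \<odot> v \<in> ?S"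
      using split_off[OF M(1,2) _ M(3) y] s(2) fs NS vS by (intro span_add span_scale) auto
    then show "y \<in> ?S" by simp
  qed
  then show ?thesis using um card by (auto simp: partial_basis_def basis_of_def)
qed

text \<open>Members are split off one at a time. Rank and size drop together, so the size hypothesis
  persists; as long as a member remains it gives \<open>k \<le> n\<close>, which is the stable range
  that \<open>unimod_vector_complement\<close> needs.\<close>

lemma unimod_imp_partial_basis:
  assumes k: "k \<ge> 1" "SR TYPE('a) k" and M: "free n M" and s: "unimod M \<sigma>" "card \<sigma> + k \<le> n + 1"
  shows "partial_basis n M \<sigma>"
  using M s
proof (induction "card \<sigma>" arbitrary: n M \<sigma>)
  case 0
  then have "\<sigma> = {}" using unimod_finite by auto
  then show ?case using free_imp_basis[OF 0(2)] by (auto simp: partial_basis_def)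
next
  case (Suc j)
  then obtain v where v: "v \<in> \<sigma>" by (metis card.empty ex_in_conv nat.distinct(1))
  obtain m where m: "n = Suc m" using Suc.hyps(2) Suc.prems(3) k(1) by (cases n) auto
  have sub: "subspace M" using Suc.prems(1) by (auto simp: free_def frame_def)
  have "SR TYPE('a) (Suc m)" by (rule SR_mono[OF k(2,1)]) (use Suc.hyps(2) Suc.prems(3) m in simp)
  moreover have "unimod M {v}" by (rule unimod_subset[OF Suc.prems(2)]) (use v in auto)
  ultimately obtain c where c: "linear_on M c" "c v = 1" "free m (ker_on M c)"
    using unimod_vector_complement[OF _ Suc.prems(1)[unfolded m]] by metis
  let ?s = "(\<lambda>y. y - c y \<odot> v) ` (\<sigma> - {v})"
  have cs: "card ?s = j"
    using card_image[OF unimod_project(1)[OF sub c(1,2) Suc.prems(2) v]] unimod_finite[OF Suc.prems(2)] v Suc.hyps(2) by simp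
  have "partial_basis m (ker_on M c) ?s"
    by (rule Suc.hyps(1)) (use cs c(3) unimod_project(2)[OF sub c(1,2) Suc.prems(2) v] Suc.hyps(2) Suc.prems(3) m in auto)
  then show ?case unfolding m by (rule basis_lift[OF sub c(1,2) Suc.prems(2) v])
qed

section \<open>Shears and exchange of basis vectors\<close>

text \<open>A unipotent change of basis: the functionals dual to \<open>T\<close> are kept for the
  sheared vectors, and those dual to \<open>S\<close> are corrected by the entries of the
  shear.\<close>

lemma basis_shear:
  assumes M: "subspace M" and B: "basis_of M (S \<union> T)" "S \<inter> T = {}" and f: "\<And>t. t \<in> T \<Longrightarrow> f t - t \<in> span S"
  shows "basis_of M (S \<union> f ` T)" "inj_on f T" "S \<inter> f ` T = {}"
proof -
  obtain \<xi> where x: "dual_family M (S \<union> T) \<xi>" using B(1) by (auto simp: basis_of_def unimod_def)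
  have fin: "finite S" "finite T" "S \<subseteq> M" "T \<subseteq> M" and xl: "\<And>b. b \<in> S \<union> T \<Longrightarrow> linear_on M (\<xi> b)"
    and xd: "\<And>b b'. b \<in> S \<union> T \<Longrightarrow> b' \<in> S \<union> T \<Longrightarrow> \<xi> b b' = (if b' = b then 1 else 0)"
    using x by (auto simp: dual_family_def)
  have SM: "span S \<subseteq> M" by (rule span_minimal[OF fin(3) M])
  have fM: "f t \<in> M" if "t \<in> T" for t
    using subspace_add[OF M, of "f t - t" t] f[OF that] SM fin(4) that by auto
  have xS: "\<xi> t y = 0" if "t \<in> T" "y \<in> span S" for t y
    by (rule linear_on_span_eq_0[OF xl M fin(3) _ that(2)]) (use that(1) B(2) in \<open>auto simp: xd\<close>)
  have xf: "\<xi> t (f t') = (if t' = t then 1 else 0)" if t: "t \<in> T" "t' \<in> T" for t t'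
  proof -
    have "\<xi> t (f t') - \<xi> t t' = 0"
      using linear_on_diff[OF xl M fM, of t t' t'] xS[OF t(1) f[OF t(2)]] t fin(4) by auto
    then show ?thesis using xd[of t t'] t by simp
  qed
  show inj: "inj_on f T"
  proof (rule inj_onI)
    fix t t' assume t: "t \<in> T" "t' \<in> T" "f t = f t'"
    then have "\<xi> t (f t') = 1" using xf[of t t] by simp
    then show "t = t'" using xf[OF t(1,2)] by (auto split: if_splits)
  qed
  show dis: "S \<inter> f ` T = {}"
  proof (rule ccontr)
    assume "S \<inter> f ` T \<noteq> {}"
    then obtain t where t: "t \<in> T" "f t \<in> S" by auto
    then show False using xS[OF t(1) span_base[OF t(2)]] xf[OF t(1) t(1)] by simp
  qed
  define \<eta> where "\<eta> b y = (if b \<in> S then \<xi> b y - (\<Sum>t\<in>T. \<xi> b (f t - t) * \<xi> t y) else \<xi> (inv_into T f b) y)" for b y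
  have ef: "\<eta> (f t) = \<xi> t" if "t \<in> T" for t
  proof -
    have "f t \<notin> S" using that dis by blast
    then show ?thesis using inv_into_f_f[OF inj that] by (simp add: \<eta>_def[abs_def])
  qed
  have "dual_family M (S \<union> f ` T) \<eta>"
    unfolding dual_family_def
  proof (intro conjI ballI)
    fix b assume b: "b \<in> S \<union> f ` T"
    show "linear_on M (\<eta> b)"
    proof (cases "b \<in> S")
      case True
      have "linear_on M (\<lambda>y. \<xi> b y - (\<Sum>t\<in>T. \<xi> b (f t - t) * \<xi> t y))"
        unfolding linear_on_def
      proof (intro conjI ballI allI)
        fix x y assume "x \<in> M" "y \<in> M"
        then show "\<xi> b (x + y) - (\<Sum>t\<in>T. \<xi> b (f t - t) * \<xi> t (x + y)) =
          \<xi> b x - (\<Sum>t\<in>T. \<xi> b (f t - t) * \<xi> t x) + (\<xi> b y - (\<Sum>t\<in>T. \<xi> b (f t - t) * \<xi> t y))"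
          using True linear_on_add[OF xl] by (simp add: distrib_left sum.distrib)
      next
        fix r x assume "x \<in> M"
        then show "\<xi> b (r \<odot> x) - (\<Sum>t\<in>T. \<xi> b (f t - t) * \<xi> t (r \<odot> x)) =
          r * (\<xi> b x - (\<Sum>t\<in>T. \<xi> b (f t - t) * \<xi> t x))"
          using True linear_on_scale[OF xl] by (simp add: right_diff_distrib sum_distrib_left mult.left_commute)
      qed
      then show ?thesis using True by (simp add: \<eta>_def[abs_def])
    next
      case False
      then show ?thesis using b ef xl by auto
    qed
    fix b' assume b': "b' \<in> S \<union> f ` T"
    show "\<eta> b b' = (if b' = b then 1 else 0)"
    proof (cases "b \<in> S")
      case bS: True
      show ?thesis
      proof (cases "b' \<in> S")
        case True
        then have "(\<Sum>t\<in>T. \<xi> b (f t - t) * \<xi> t b') = (\<Sum>t\<in>T. 0)" using xS span_base by (intro sum.cong) auto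
        then show ?thesis using bS True xd[of b b'] by (simp add: \<eta>_def)
      next
        case False
        then obtain t' where t': "t' \<in> T" "b' = f t'" using b' by auto
        have "(\<Sum>t\<in>T. \<xi> b (f t - t) * \<xi> t b') = (\<Sum>t\<in>T. if t = t' then \<xi> b (f t' - t') else 0)"
          using xf t' by (intro sum.cong) auto
        also have "\<dots> = \<xi> b (f t' - t')" using fin(2) t'(1) by simp
        also have "\<dots> = \<xi> b (f t') - \<xi> b t'"
          using bS t'(1) fin(4) by (intro linear_on_diff[OF xl M fM]) auto
        finally have "\<eta> b b' = \<xi> b t'" using bS t'(2) by (simp add: \<eta>_def)
        also have "\<dots> = 0" using xd[of b t'] bS t'(1) B(2) by auto
        finally show ?thesis using bS False by auto
      qed
    next
      case False
      then obtain t where t: "t \<in> T" "b = f t" using b by auto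
      show ?thesis
      proof (cases "b' \<in> S")
        case True
        then show ?thesis using t ef xS[OF t(1) span_base[OF True]] False by auto
      next
        case False
        then obtain t' where "t' \<in> T" "b' = f t'" using b' by auto
        then show ?thesis using t ef xf inj_on_eq_iff[OF inj] by auto
      qed
    qed
  qed (use fin fM in auto)
  then have um: "unimod M (S \<union> f ` T)" by (auto simp: unimod_def)
  let ?S = "span (S \<union> f ` T)"
  have "t \<in> ?S" if "t \<in> T" for t
  proof -
    have "f t \<in> ?S" by (rule span_base) (use that in auto)
    moreover have "f t - t \<in> ?S" using f[OF that] span_mono[of S "S \<union> f ` T"] by auto
    ultimately have "f t - (f t - t) \<in> ?S" by (rule span_diff)
    then show ?thesis by simp
  qed
  then have "S \<union> T \<subseteq> ?S" using span_base by blast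
  then have "M \<subseteq> ?S" using B(1) span_minimal[OF _ subspace_span] unfolding basis_of_def by blast
  then show "basis_of M (S \<union> f ` T)" using um by (simp add: basis_of_def)
qed

lemma basis_exchange:
  assumes M: "subspace M" and B: "basis_of M B" "x \<in> B" and y: "y - x \<in> span (B - {x})"
  shows "basis_of M (insert y (B - {x}))" "y \<notin> B - {x}" "card (insert y (B - {x})) = card B"
proof -
  have "B - {x} \<union> {x} = B" using B(2) by auto
  then have b: "basis_of M (B - {x} \<union> {x})" using B(1) by simp
  note sh = basis_shear[OF M b, of "\<lambda>_. y"]
  show "basis_of M (insert y (B - {x}))" "y \<notin> B - {x}" using sh y by auto
  then show "card (insert y (B - {x})) = card B"
    using B unimod_finite[of M B] by (simp add: basis_of_def card_Suc_Diff1 del: card_Diff_insert)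
qed

lemma span_coefficients:
  assumes "finite B" "y \<in> span B" obtains a where "y = (\<Sum>b\<in>B. a b \<odot> b)"
  using assms span_finite[OF assms(1)] by auto

text \<open>A unimodular set of this size need not be completable to a basis. Complete all of it but one
  vector \<open>v\<close> to a basis \<open>e\<^sub>1, \<dots>, e\<^sub>m, w\<^sub>1, \<dots>, w\<^sub>r\<close>; a shear of the
  \<open>w\<^sub>j\<close> achieves \<open>v = e\<^sub>1 + \<Sum> a\<^sub>j w\<^sub>j\<close> with \<open>\<Sum> b\<^sub>j a\<^sub>j = 1\<close>,
  and the cone point is \<open>w\<^sub>1 - b\<^sub>1 (e\<^sub>2 + \<dots> + e\<^sub>m)\<close>.\<close>

lemma boundary_coned_off:
  assumes k: "k \<ge> 2" "SR TYPE('a) k" and M: "free n M" and t: "unimod M \<tau>" "\<tau> \<noteq> {}" "card \<tau> + k = n + 2"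
  shows "\<exists>u. \<forall>\<rho>. \<rho> \<subset> \<tau> \<longrightarrow> partial_basis n M (insert u \<rho>)"
proof -
  have sub: "subspace M" using M by (auto simp: free_def frame_def)
  have ft: "finite \<tau>" using unimod_finite[OF t(1)] .
  obtain v where v: "v \<in> \<tau>" using t(2) by auto
  define S where "S = \<tau> - {v}"
  have tS: "\<tau> = insert v S" "v \<notin> S" "finite S" using v ft by (auto simp: S_def)
  have "partial_basis n M S"
    by (rule unimod_imp_partial_basis[OF _ k(2) M]) (use k(1) t tS unimod_subset[OF t(1), of S] in \<open>auto simp: card_insert_if\<close>)
  then obtain B where B: "basis_of M B" "card B = n" "S \<subseteq> B" by (auto simp: partial_basis_def)
  have fB: "finite B" "B \<subseteq> M" using B(1) unimod_finite unimod_carrier by (auto simp: basis_of_def)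
  define W where "W = B - S"
  have SW: "S \<union> W = B" "S \<inter> W = {}" "finite W" using B(3) fB by (auto simp: W_def)
  have "card W = n - card S" unfolding W_def using card_Diff_subset[OF tS(3) B(3)] B(2) by simp
  then have "card W > 0" using t(3) k(1) tS by simp
  then obtain w1 where w1: "w1 \<in> W" by (auto simp: card_gt_0_iff)
  have span_S: "x \<in> span S" if "x \<in> S" for x using that by (rule span_base)
  show ?thesis
  proof (cases "S = {}")
    \<comment> \<open>Here \<open>\<tau>\<close> is \<open>{v}\<close> and only the empty
      \<open>\<rho>\<close> occurs, so any vector of the basis will do.\<close>
    case True
    then show ?thesis
      using B w1 tS by (intro exI[of _ w1]) (auto simp: partial_basis_def W_def)
  next
    case False
    then obtain e1 where e1: "e1 \<in> S" by auto
    obtain \<xi> where x: "dual_family M \<tau> \<xi>" using t(1) by (auto simp: unimod_def)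
    define \<beta> where "\<beta> = \<xi> v"
    have \<beta>: "linear_on M \<beta>" "\<beta> v = 1" "\<And>s. s \<in> S \<Longrightarrow> \<beta> s = 0"
      using x tS unfolding dual_family_def \<beta>_def by auto
    have vM: "v \<in> M" using unimod_carrier[OF t(1)] v by auto
    then have "v \<in> span B" using B(1) by (auto simp: basis_of_def)
    then obtain a where a: "v = (\<Sum>b\<in>B. a b \<odot> b)" using span_coefficients[OF fB(1)] by metis
    define y where "y = (\<Sum>b\<in>S. a b \<odot> b)"
    have vy: "v = y + (\<Sum>w\<in>W. a w \<odot> w)"
      unfolding a y_def SW(1)[symmetric] by (rule sum.union_disjoint[OF tS(3) SW(3,2)])
    have yS: "y \<in> span S" unfolding y_def by (intro span_sum span_scale span_base)
    have "\<beta> v = (\<Sum>b\<in>B. a b * \<beta> b)"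
      unfolding a by (rule linear_on_lincomb[OF \<beta>(1) sub]) (use fB in auto)
    also have "\<dots> = (\<Sum>b\<in>S. a b * \<beta> b) + (\<Sum>w\<in>W. a w * \<beta> w)"
      unfolding SW(1)[symmetric] by (rule sum.union_disjoint[OF tS(3) SW(3,2)])
    finally have ab: "(\<Sum>w\<in>W. a w * \<beta> w) = 1" using \<beta>(2,3) by simp
    \<comment> \<open>As the numbers \<open>a w * \<beta> w\<close> sum to 1, this shear changes the
      sum of the \<open>a w \<odot> w\<close> by exactly \<open>z\<close>. Hence the
      \<open>S\<close>-part of \<open>v\<close> relative to the sheared basis can be prescribed
      through \<open>z\<close>.\<close>
    define f where "f z w = w + \<beta> w \<odot> z" for z w
    have sumf: "(\<Sum>w\<in>W. a w \<odot> f z w) = (\<Sum>w\<in>W. a w \<odot> w) + z" for z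
    proof -
      have "(\<Sum>w\<in>W. a w \<odot> f z w) = (\<Sum>w\<in>W. a w \<odot> w) + (\<Sum>w\<in>W. (a w * \<beta> w) \<odot> z)"
        by (simp add: f_def scale_right_distrib sum.distrib)
      also have "(\<Sum>w\<in>W. (a w * \<beta> w) \<odot> z) = z" by (simp add: scale_sum_left[symmetric] ab)
      finally show ?thesis .
    qed
    have sh: "basis_of M (S \<union> f z ` W)" "inj_on (f z) W" "S \<inter> f z ` W = {}" if "z \<in> span S" for z
    proof -
      have "f z w - w \<in> span S" for w using span_scale[OF that] by (simp add: f_def)
      then show "basis_of M (S \<union> f z ` W)" "inj_on (f z) W" "S \<inter> f z ` W = {}"
        using basis_shear[OF sub, of S W "f z"] B(1) SW(1,2) by auto
    qed
    have cardf: "card (S \<union> f z ` W) = n" if z: "z \<in> span S" for z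
    proof -
      have "card (S \<union> f z ` W) = card S + card W"
        using card_Un_disjoint[OF tS(3) _ sh(3)[OF z]] card_image[OF sh(2)[OF z]] SW(3) by simp
      also have "\<dots> = card B" using card_Un_disjoint[OF tS(3) SW(3,2)] SW(1) by simp
      finally show ?thesis using B(2) by simp
    qed
    define E where "E = S - {e1}"
    \<comment> \<open>Expanded, \<open>u\<close> is
      \<open>w1 + \<beta> w1 \<odot> (y - (\<Sum>s\<in>S. s))\<close>. This is symmetric in the
      members of \<open>S\<close>, so one \<open>u\<close> can serve for every deleted
      vector.\<close>
    define u where "u = f (y - e1) w1 - \<beta> w1 \<odot> (\<Sum>s\<in>E. s)"
    have zS: "y - e1 \<in> span S" using yS span_S[OF e1] by (rule span_diff)
    have v1: "v = e1 + (\<Sum>w\<in>W. a w \<odot> f (y - e1) w)" unfolding sumf vy by simp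
    let ?B1 = "S \<union> f (y - e1) ` W" and ?w = "f (y - e1) w1"
    have wB1: "?w \<in> ?B1" "?w \<notin> S" using w1 sh(3)[OF zS] by auto
    have "u - ?w \<in> span (?B1 - {?w})"
    proof -
      have "u - ?w = - (\<beta> w1 \<odot> (\<Sum>s\<in>E. s))" by (simp add: u_def)
      also have "\<dots> \<in> span (?B1 - {?w})"
        using wB1 by (intro span_neg span_scale span_sum span_base) (auto simp: E_def)
      finally show ?thesis .
    qed
    note B2 = basis_exchange[OF sub sh(1)[OF zS] wB1(1) this]
    let ?B2 = "insert u (?B1 - {?w})"
    have c1: "partial_basis n M (insert u S)"
      unfolding partial_basis_def
      by (intro exI[of _ ?B2]) (use B2 cardf[OF zS] wB1 in auto)
    have uS: "u \<notin> S" using B2(2) wB1 by auto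
    have e1B2: "e1 \<in> ?B2" using e1 wB1 by auto
    \<comment> \<open>The coefficient of \<open>e1\<close> in \<open>v\<close> is 1, and the sheared
      \<open>w1\<close> can be rewritten through \<open>u\<close> and \<open>E\<close>, so
      \<open>v\<close> may replace \<open>e1\<close>.\<close>
    have "v - e1 \<in> span (?B2 - {e1})"
    proof -
      have ub: "u \<in> ?B2 - {e1}" using uS e1 by auto
      have "u + \<beta> w1 \<odot> (\<Sum>s\<in>E. s) \<in> span (?B2 - {e1})"
        using ub wB1 by (intro span_add span_scale span_sum span_base) (auto simp: E_def)
      then have fw: "?w \<in> span (?B2 - {e1})" by (simp add: u_def)
      have "f (y - e1) w \<in> span (?B2 - {e1})" if "w \<in> W" for w
      proof (cases "f (y - e1) w = ?w")
        case True then show ?thesis using fw by simp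
      next
        case False
        have "f (y - e1) w \<in> f (y - e1) ` W" using that by simp
        then have "f (y - e1) w \<noteq> e1" using sh(3)[OF zS] e1 unfolding disjoint_iff by metis
        then show ?thesis using False that by (intro span_base) auto
      qed
      then show ?thesis unfolding v1 by (simp add: span_sum span_scale)
    qed
    note B3 = basis_exchange[OF sub B2(1) e1B2 this]
    have c2: "partial_basis n M (insert u (insert v E))"
      unfolding partial_basis_def
      by (intro exI[of _ "insert v (?B2 - {e1})"]) (use B3 B2(3) cardf[OF zS] wB1 uS e1 in \<open>auto simp: E_def\<close>)
    have c3: "partial_basis n M (insert u (insert v (S - {e})))" if e: "e \<in> E" for e
    proof -
      \<comment> \<open>To delete \<open>e\<close> a shear is needed that leaves coefficient 1 at
        \<open>e\<close> as well: now \<open>v\<close> is \<open>e1 + e\<close> plus a combination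
        of the sheared \<open>W\<close>, so \<open>v\<close> may replace \<open>e\<close>.\<close>
      define z where "z = y - e1 - e"
      have eS: "e \<in> S" "e \<noteq> e1" using e by (auto simp: E_def)
      have zz: "z \<in> span S" unfolding z_def using zS span_S[OF eS(1)] by (rule span_diff)
      let ?C = "S \<union> f z ` W" and ?h = "f z w1"
      have v2: "v - e = e1 + (\<Sum>w\<in>W. a w \<odot> f z w)" unfolding sumf vy z_def by simp
      have fS: "f z w \<notin> S" if "w \<in> W" for w using sh(3)[OF zz] that by auto
      have "v - e \<in> span (?C - {e})"
        unfolding v2 using e1 eS fS by (intro span_add span_sum span_scale span_base) auto
      note C2 = basis_exchange[OF sub sh(1)[OF zz] UnI1[OF eS(1)] this]
      let ?C2 = "insert v (?C - {e})"
      have hC: "?h \<in> ?C - {e}" using w1 fS[OF w1] eS by auto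
      then have vh: "v \<noteq> ?h" using C2(2) by auto
      have "u - ?h = - (\<beta> w1 \<odot> (\<Sum>s\<in>E - {e}. s))"
      proof -
        have "(\<Sum>s\<in>E. s) = e + (\<Sum>s\<in>E - {e}. s)" using tS(3) e by (intro sum.remove) (auto simp: E_def)
        then show ?thesis
          by (simp add: u_def f_def z_def scale_right_distrib scale_right_diff_distrib)
      qed
      also have "\<dots> \<in> span (?C2 - {?h})"
        using fS[OF w1] by (intro span_neg span_scale span_sum span_base) (auto simp: E_def)
      finally have uh: "u - ?h \<in> span (?C2 - {?h})" .
      have "?h \<in> ?C2" using hC by auto
      note C3 = basis_exchange[OF sub C2(1) this uh]
      show ?thesis unfolding partial_basis_def
        by (intro exI[of _ "insert u (?C2 - {?h})"])
          (use C3 C2(3) cardf[OF zz] fS[OF w1] vh in auto)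
    qed
    have "partial_basis n M (insert u \<rho>)" if r: "\<rho> \<subset> \<tau>" for \<rho>
    proof -
      obtain x where x: "x \<in> \<tau>" "\<rho> \<subseteq> \<tau> - {x}" using r by auto
      then consider "x = v" | "x = e1" | "x \<in> E" using tS by (auto simp: E_def)
      then have "partial_basis n M (insert u (\<tau> - {x}))"
      proof cases
        case 1 then show ?thesis using c1 tS by simp
      next
        case 2
        then have "\<tau> - {x} = insert v E" using tS e1 by (auto simp: E_def)
        then show ?thesis using c2 by simp
      next
        case 3
        then have "\<tau> - {x} = insert v (S - {x})" using tS by (auto simp: E_def)
        then show ?thesis using c3[OF 3] by simp
      qed
      then show ?thesis by (rule partial_basis_subset) (use x in auto)
    qed
    then show ?thesis by blast
  qed
qed

text \<open>For \<open>k = 2\<close>, a subset of \<open>n - 1\<close> members is completed to a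
  basis by a single vector \<open>w\<close>. A further member \<open>v\<close> has a unit as its
  coefficient at \<open>w\<close>, witnessed by the functional dual to \<open>v\<close>, so
  \<open>v\<close> replaces \<open>w\<close>. As the result spans, a functional dual to yet another
  member would vanish on all of \<open>M\<close>.\<close>

lemma unimod_sr2:
  assumes sr: "SR TYPE('a) 2" and M: "free n M" "n \<ge> 1" and t: "unimod M \<tau>"
  shows "card \<tau> \<le> n" "partial_basis n M \<tau>"
proof -
  have sub: "subspace M" using M by (auto simp: free_def frame_def)
  have ft: "finite \<tau>" using unimod_finite[OF t] .
  have "card \<tau> \<le> n \<and> partial_basis n M \<tau>"
  proof (cases "card \<tau> \<le> n - 1")
    case True
    then show ?thesis using unimod_imp_partial_basis[OF _ sr M(1) t] M(2) by simp
  next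
    case False
    then obtain \<rho> where r: "\<rho> \<subseteq> \<tau>" "card \<rho> = n - 1" "finite \<rho>"
      using obtain_subset_with_card_n[of "n - 1" \<tau>] by (metis nat_le_linear)
    have rt: "\<rho> \<noteq> \<tau>" using False r by auto
    then obtain v where v: "v \<in> \<tau>" "v \<notin> \<rho>" using r(1) by auto
    obtain \<xi> where x: "dual_family M \<tau> \<xi>" using t by (auto simp: unimod_def)
    have xl: "\<And>b. b \<in> \<tau> \<Longrightarrow> linear_on M (\<xi> b)" and tM: "\<tau> \<subseteq> M"
      and xd: "\<And>b b'. b \<in> \<tau> \<Longrightarrow> b' \<in> \<tau> \<Longrightarrow> \<xi> b b' = (if b' = b then 1 else 0)"
      using x by (auto simp: dual_family_def)
    have "partial_basis n M \<rho>"
      by (rule unimod_imp_partial_basis[OF _ sr M(1) unimod_subset[OF t r(1)]]) (use r M(2) in auto)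
    then obtain B where B: "unimod M B" "M \<subseteq> span B" "card B = n" "\<rho> \<subseteq> B"
      by (auto simp: partial_basis_def basis_of_def)
    have "card (B - \<rho>) = 1" using card_Diff_subset[OF r(3) B(4)] B(3) r(2) M(2) by simp
    then obtain w where "B - \<rho> = {w}" by (auto simp: card_1_singleton_iff)
    then have w: "B = insert w \<rho>" "w \<notin> \<rho>" using B(4) by auto
    have wM: "w \<in> M" using unimod_carrier[OF B(1)] w by auto
    have "v \<in> span B" using B(2) tM v by auto
    then obtain a where a: "v = (\<Sum>b\<in>B. a b \<odot> b)" using span_coefficients[OF unimod_finite[OF B(1)]] by metis
    define y where "y = (\<Sum>b\<in>\<rho>. a b \<odot> b)"
    have vy: "v = a w \<odot> w + y" unfolding a y_def w(1) using w(2) r(3) by simp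
    have yS: "y \<in> span \<rho>" unfolding y_def by (intro span_sum span_scale span_base)
    have yM: "y \<in> M" using span_minimal[OF _ sub, of \<rho>] yS r(1) tM by auto
    have "\<xi> v y = 0"
      by (rule linear_on_span_eq_0[OF xl[OF v(1)] sub _ _ yS]) (use r(1) tM xd v in auto)
    moreover have "\<xi> v v = a w * \<xi> v w + \<xi> v y"
      using linear_on_add[OF xl[OF v(1)] subspace_scale[OF sub wM] yM] linear_on_scale[OF xl[OF v(1)] wM] vy by metis
    ultimately have one: "a w * \<xi> v w = 1" using xd[of v v] v by simp
    have vS: "insert v \<rho> \<subseteq> span (insert v \<rho>)" by (rule span_superset)
    have "\<xi> v w \<odot> (v - y) = w"
      using one unfolding vy by (simp add: mult.commute)
    moreover have "\<xi> v w \<odot> (v - y) \<in> span (insert v \<rho>)"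
      using vS yS span_mono[of \<rho> "insert v \<rho>"] by (intro span_scale span_diff) auto
    ultimately have "B \<subseteq> span (insert v \<rho>)" using w vS by auto
    then have MS: "M \<subseteq> span (insert v \<rho>)" using B(2) span_minimal[OF _ subspace_span] by blast
    have "\<tau> = insert v \<rho>"
    proof (rule ccontr)
      assume "\<tau> \<noteq> insert v \<rho>"
      then obtain v' where v': "v' \<in> \<tau>" "v' \<notin> insert v \<rho>" using v(1) r(1) by auto
      have "\<xi> v' v' = 0"
        by (rule linear_on_span_eq_0[OF xl[OF v'(1)] sub, of "insert v \<rho>"]) (use r(1) tM xd v v' MS in auto)
      then show False using xd[of v' v'] v' by simp
    qed
    then show ?thesis
      using MS t r v M(2) unfolding partial_basis_def basis_of_def by (intro conjI exI[of _ \<tau>]) auto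
  qed
  then show "card \<tau> \<le> n" "partial_basis n M \<tau>" by auto
qed

end

section \<open>Coordinate spaces\<close>

definition vscale :: "'a::comm_ring_1 \<Rightarrow> (nat \<Rightarrow> 'a) \<Rightarrow> nat \<Rightarrow> 'a" where
  "vscale c v = (\<lambda>i. c * v i)"

interpretation vec: unimodular "vscale :: 'a::comm_ring_1 \<Rightarrow> (nat \<Rightarrow> 'a) \<Rightarrow> nat \<Rightarrow> 'a"
  by unfold_locales (auto simp: vscale_def algebra_simps)

lemma sum_fun_apply: "(\<Sum>b\<in>B. f b) i = (\<Sum>b\<in>B. (f b :: nat \<Rightarrow> 'a::comm_ring_1) i)"
  by (induction B rule: infinite_finite_induct) auto

lemma lincomb_eq: "lincomb c B = (\<Sum>b\<in>B. vscale (c b) b)"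
  by (rule ext) (simp add: lincomb_def sum_fun_apply vscale_def)

lemma subspace_vecs: "vec.subspace (vecs n)"
  by (auto simp: vec.subspace_def vecs_def vscale_def)

lemma free_vecs: "vec.free n (vecs n :: (nat \<Rightarrow> 'a::comm_ring_1) set)"
proof -
  have "vec.frame n (vecs n) (\<lambda>i j. if j = i then 1 else 0 :: 'a) (\<lambda>i y. y i)"
    unfolding vec.frame_def
  proof (intro conjI ballI allI impI)
    fix y :: "nat \<Rightarrow> 'a" assume y: "y \<in> vecs n"
    show "y = (\<Sum>i<n. vscale (y i) (\<lambda>j. if j = i then 1 else 0))"
    proof
      fix j
      have "(\<Sum>i<n. vscale (y i) (\<lambda>j. if j = i then 1 else 0)) j = (\<Sum>i<n. if i = j then y j else 0)"
        unfolding sum_fun_apply by (intro sum.cong) (auto simp: vscale_def)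
      also have "\<dots> = y j" using y by (auto simp: vecs_def)
      finally show "y j = (\<Sum>i<n. vscale (y i) (\<lambda>j. if j = i then 1 else 0)) j" by simp
    qed
  next
    show "vec.subspace (vecs n :: (nat \<Rightarrow> 'a) set)" by (rule subspace_vecs)
  qed (auto simp: vec.linear_on_def vecs_def vscale_def)
  then show ?thesis by (auto simp: vec.free_def)
qed

lemma unit_vector_notin_vecs: "(\<lambda>j. if j = n then 1 else 0 :: 'a::comm_ring_1) \<notin> vecs n"
  by (auto simp: vecs_def intro!: exI[of _ n])

text \<open>Uniqueness of coefficients makes the chosen ones linear, hence a dual family;
  conversely, dual functionals read off the coefficients and force independence.\<close>

lemma is_basis_iff: "is_basis n B \<longleftrightarrow> vec.basis_of (vecs n) (B :: (nat \<Rightarrow> 'a::comm_ring_1) set)"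
proof
  assume b: "is_basis n B"
  then have B: "finite B" "B \<subseteq> vecs n" "\<And>w. w \<in> vecs n \<Longrightarrow> \<exists>c. w = lincomb c B"
    "\<And>c. lincomb c B = (\<lambda>i. 0) \<Longrightarrow> \<forall>b\<in>B. c b = 0"
    by (auto simp: is_basis_def)
  have uniq: "\<forall>b\<in>B. c b = c' b" if "lincomb c B = lincomb c' B" for c c'
  proof -
    have "lincomb (\<lambda>b. c b - c' b) B = (\<lambda>i. 0)"
    proof
      fix i show "lincomb (\<lambda>b. c b - c' b) B i = 0"
        using fun_cong[OF that, of i] by (simp add: lincomb_def left_diff_distrib sum_subtractf)
    qed
    then show ?thesis using B(4) by fastforce
  qed
  define co where "co w = (SOME c. w = lincomb c B)" for w
  have co: "w = lincomb (co w) B" if "w \<in> vecs n" for w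
    unfolding co_def using someI_ex[OF B(3)[OF that]] .
  have coq: "co w b = c b" if "w = lincomb c B" "w \<in> vecs n" "b \<in> B" for w c b
    using uniq[of "co w" c] co[OF that(2)] that by metis
  have "vec.dual_family (vecs n) B (\<lambda>b w. co w b)"
    unfolding vec.dual_family_def vec.linear_on_def
  proof (intro conjI ballI allI)
    fix b x y :: "nat \<Rightarrow> 'a" assume b: "b \<in> B" and x: "x \<in> vecs n" "y \<in> vecs n"
    have "x + y = lincomb (\<lambda>b. co x b + co y b) B"
    proof
      fix i show "(x + y) i = lincomb (\<lambda>b. co x b + co y b) B i"
        using fun_cong[OF co[OF x(1)], of i] fun_cong[OF co[OF x(2)], of i]
        by (simp add: lincomb_def distrib_right sum.distrib)
    qed
    then show "co (x + y) b = co x b + co y b"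
      using coq[of "x + y"] b vec.subspace_add[OF subspace_vecs x] by blast
  next
    fix b x :: "nat \<Rightarrow> 'a" and r assume b: "b \<in> B" and x: "x \<in> vecs n"
    have "vscale r x = lincomb (\<lambda>b. r * co x b) B"
    proof
      fix i show "vscale r x i = lincomb (\<lambda>b. r * co x b) B i"
        using fun_cong[OF co[OF x], of i]
        by (simp add: lincomb_def vscale_def sum_distrib_left mult.assoc)
    qed
    then show "co (vscale r x) b = r * co x b"
      using coq[of "vscale r x"] b vec.subspace_scale[OF subspace_vecs x] by blast
  next
    fix b b' :: "nat \<Rightarrow> 'a" assume b: "b \<in> B" "b' \<in> B"
    have "b' = lincomb (\<lambda>d. if b' = d then 1 else 0) B"
    proof
      fix i
      have "lincomb (\<lambda>d. if b' = d then 1 else 0) B i = (\<Sum>d\<in>B. if d = b' then b' i else 0)"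
        unfolding lincomb_def by (intro sum.cong) auto
      then show "b' i = lincomb (\<lambda>d. if b' = d then 1 else 0) B i" using B(1) b(2) by simp
    qed
    then show "co b' b = (if b' = b then 1 else 0)" using coq[of b'] b B(2) by blast
  qed (use B in auto)
  moreover have "vecs n \<subseteq> vec.span B"
    using B(3) unfolding lincomb_eq vec.span_finite[OF B(1)] by blast
  ultimately show "vec.basis_of (vecs n) B" by (auto simp: vec.basis_of_def vec.unimod_def)
next
  assume b: "vec.basis_of (vecs n) B"
  then obtain \<xi> where x: "vec.dual_family (vecs n) B \<xi>" and sp: "vecs n \<subseteq> vec.span B"
    by (auto simp: vec.basis_of_def vec.unimod_def)
  have B: "finite B" "B \<subseteq> vecs n" using x by (auto simp: vec.dual_family_def)
  show "is_basis n B"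
    unfolding is_basis_def
  proof (intro conjI ballI allI impI)
    show "\<exists>c. w = lincomb c B" if "w \<in> vecs n" for w
      using sp that unfolding vec.span_finite[OF B(1)] lincomb_eq by blast
    fix c b assume c: "lincomb c B = (\<lambda>i. 0)" and b: "b \<in> B"
    have l: "vec.linear_on (vecs n) (\<xi> b)" using x b by (auto simp: vec.dual_family_def)
    have "\<xi> b (lincomb c B) = (\<Sum>d\<in>B. c d * \<xi> b d)"
      unfolding lincomb_eq by (rule vec.linear_on_lincomb[OF l subspace_vecs]) (use B in auto)
    also have "\<dots> = (\<Sum>d\<in>B. if d = b then c b else 0)"
      by (intro sum.cong) (use x b in \<open>auto simp: vec.dual_family_def\<close>)
    also have "\<dots> = c b" using B(1) b by simp
    finally show "c b = 0" using vec.linear_on_0[OF l subspace_vecs] c by (simp add: zero_fun_def)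
  qed (use B in auto)
qed

section \<open>The partial basis complex of a coordinate space\<close>

lemma partial_basis_complex_unimod:
  "\<sigma> \<in> partial_basis_complex n \<Longrightarrow> \<sigma> \<noteq> {} \<and> vec.unimod (vecs n) \<sigma>"
  by (auto simp: partial_basis_complex_def is_basis_iff vec.basis_of_def intro: vec.unimod_subset)

lemma partial_basis_complexI:
  assumes "vec.partial_basis n (vecs n) \<sigma>" "\<sigma> \<noteq> {}" shows "\<sigma> \<in> partial_basis_complex n"
proof -
  obtain B where "vec.basis_of (vecs n) B" "\<sigma> \<subseteq> B" using assms(1) by (auto simp: vec.partial_basis_def)
  then show ?thesis
    using assms(2) vec.unimod_finite[of "vecs n" B] finite_subset
    by (auto simp: partial_basis_complex_def is_basis_iff vec.basis_of_def)
qed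

lemma abstract_complex_partial_basis_complex: "abstract_complex (partial_basis_complex n)"
  by (auto simp: abstract_complex_def partial_basis_complex_def intro: finite_subset)

lemma cx_connected_partial_basis_complex:
  assumes k: "k \<ge> 2" "SR TYPE('a::comm_ring_1) k"
  shows "cx_connected (int n - int k) (partial_basis_complex n :: (nat \<Rightarrow> 'a) set set)"
proof -
  let ?P = "partial_basis_complex n :: (nat \<Rightarrow> 'a) set set" and ?M = "vecs n :: (nat \<Rightarrow> 'a) set"
  \<comment> \<open>\<open>?B\<close> is the part of \<open>?P\<close> inside the truncated complex
    \<open>?U\<close>; the larger simplices of \<open>?P\<close> are attached at the end.\<close>
  let ?B = "{\<tau> \<in> ?P. card \<tau> + k \<le> n + 2}" and ?U = "vec.unimod_complex k n ?M" and ?d = "int n - int k"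
  have Pc: "abstract_complex ?P" by (rule abstract_complex_partial_basis_complex)
  have b: "(\<lambda>j. if j = n then 1 else 0) \<notin> ?M" by (rule unit_vector_notin_vecs)
  have U: "cconn ?d ?U"
    using vec.link_conn_all[OF k, of n] free_vecs b vec.unimod_empty[of ?M]
    unfolding vec.link_conn_def by (metis UNIV_I card.empty diff_0_right link_empty of_nat_0)
  have Bc: "abstract_complex ?B"
    unfolding abstract_complex_def
  proof (intro ballI conjI allI impI)
    fix \<sigma> assume s: "\<sigma> \<in> ?B"
    then show f: "finite \<sigma>" "\<sigma> \<noteq> {}" using abstract_complexD[OF Pc, of \<sigma>] by auto
    fix \<tau> assume t: "\<tau> \<subseteq> \<sigma> \<and> \<tau> \<noteq> {}"
    then have "card \<tau> \<le> card \<sigma>" using f(1) by (simp add: card_mono)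
    then show "\<tau> \<in> ?B" using s t abstract_complexD(3)[OF Pc, of \<sigma> \<tau>] by auto
  qed
  have BU: "?B \<subseteq> ?U" using partial_basis_complex_unimod by (auto simp: vec.unimod_complex_def)
  have small: "\<sigma> \<in> ?B" if "vec.unimod ?M \<sigma>" "\<sigma> \<noteq> {}" "card \<sigma> + k \<le> n + 1" for \<sigma>
    using partial_basis_complexI[OF vec.unimod_imp_partial_basis[OF _ k(2) free_vecs that(1,3)] that(2)] k(1) that(3) by auto
  have conn: "cconn ?d ?B"
  proof (rule cconn_delete_simplices[OF Bc vec.abstract_complex_unimod_complex BU U])
    fix \<tau> assume t: "\<tau> \<in> ?U - ?B"
    then have t': "vec.unimod ?M \<tau>" "\<tau> \<noteq> {}" "card \<tau> + k \<le> n + 2" by (auto simp: vec.unimod_complex_def)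
    have c: "card \<tau> + k = n + 2" using small[OF t'(1,2)] t t'(3) by fastforce
    have ft: "finite \<tau>" using vec.unimod_finite[OF t'(1)] .
    have "simplex_boundary \<tau> \<subseteq> ?B"
    proof
      fix \<rho> assume "\<rho> \<in> simplex_boundary \<tau>"
      then have r: "\<rho> \<subset> \<tau>" "\<rho> \<noteq> {}" by (auto simp: simplex_boundary_def)
      then have "card \<rho> < card \<tau>" using ft by (simp add: psubset_card_mono)
      then show "\<rho> \<in> ?B" using r c vec.unimod_subset[OF t'(1), of \<rho>] by (intro small) auto
    qed
    moreover obtain u where u: "\<And>\<rho>. \<rho> \<subset> \<tau> \<Longrightarrow> vec.partial_basis n ?M (insert u \<rho>)"
      using vec.boundary_coned_off[OF k free_vecs t'(1,2) c] by blast
    have "insert u \<rho> \<in> ?B" if r: "\<rho> \<subset> \<tau>" for \<rho>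
    proof -
      have "card \<rho> < card \<tau>" using ft r by (simp add: psubset_card_mono)
      moreover have "finite \<rho>" using ft r by (meson finite_subset psubset_imp_subset)
      ultimately have "card (insert u \<rho>) \<le> card \<tau>" by (simp add: card_insert_if)
      then show ?thesis using partial_basis_complexI[OF u[OF r]] c by simp
    qed
    ultimately show "simplex_boundary \<tau> \<subseteq> ?B \<and> (\<exists>u. \<forall>\<rho>. \<rho> \<subset> \<tau> \<longrightarrow> insert u \<rho> \<in> ?B)" by blast
  qed
  \<comment> \<open>The unit vector at place \<open>n\<close> lies outside \<open>vecs n\<close>, so
    it is a fresh vertex for attaching the simplices with more than \<open>n + 2 - k\<close>
    members.\<close>
  have "(\<lambda>j. if j = n then 1 else 0) \<notin> \<Union>?P"
    using b partial_basis_complex_unimod vec.unimod_carrier by blast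
  then have "cconn ?d ?P"
    by (rule cconn_add_large_simplices[OF Bc conn Pc, rotated 2]) auto
  then show ?thesis by (rule cconn_imp_cx_connected[OF Pc])
qed

text \<open>For \<open>k = 2\<close> unimodular sets and partial bases coincide, so the links are
  covered by \<open>link_conn_all\<close> and only dimensions remain to be counted.\<close>

theorem mainTheorem10:
  fixes k n :: nat
  assumes "k \<ge> 2" and "SR TYPE('a::comm_ring_1) k" and "n \<ge> 1"
  shows "cx_connected (int n - int k) (partial_basis_complex n :: (nat \<Rightarrow> 'a) set set)
     \<and> (k = 2 \<longrightarrow> cohen_macaulay (int n - 1) (partial_basis_complex n :: (nat \<Rightarrow> 'a) set set))"
proof (intro conjI impI)
  let ?P = "partial_basis_complex n :: (nat \<Rightarrow> 'a) set set" and ?M = "vecs n :: (nat \<Rightarrow> 'a) set"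
  show conn: "cx_connected (int n - int k) ?P" by (rule cx_connected_partial_basis_complex[OF assms(1,2)])
  assume k: "k = 2"
  have sr: "SR TYPE('a) 2" using assms(2) k by simp
  have Pc: "abstract_complex ?P" by (rule abstract_complex_partial_basis_complex)
  note um = vec.unimod_sr2[OF sr free_vecs assms(3)]
  have card_le: "card \<sigma> \<le> n" if "\<sigma> \<in> ?P" for \<sigma>
    using um(1) partial_basis_complex_unimod[OF that] by blast
  have ext: "\<exists>B\<in>?P. card B = n \<and> \<sigma> \<subseteq> B" if "\<sigma> = {} \<or> \<sigma> \<in> ?P" for \<sigma>
  proof -
    have "vec.unimod ?M \<sigma>" using that partial_basis_complex_unimod vec.unimod_empty by blast
    then obtain B where B: "vec.basis_of ?M B" "card B = n" "\<sigma> \<subseteq> B"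
      using um(2) by (auto simp: vec.partial_basis_def)
    then have "vec.partial_basis n ?M B" by (auto simp: vec.partial_basis_def)
    moreover have "B \<noteq> {}" using B(2) assms(3) by auto
    ultimately show ?thesis using partial_basis_complexI B by blast
  qed
  \<comment> \<open>For \<open>k = 2\<close> the size bound reads
    \<open>card \<tau> \<le> n\<close>, which every unimodular set satisfies, so the truncation
    removes nothing.\<close>
  have eq: "vec.unimod_complex 2 n ?M = ?P"
  proof (intro equalityI subsetI)
    fix \<tau> assume "\<tau> \<in> vec.unimod_complex 2 n ?M"
    then show "\<tau> \<in> ?P" using partial_basis_complexI[OF um(2)] by (auto simp: vec.unimod_complex_def)
  next
    fix \<tau> assume "\<tau> \<in> ?P"
    then show "\<tau> \<in> vec.unimod_complex 2 n ?M"
      using partial_basis_complex_unimod[of \<tau> n] um(1)[of \<tau>] by (auto simp: vec.unimod_complex_def)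
  qed
  show "cohen_macaulay (int n - 1) ?P"
    unfolding cohen_macaulay_def spherical_def
  proof (intro conjI ballI)
    have "\<exists>B\<in>?P. card B = n" using ext[of "{}"] by blast
    then show "cx_dim ?P (int n - 1)" using card_le unfolding cx_dim_def by auto
    show "cx_connected (int n - 1 - 1) ?P" using conn k by (simp add: algebra_simps)
    fix \<sigma> assume s: "\<sigma> \<in> ?P"
    have fs: "finite \<sigma>" using abstract_complexD(1)[OF Pc s] .
    let ?d = "int n - 1 - (int (card \<sigma>) - 1) - 1"
    have le: "card \<tau> + card \<sigma> \<le> n" "card \<tau> > 0" if "\<tau> \<in> link ?P \<sigma>" for \<tau>
    proof -
      have t: "\<tau> \<in> ?P" "\<tau> \<inter> \<sigma> = {}" "\<tau> \<union> \<sigma> \<in> ?P" using that by (auto simp: link_def)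
      have ft: "finite \<tau>" "\<tau> \<noteq> {}" using abstract_complexD(1,2)[OF Pc t(1)] by auto
      show "card \<tau> + card \<sigma> \<le> n" "card \<tau> > 0"
        using card_le[OF t(3)] card_Un_disjoint[OF ft(1) fs t(2)] ft by (auto simp: card_gt_0_iff)
    qed
    obtain B where B: "B \<in> ?P" "card B = n" "\<sigma> \<subseteq> B" using ext[of \<sigma>] s by blast
    have fB: "finite B" using abstract_complexD(1)[OF Pc B(1)] .
    have cB: "card (B - \<sigma>) = n - card \<sigma>" using card_Diff_subset[OF fs B(3)] B(2) by simp
    have top: "B - \<sigma> \<in> link ?P \<sigma>" if "card \<sigma> < n"
    proof -
      have "B - \<sigma> \<noteq> {}" using cB that by (metis card.empty zero_less_diff less_numeral_extra(3))
      then have "B - \<sigma> \<in> ?P" using abstract_complexD(3)[OF Pc B(1)] by blast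
      moreover have "B - \<sigma> \<union> \<sigma> = B" using B(3) by auto
      ultimately show ?thesis using B(1) by (auto simp: link_def)
    qed
    show "cx_dim (link ?P \<sigma>) ?d"
    proof (cases "card \<sigma> < n")
      case True
      have "int (card (B - \<sigma>)) = ?d + 1" using cB True by simp
      then show ?thesis using le(1) top[OF True] unfolding cx_dim_def by fastforce
    next
      case False
      \<comment> \<open>For a full basis the link is empty, and \<open>?d\<close> is -1, the
        dimension that \<open>cx_dim\<close> assigns to the empty complex.\<close>
      then have "card \<sigma> = n" using card_le[OF s] by simp
      moreover have "link ?P \<sigma> = {}" using le False by fastforce
      ultimately show ?thesis by (simp add: cx_dim_def)
    qed
    \<comment> \<open>With \<open>k = 2\<close> the degree in \<open>link_conn\<close> is exactly
      one below the dimension \<open>?d\<close> of the link.\<close>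
    have "cconn (int n - int 2 - int (card \<sigma>)) (link (vec.unimod_complex 2 n ?M) \<sigma>)"
      using vec.link_conn_all[OF order_refl sr, of n] free_vecs unit_vector_notin_vecs partial_basis_complex_unimod[OF s]
      unfolding vec.link_conn_def by (metis UNIV_I)
    then have "cconn (?d - 1) (link ?P \<sigma>)" unfolding eq by (simp add: algebra_simps)
    then show "cx_connected (?d - 1) (link ?P \<sigma>)"
      by (rule cconn_imp_cx_connected[OF abstract_complex_link[OF Pc]])
  qed
qed

end
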